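(* Suppose that $m\in O(n)$. Let $F:\{0,1\}^m\times\{0,1\}^n\to\{0,1\}^\ell$ be a function given by a quantum oracle and $g:\{0,1\}^n\to\{0,1\}^\ell$ a function given by a classical oracle, and write $f_i(\cdot)=F(i,\cdot)$. Assume that there is exactly one $i_0\in\{0,1\}^m$ such that $f_{i_0}\oplus g$ has a period, i.e. such that for some $s\in\{0,1\}^n\setminus\{0^n\}$ one has $(f_{i_0}\oplus g)(x)=(f_{i_0}\oplus g)(x\oplus s)$ for all $x\in\{0,1\}^n$, and assume that $$\max_{\substack{i\in\{0,1\}^m\setminus\{i_0\}\\ t\in\{0,1\}^n\setminus\{0^n\}}}\ \Pr_{x\gets\{0,1\}^n}\left[(f_i\oplus g)(x\oplus t)=(f_i\oplus g)(x)\right]\le\frac12 .$$ Let $c$ be a sufficiently large constant. Then the algorithm $\mathsf{Alg\text{-}ExpQ1}$ (with parameter $c$) finds $i_0$ with a probability in $\Theta(1)$ by making $O(2^n)$ classical queries to $g$ and $O(n2^{m/2})$ quantum queries to $F$. The offline computation of $\mathsf{Alg\text{-}ExpQ1}$ (all procedures excluding those that prepare the state $|\psi_g\rangle$) is done in time $O\left((n^3+nT_F)2^{m/2}\right)$, where $T_F$ is the time required to evaluate $F$ once.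
   Context: Quantum circuit model; time is the number of elementary operations. A quantum query to a function $h$ is one application of the unitary $|x\rangle|y\rangle\mapsto|x\rangle|y\oplus h(x)\rangle$; a classical query to $g$ at $y$ returns the value $g(y)$. $\Pr_{x\gets\{0,1\}^n}$ is over uniform $x$; $u\cdot x$ is the inner product modulo 2; $H$ is the Hadamard gate; $|-\rangle=\frac1{\sqrt2}(|0\rangle-|1\rangle)$; $\mathrm{Span}$ is over the field with two elements. The constant $c$ is a positive integer; how large it must be may depend on the constant implicit in $m\in O(n)$. For a function $h:\{0,1\}^n\to\{0,1\}^\ell$ put $|\psi_h\rangle=\left(2^{-n/2}\sum_{x\in\{0,1\}^n}|x\rangle|h(x)\rangle\right)^{\otimes cn}$. The unitary $\mathsf{test}$ acts on an $m$-qubit index register $|i\rangle$, $cn$ pairs of registers of $n$ and $\ell$ qubits (the registers of $|\psi_g\rangle$), and one qubit $|b\rangle$, as follows. (1) Using $cn$ queries to $F$, XOR $f_i(x_j)$ into the $\ell$-qubit register paired with $|x_j\rangle$, for each $j=1,\dots,cn$ (this maps $|i\rangle|\psi_g\rangle|b\rangle$ to $|i\rangle|\psi_{f_i\oplus g}\rangle|b\rangle$). (2) Apply $H^{\otimes n}$ to each of the $cn$ $n$-qubit registers. (3) On computational basis values $u_1,\dots,u_{cn}$ of the $n$-qubit registers, compute $d=\dim(\mathrm{Span}(u_1,\dots,u_{cn}))$, set $r=0$ if $d=n$ and $r=1$ if $d<n$, replace $b$ by $b\oplus r$, and uncompute $d$ and $r$. (4) Undo steps (2) and (1) (using $cn$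 further queries to $F$). Algorithm $\mathsf{Alg\text{-}ExpQ1}$ with parameter $c$. Online phase: prepare $|\psi_g\rangle$ by starting from $\left(2^{-n/2}\sum_x|x\rangle|0^\ell\rangle\right)^{\otimes cn}$ and, for each $y\in\{0,1\}^n$, classically querying $g(y)$ and applying, to each of the $cn$ pairs, the unitary which writes (XORs) $g(y)$ in the second register if the first register contains $y$. Offline phase: starting from $\left(2^{-m/2}\sum_{i\in\{0,1\}^m}|i\rangle\right)\otimes|\psi_g\rangle\otimes|-\rangle$, apply $\lfloor\pi/(4\arcsin(2^{-m/2}))\rfloor=O(2^{m/2})$ Grover iterations, each iteration being $-\left((H^{\otimes m}\mathcal S_0H^{\otimes m})\otimes I\right)\mathsf{test}$, where $\mathcal S_0$ maps $|0^m\rangle$ to $-|0^m\rangle$ and fixes every other computational basis state; then measure the index register and output the result. *)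

theory Defs
  imports
    "HOL-Probability.Probability"
    "HOL-Library.Z2"
    "Jordan_Normal_Form.DL_Rank"
begin

text \<open>
  The set of bit strings of length \<open>n\<close> is \<open>carrier_vec n\<close> over the two-element field \<open>bit\<close>, so that
  XOR of strings is vector addition and the all-zero string is \<open>0\<^sub>v n\<close>.
\<close>

definition has_period :: "nat \<Rightarrow> (bit vec \<Rightarrow> bit vec) \<Rightarrow> bool" where
  "has_period n h \<longleftrightarrow>
     (\<exists>s \<in> carrier_vec n - {0\<^sub>v n}. \<forall>x \<in> carrier_vec n. h x = h (x + s))"

definition span_dim :: "nat \<Rightarrow> bit vec set \<Rightarrow> nat" where
  "span_dim n U = vectorspace.dim class_ring
     ((module_vec TYPE(bit) n)
        \<lparr>carrier := LinearCombinations.module.span class_ring (module_vec TYPE(bit) n) U\<rparr>)"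

definition all_strings :: "nat \<Rightarrow> bit vec list" where
  "all_strings n = map (\<lambda>k. vec n (\<lambda>i. of_bool (bit k i))) [0..<2 ^ n]"

lemma set_all_strings: "set (all_strings n) = carrier_vec n"
proof
  show "set (all_strings n) \<subseteq> carrier_vec n"
    by (auto simp: all_strings_def)
  show "carrier_vec n \<subseteq> set (all_strings n)"
  proof
    fix x :: "bit vec" assume x: "x \<in> carrier_vec n"
    define bs where "bs = map (\<lambda>i. vec_index x i = 1) [0..<n]"
    define k :: nat where "k = horner_sum of_bool 2 bs"
    have "k < 2 ^ n"
      using horner_sum_of_bool_2_less[of bs] by (simp add: k_def bs_def)
    moreover have "x = vec n (\<lambda>i. of_bool (bit k i))"
    proof (rule eq_vecI)
      fix i assume "i < dim_vec (vec n (\<lambda>i. of_bool (bit k i) :: bit))"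
      then have i: "i < n" by simp
      then have "bit k i \<longleftrightarrow> vec_index x i = 1"
        unfolding k_def bit_horner_sum_bit_iff by (simp add: bs_def)
      with i show "vec_index x i = vec_index (vec n (\<lambda>i. of_bool (bit k i))) i"
        by (simp add: bit_not_one_iff)
    next
      show "dim_vec x = dim_vec (vec n (\<lambda>i. of_bool (bit k i) :: bit))"
        using x by simp
    qed
    ultimately show "x \<in> set (all_strings n)"
      unfolding all_strings_def by force
  qed
qed

lemma finite_carrier_vec_bit: "finite (carrier_vec n :: bit vec set)"
  by (metis List.finite_set set_all_strings)


section \<open>Circuits\<close>

text \<open>
  Wires: \<open>Idx\<close> is the index register, \<open>Arg j\<close> and \<open>Val j\<close> are the two registers of the \<open>j\<close>-th pair,
  \<open>Flag\<close> is the qubit \<open>b\<close>, and \<open>Anc\<close> is an unlimited supply of ancillas, initially \<open>0\<close>.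
  A state is the family of its amplitudes in the computational basis. Although
  there are infinitely many wires, every state reached from a basis state has finite support.
\<close>

datatype wire = Idx nat | Arg nat nat | Val nat nat | Flag | Anc nat

type_synonym label = "wire \<Rightarrow> bit"
type_synonym state = "label \<Rightarrow> complex"

definition ket :: "label \<Rightarrow> state" where
  "ket v = (\<lambda>v'. if v' = v then 1 else 0)"

definition read :: "wire list \<Rightarrow> label \<Rightarrow> bit vec" where
  "read ws v = vec_of_list (map v ws)"

definition xor_into :: "wire list \<Rightarrow> bit vec \<Rightarrow> label \<Rightarrow> label" where
  "xor_into ws z v = fold (\<lambda>(w, b) v. v(w := v w + b)) (zip ws (list_of_vec z)) v"

definition idx_reg :: "nat \<Rightarrow> wire list" where
  "idx_reg m = map Idx [0..<m]"

definition arg_reg :: "nat \<Rightarrow> nat \<Rightarrow> wire list" where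
  "arg_reg n j = map (Arg j) [0..<n]"

definition val_reg :: "nat \<Rightarrow> nat \<Rightarrow> wire list" where
  "val_reg l j = map (Val j) [0..<l]"

text \<open>The elementary operations form a finite universal gate set.\<close>

datatype gate =
    Hadamard wire
  | PauliX wire
  | PhaseT wire
  | CNOT wire wire
  | Toffoli wire wire wire

fun wf_gate :: "gate \<Rightarrow> bool" where
  "wf_gate (CNOT a b) \<longleftrightarrow> a \<noteq> b"
| "wf_gate (Toffoli a b c) \<longleftrightarrow> a \<noteq> b \<and> a \<noteq> c \<and> b \<noteq> c"
| "wf_gate _ \<longleftrightarrow> True"

text \<open>
  A unitary permuting the basis labels by \<open>\<pi>\<close> sends \<open>\<psi>\<close> to \<open>\<psi> \<circ> inv \<pi>\<close>; all the permutations below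
  are involutions, whence \<open>\<psi> \<circ> \<pi>\<close>.
\<close>

fun gate_sem :: "gate \<Rightarrow> state \<Rightarrow> state" where
  "gate_sem (Hadamard w) \<psi> =
     (\<lambda>v. (\<psi> (v(w := 0)) + (if v w = 0 then 1 else -1) * \<psi> (v(w := 1))) / sqrt 2)"
| "gate_sem (PauliX w) \<psi> = (\<lambda>v. \<psi> (v(w := v w + 1)))"
| "gate_sem (PhaseT w) \<psi> = (\<lambda>v. (if v w = 0 then 1 else cis (pi / 4)) * \<psi> v)"
| "gate_sem (CNOT a b) \<psi> = (\<lambda>v. \<psi> (v(b := v b + v a)))"
| "gate_sem (Toffoli a b c) \<psi> = (\<lambda>v. \<psi> (v(c := v c + v a * v b)))"

type_synonym f_oracle = "bit vec \<Rightarrow> bit vec \<Rightarrow> bit vec"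
type_synonym g_oracle = "bit vec \<Rightarrow> bit vec"

text \<open>\<open>Query is xs ys\<close> is a quantum query: it XORs \<open>F(i, x)\<close> into the wires \<open>ys\<close>.\<close>

datatype op = Gate gate | Query "wire list" "wire list" "wire list"

fun op_sem :: "f_oracle \<Rightarrow> op \<Rightarrow> state \<Rightarrow> state" where
  "op_sem F (Gate G) \<psi> = gate_sem G \<psi>"
| "op_sem F (Query is xs ys) \<psi> = (\<lambda>v. \<psi> (xor_into ys (F (read is v) (read xs v)) v))"

fun op_queries :: "op \<Rightarrow> nat" where
  "op_queries (Gate _) = 0"
| "op_queries (Query _ _ _) = 1"

fun op_time :: "nat \<Rightarrow> op \<Rightarrow> nat" where
  "op_time T\<^sub>F (Gate _) = 1"
| "op_time T\<^sub>F (Query _ _ _) = T\<^sub>F"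

text \<open>
  Programs access \<open>g\<close> only through \<open>Ask y P\<close>, which continues as \<open>P z\<close> where \<open>z = g y\<close> is the answer
  of a classical query. \<open>CondXor xs ys y z\<close> writes \<open>z\<close> into the register \<open>ys\<close> if the register \<open>xs\<close>
  contains \<open>y\<close>.
\<close>

datatype prog =
    Stop
  | Do op prog
  | CondXor "wire list" "wire list" "bit vec" "bit vec" prog
  | Ask "bit vec" "bit vec \<Rightarrow> prog"

primrec run :: "f_oracle \<Rightarrow> g_oracle \<Rightarrow> prog \<Rightarrow> state \<Rightarrow> state" where
  "run F g Stop = (\<lambda>\<psi>. \<psi>)"
| "run F g (Do u P) = (\<lambda>\<psi>. run F g P (op_sem F u \<psi>))"
| "run F g (CondXor xs ys y z P) =
     (\<lambda>\<psi>. run F g P (\<lambda>v. \<psi> (if read xs v = y then xor_into ys z v else v)))"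
| "run F g (Ask y P) = (\<lambda>\<psi>. run F g (P (g y)) \<psi>)"

primrec classical_queries :: "g_oracle \<Rightarrow> prog \<Rightarrow> nat" where
  "classical_queries g Stop = 0"
| "classical_queries g (Do u P) = classical_queries g P"
| "classical_queries g (CondXor xs ys y z P) = classical_queries g P"
| "classical_queries g (Ask y P) = Suc (classical_queries g (P (g y)))"

primrec quantum_queries :: "g_oracle \<Rightarrow> prog \<Rightarrow> nat" where
  "quantum_queries g Stop = 0"
| "quantum_queries g (Do u P) = op_queries u + quantum_queries g P"
| "quantum_queries g (CondXor xs ys y z P) = quantum_queries g P"
| "quantum_queries g (Ask y P) = quantum_queries g (P (g y))"


section \<open>The two subroutines without oracle access\<close>

definition clean :: "label \<Rightarrow> bool" where
  "clean v \<longleftrightarrow> (\<forall>k. v (Anc k) = 0)"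

text \<open>
  \<open>rk\<close> implements step (3) of \<open>test\<close> on \<open>N\<close> pairs of registers: it XORs \<open>r\<close> into the flag and leaves
  everything else, including the ancillas, as it was.
\<close>

definition rank_circuit :: "nat \<Rightarrow> nat \<Rightarrow> gate list \<Rightarrow> bool" where
  "rank_circuit n N rk \<longleftrightarrow> list_all wf_gate rk \<and>
     (\<forall>v. clean v \<longrightarrow>
        fold gate_sem rk (ket v) =
          ket (v(Flag := v Flag +
            (if span_dim n ((\<lambda>j. read (arg_reg n j) v) ` {..<N}) = n then 0 else 1))))"

text \<open>
  \<open>rf\<close> implements \<open>- S\<^sub>0\<close> on the index register: the scalar \<open>-1\<close> in front of the Grover iteration
  is absorbed here.
\<close>

definition reflection_circuit :: "nat \<Rightarrow> gate list \<Rightarrow> bool" where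
  "reflection_circuit m rf \<longleftrightarrow> list_all wf_gate rf \<and>
     (\<forall>v. clean v \<longrightarrow>
        fold gate_sem rf (ket v) =
          (\<lambda>v'. (if read (idx_reg m) v = 0\<^sub>v m then 1 else -1) * ket v v'))"


section \<open>The algorithm\<close>

definition hadamards :: "wire list \<Rightarrow> op list" where
  "hadamards ws = map (\<lambda>w. Gate (Hadamard w)) ws"

text \<open>
  The online phase prepares \<open>|\<psi>\<^sub>g\<rangle>\<close> on \<open>N\<close> pairs of registers and continues with \<open>P\<close>.
\<close>

definition online :: "nat \<Rightarrow> nat \<Rightarrow> nat \<Rightarrow> prog \<Rightarrow> prog" where
  "online n l N P =
     foldr Do (hadamards (concat (map (arg_reg n) [0..<N])))
       (foldr (\<lambda>y Q. Ask y (\<lambda>z.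
            foldr (\<lambda>j. CondXor (arg_reg n j) (val_reg l j) y z) [0..<N] Q))
          (all_strings n) P)"

text \<open>Every operation of steps (1) and (2) is an involution, so they are undone by reversing the list.\<close>

definition test :: "nat \<Rightarrow> nat \<Rightarrow> nat \<Rightarrow> nat \<Rightarrow> gate list \<Rightarrow> op list" where
  "test m n l N rk =
     (let steps12 = map (\<lambda>j. Query (idx_reg m) (arg_reg n j) (val_reg l j)) [0..<N]
                    @ hadamards (concat (map (arg_reg n) [0..<N]))
      in steps12 @ map Gate rk @ rev steps12)"

definition grover_iteration ::
    "nat \<Rightarrow> nat \<Rightarrow> nat \<Rightarrow> nat \<Rightarrow> gate list \<Rightarrow> gate list \<Rightarrow> op list" where
  "grover_iteration m n l N rk rf =
     test m n l N rk @ hadamards (idx_reg m) @ map Gate rf @ hadamards (idx_reg m)"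

definition iterations :: "nat \<Rightarrow> nat" where
  "iterations m = nat \<lfloor>pi / (4 * arcsin (2 powr (- (real m / 2))))\<rfloor>"

text \<open>The operations before the Grover iterations prepare the uniform superposition of indices and \<open>|-\<rangle>\<close>.\<close>

definition offline ::
    "nat \<Rightarrow> nat \<Rightarrow> nat \<Rightarrow> nat \<Rightarrow> gate list \<Rightarrow> gate list \<Rightarrow> op list" where
  "offline m n l N rk rf =
     hadamards (idx_reg m) @ [Gate (PauliX Flag)] @ [Gate (Hadamard Flag)]
     @ concat (replicate (iterations m) (grover_iteration m n l N rk rf))"

definition Alg_ExpQ1 ::
    "nat \<Rightarrow> nat \<Rightarrow> nat \<Rightarrow> nat \<Rightarrow> gate list \<Rightarrow> gate list \<Rightarrow> prog" where
  "Alg_ExpQ1 c m n l rk rf = online n l (c * n) (foldr Do (offline m n l (c * n) rk rf) Stop)"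

text \<open>Probability that measuring the index register at the end of \<open>P\<close>, started on all zeros, yields \<open>i\<close>.\<close>

definition outcome_prob :: "f_oracle \<Rightarrow> g_oracle \<Rightarrow> nat \<Rightarrow> prog \<Rightarrow> bit vec \<Rightarrow> real" where
  "outcome_prob F g m P i =
     (\<Sum>\<^sub>\<infinity>v \<in> {v. read (idx_reg m) v = i}. (cmod (run F g P (ket (\<lambda>_. 0)) v))\<^sup>2)"

text \<open>The summand \<open>m\<close> is the final measurement of the \<open>m\<close> index qubits.\<close>

definition offline_time ::
    "nat \<Rightarrow> nat \<Rightarrow> nat \<Rightarrow> nat \<Rightarrow> nat \<Rightarrow> gate list \<Rightarrow> gate list \<Rightarrow> nat" where
  "offline_time T\<^sub>F c m n l rk rf =
     sum_list (map (op_time T\<^sub>F) (offline m n l (c * n) rk rf)) + m"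

end

theory Submission
  imports Defs
begin

text \<open>
  The state before the final measurement is compared with the state of an ideal Grover search in
  which step (3) of \<open>test\<close> is replaced by an exact phase flip of \<open>i0\<close>. Write \<open>h i = F i + g\<close>. After steps
  (1) and (2) each of the \<open>c n\<close> pairs carries the Fourier amplitudes of \<open>h i\<close>. If \<open>h i\<close> has a period \<open>s\<close>,
  only strings \<open>u\<close> with \<open>u \<bullet> s = 0\<close> occur, so the rank is always deficient and the flip is exact.
  Otherwise a fixed \<open>t \<noteq> 0\<close> is orthogonal to \<open>u\<close> with probability
  \<open>(1 + Pr[h i (x + t) = h i x]) / 2 \<le> 3/4\<close>, so by a union bound over \<open>t\<close> the rank is deficient with
  probability at most \<open>2\<^sup>n (3/4)\<^sup>c\<^sup>n\<close>. All steps are isometries, so the errors of the \<open>O(2\<^sup>m\<^sup>/\<^sup>2)\<close>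
  iterations add up to at most \<open>\<pi>/2 \<cdot> (2\<^sup>m\<^sup>+\<^sup>n (3/4)\<^sup>c\<^sup>n)\<^sup>1\<^sup>/\<^sup>2\<close>, which is small once \<open>c\<close> is large compared with
  \<open>m / n\<close>, while the ideal search succeeds with probability at least \<open>1/2\<close>.
  The rank is computed reversibly by Gaussian elimination with fresh ancillas and \<open>O(c n\<^sup>3)\<close> gates.
\<close>

text \<open>Both subroutines are specified only on basis states with clean ancillas, and a state is
  a function on infinitely many labels. All states are therefore kept supported on the finite set
  \<open>labels\<close>, where the ancillas are zero, and linearity extends the specifications to
  that space. The comparison needs a state that is known exactly between iterations. Undoing steps
  (1) and (2) provides it: after an exact flip the pairs are back in their prepared state and
  independent of the index, so the ideal state stays a product in which only the index amplitudes
  change, and these follow Grover's rotation in a plane. The flag is kept in the minus state so that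
  XORing the rank bit acts as a sign. The loss \<open>2 ^ n\<close> of the union bound, the factor
  from the number of iterations and the gain \<open>(3 / 4) ^ (c * n)\<close> are all exponential in
  \<open>n\<close>, so a single condition on \<open>c\<close> and \<open>a\<close> serves every
  \<open>n \<ge> 1\<close>.\<close>

no_notation inner (infix "\<bullet>" 70)
no_notation vec_nth (infixl "$" 90)

text \<open>Bits are treated as elements of a field; rewriting sums and products to bit operations
  would hide them from ring lemmas.\<close>

declare add_bit_eq_xor [simp del] mult_bit_eq_and [simp del]

section \<open>Full rank and annihilators\<close>

text \<open>A maximal independent \<open>S\<close> in \<open>U\<close> has the same span, hence the
  same annihilators, and as many elements as the dimension. Padding \<open>S\<close> with zero rows
  gives a square matrix whose kernel is the set of annihilators; its determinant is nonzero exactly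
  when there are no padded rows.\<close>

lemma dim_span_eq_iff_no_annihilator:
  fixes U :: "'a :: field vec set"
  assumes U: "U \<subseteq> carrier_vec n" and finU: "finite U"
  shows "vectorspace.dim class_ring ((module_vec TYPE('a) n)
        \<lparr>carrier := LinearCombinations.module.span class_ring (module_vec TYPE('a) n) U\<rparr>) = n \<longleftrightarrow>
    (\<forall>t \<in> carrier_vec n. (\<forall>u \<in> U. u \<bullet> t = 0) \<longrightarrow> t = 0\<^sub>v n)"
proof -
  interpret vec_space "TYPE('a)" n .
  have "lin_indpt {}" unfolding lin_dep_def by auto
  then obtain S where mx: "maximal S (\<lambda>T. T \<subseteq> U \<and> lin_indpt T)"
    using maximal_exists_superset[OF finU, where P = "\<lambda>T. T \<subseteq> U \<and> lin_indpt T" and B = "{}"]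
    by blast
  have SU: "S \<subseteq> U" and li: "lin_indpt S" using mx by (simp_all add: maximal_def)
  have S: "S \<subseteq> carrier_vec n" and finS: "finite S"
    using SU U finite_subset[OF SU finU] by auto
  have dim: "vectorspace.dim class_ring (span_vs U) = card S"
    using U by (intro dim_span[OF _ finU mx]) simp
  have card_le: "card S \<le> n"
    using li_le_dim(2)[OF fin_dim _ li] S dim_is_n by simp
  have "U \<subseteq> span S"
  proof
    fix u assume u: "u \<in> U"
    show "u \<in> span S"
    proof (rule ccontr)
      assume nu: "u \<notin> span S"
      then have "u \<notin> S" using S span_mem by auto
      moreover have "lin_indpt (S \<union> {u})"
        using lin_dep_iff_in_span[OF _ li _ \<open>u \<notin> S\<close>] u U S nu by auto
      ultimately show False
        using mx u SU unfolding maximal_def by blast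
    qed
  qed
  \<comment> \<open>The vectors orthogonal to a fixed \<open>t\<close> form a submodule, so
    orthogonality to \<open>S\<close> passes to its span.\<close>
  moreover have "span S \<subseteq> {x \<in> carrier_vec n. x \<bullet> t = 0}"
    if "t \<in> carrier_vec n" "\<forall>s \<in> S. s \<bullet> t = 0" for t
  proof (rule span_is_subset)
    show "S \<subseteq> {x \<in> carrier_vec n. x \<bullet> t = 0}" using that S by auto
    show "submodule class_ring {x \<in> carrier_vec n. x \<bullet> t = 0} V"
      using that(1) by (auto simp: submodule_def module_vec_simps class_ring_simps add_scalar_prod_distrib
          intro!: vec_module)
  qed
  ultimately have orth: "(\<forall>u \<in> U. u \<bullet> t = 0) \<longleftrightarrow> (\<forall>s \<in> S. s \<bullet> t = 0)"
    if "t \<in> carrier_vec n" for t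
    using that SU by blast
  obtain xs where xs: "set xs = S" "distinct xs"
    using finite_distinct_list[OF finS] by blast
  have len: "length xs = card S" using xs distinct_card by force
  define A where "A = mat_of_rows n (xs @ replicate (n - card S) (0\<^sub>v n))"
  have A: "A \<in> carrier_mat n n"
    using len card_le by (auto simp: A_def)
  have rowA: "row A i = (if i < card S then xs ! i else 0\<^sub>v n)" if "i < n" for i
  proof -
    have "row A i = (xs @ replicate (n - card S) (0\<^sub>v n)) ! i"
      unfolding A_def using that len S xs
      by (intro mat_of_rows_row) (auto simp: nth_append)
    then show ?thesis using that len by (simp add: nth_append)
  qed
  have ker: "A *\<^sub>v t = 0\<^sub>v n \<longleftrightarrow> (\<forall>s \<in> S. s \<bullet> t = 0)" if t: "t \<in> carrier_vec n" for t
  proof -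
    have "A *\<^sub>v t = 0\<^sub>v n \<longleftrightarrow> (\<forall>i < n. row A i \<bullet> t = 0)"
      using A t by (auto simp: vec_eq_iff)
    also have "\<dots> \<longleftrightarrow> (\<forall>i < card S. xs ! i \<bullet> t = 0)"
      using rowA card_le t by (auto simp: )
    also have "\<dots> \<longleftrightarrow> (\<forall>s \<in> S. s \<bullet> t = 0)"
      using xs len by (metis in_set_conv_nth)
    finally show ?thesis .
  qed
  have "card S = n \<longleftrightarrow> det A \<noteq> 0"
  proof
    assume c: "card S = n"
    have At: "transpose_mat A \<in> carrier_mat n n" using A by simp
    have cols: "cols (transpose_mat A) = xs"
      using c S xs by (simp add: A_def)
    have "rank (transpose_mat A) = n"
      using lin_indpt_full_rank[OF At] cols xs li by simp
    then show "det A \<noteq> 0"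
      using det_rank_iff[OF At] det_transpose[OF A] by simp
  next
    assume d: "det A \<noteq> 0"
    show "card S = n"
    proof (rule ccontr)
      assume "card S \<noteq> n"
      with card_le have lt: "card S < n" by simp
      have z: "row A (card S) = 0\<^sub>v n" using rowA lt by simp
      have "A $$ (card S, j) = 0" if "j < n" for j
      proof -
        have "A $$ (card S, j) = row A (card S) $ j"
          using A lt that by simp
        then show ?thesis using z that by simp
      qed
      then have "det A = 0"
        using laplace_expansion_row[OF A lt] by simp
      with d show False by simp
    qed
  qed
  also have "\<dots> \<longleftrightarrow> (\<forall>t \<in> carrier_vec n. (\<forall>s \<in> S. s \<bullet> t = 0) \<longrightarrow> t = 0\<^sub>v n)"
    using det_0_iff_vec_prod_zero_field[OF A] ker by blast
  finally show ?thesis using dim orth by simp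
qed

lemma span_dim_eq_iff:
  assumes "U \<subseteq> carrier_vec n" and "finite U"
  shows "span_dim n U = n \<longleftrightarrow>
    (\<forall>t \<in> carrier_vec n. (\<forall>u \<in> U. u \<bullet> t = 0) \<longrightarrow> t = 0\<^sub>v n)"
  unfolding span_dim_def using assms by (rule dim_span_eq_iff_no_annihilator)

section \<open>Classical reversible circuits\<close>

lemma bit_add_self [simp]: "(x :: bit) + x = 0"
  by (cases x) simp_all

lemma bit_add_self_left [simp]: "(x :: bit) + (x + y) = y"
  by (simp flip: add.assoc)

fun classical :: "gate \<Rightarrow> bool" where
  "classical (Hadamard w) \<longleftrightarrow> False"
| "classical (PhaseT w) \<longleftrightarrow> False"
| "classical _ \<longleftrightarrow> True"

fun perm :: "gate \<Rightarrow> label \<Rightarrow> label" where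
  "perm (PauliX w) v = v(w := v w + 1)"
| "perm (CNOT a b) v = v(b := v b + v a)"
| "perm (Toffoli a b c) v = v(c := v c + v a * v b)"
| "perm _ v = v"

fun wires :: "gate \<Rightarrow> wire set" where
  "wires (Hadamard w) = {w}"
| "wires (PauliX w) = {w}"
| "wires (PhaseT w) = {w}"
| "wires (CNOT a b) = {a, b}"
| "wires (Toffoli a b c) = {a, b, c}"

text \<open>\<open>Flag\<close> is excluded so that the flag can be changed between a computation
  and its inverse without disturbing either.\<close>

definition reversible :: "gate list \<Rightarrow> bool" where
  "reversible gs \<longleftrightarrow> list_all (\<lambda>G. wf_gate G \<and> classical G \<and> Flag \<notin> wires G) gs"

lemma reversible_simps [simp]:
  "reversible []"
  "reversible (G # gs) \<longleftrightarrow> wf_gate G \<and> classical G \<and> Flag \<notin> wires G \<and> reversible gs"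
  "reversible (gs @ hs) \<longleftrightarrow> reversible gs \<and> reversible hs"
  "reversible (rev gs) \<longleftrightarrow> reversible gs"
  "reversible (map f xs) \<longleftrightarrow> (\<forall>x \<in> set xs. reversible [f x])"
  "reversible (concat gss) \<longleftrightarrow> (\<forall>gs \<in> set gss. reversible gs)"
  by (auto simp: reversible_def list_all_iff)

lemma perm_perm: "wf_gate G \<Longrightarrow> perm G (perm G v) = v"
  by (cases G) (auto simp: add.assoc)

lemma perm_Flag: "Flag \<notin> wires G \<Longrightarrow> perm G (v(Flag := x)) = (perm G v)(Flag := x)"
  by (cases G) (auto simp: fun_upd_twist)

text \<open>Composing the amplitudes with \<open>perm G\<close> moves basis states by the inverse
  permutation, which is \<open>perm G\<close> again because it is an involution.\<close>

lemma gate_sem_ket: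
  assumes "wf_gate G" "classical G"
  shows "gate_sem G (ket v) = ket (perm G v)"
proof -
  have "gate_sem G \<psi> = (\<lambda>v'. \<psi> (perm G v'))" for \<psi>
    using assms by (cases G) auto
  moreover have "perm G v' = v \<longleftrightarrow> v' = perm G v" for v'
    using perm_perm[OF assms(1)] by metis
  ultimately show ?thesis
    by (simp add: ket_def)
qed

lemma fold_gate_sem_ket:
  "reversible gs \<Longrightarrow> fold gate_sem gs (ket v) = ket (fold perm gs v)"
  by (induction gs arbitrary: v) (auto simp: gate_sem_ket)

lemma uncompute_Flag:
  "reversible gs \<Longrightarrow> fold perm (rev gs) ((fold perm gs v)(Flag := x)) = v(Flag := x)"
proof (induction gs arbitrary: v)
  case (Cons G gs)
  have "fold perm (rev (G # gs)) ((fold perm (G # gs) v)(Flag := x)) =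
      perm G (fold perm (rev gs) ((fold perm gs (perm G v))(Flag := x)))"
    by simp
  also have "\<dots> = perm G ((perm G v)(Flag := x))"
    using Cons by (subst Cons.IH) simp_all
  also have "\<dots> = v(Flag := x)"
    using Cons.prems perm_Flag perm_perm by (metis reversible_simps(2))
  finally show ?case .
qed simp

lemma uncompute: "reversible gs \<Longrightarrow> fold perm (rev gs) (fold perm gs v) = v"
  by (induction gs arbitrary: v) (auto simp: perm_perm)

text \<open>Compute, copy, uncompute: the output is copied while it is available, and the reversed
  gates restore every other wire because none of them touches the flag. The \<open>PauliX\<close>
  negates the copy, so that an output 1 for full rank contributes \<open>r = 0\<close>.\<close>

lemma compute_Flag_uncompute:
  assumes "reversible gs" "w \<noteq> Flag"
  shows "fold gate_sem (gs @ [CNOT w Flag, PauliX Flag] @ rev gs) (ket v) =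
    ket (v(Flag := v Flag + fold perm gs v w + 1))"
proof -
  have "fold perm gs v Flag = v Flag"
    using assms(1)
  proof (induction gs arbitrary: v)
    case (Cons G gs)
    then show ?case by (cases G) auto
  qed simp
  then show ?thesis
    using assms by (simp add: fold_gate_sem_ket gate_sem_ket uncompute_Flag del: gate_sem.simps)
qed

section \<open>The rank circuit\<close>

text \<open>
  Row \<open>p\<close> of the matrix held in the wires \<open>basis_wire\<close> is zero or has its leading one in column \<open>p\<close>.
  To process column \<open>p\<close> of the string \<open>x\<close>, put \<open>w = x\<^sub>p\<close> and \<open>d = w (1 - B\<^sub>p\<^sub>p)\<close>, add \<open>d x\<close> to row \<open>p\<close> and
  then \<open>w\<close> times row \<open>p\<close> to \<open>x\<close>. This clears \<open>x\<^sub>p\<close>, inserting \<open>x\<close> as a new row if row \<open>p\<close> is still zero,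
  and does not change the span of \<open>x\<close> and the rows. Keeping every \<open>w\<close> and \<open>d\<close> in its own ancilla makes
  the whole computation reversible.
\<close>

definition basis_wire :: "nat \<Rightarrow> nat \<Rightarrow> wire" where
  "basis_wire p q = Anc (prod_encode (0, prod_encode (p, q)))"

definition pivot_wire :: "nat \<Rightarrow> nat \<Rightarrow> wire" where
  "pivot_wire j p = Anc (prod_encode (1, prod_encode (j, p)))"

definition insert_wire :: "nat \<Rightarrow> nat \<Rightarrow> wire" where
  "insert_wire j p = Anc (prod_encode (2, prod_encode (j, p)))"

definition and_wire :: "nat \<Rightarrow> wire" where
  "and_wire p = Anc (prod_encode (3, p))"

text \<open>The tag in the first component of \<open>prod_encode\<close> keeps the four families of
  ancillas apart.\<close>

lemma ancilla_simps [simp]: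
  "basis_wire p q = basis_wire p' q' \<longleftrightarrow> p = p' \<and> q = q'" "pivot_wire j p = pivot_wire j' p' \<longleftrightarrow> j = j' \<and> p = p'"
  "insert_wire j p = insert_wire j' p' \<longleftrightarrow> j = j' \<and> p = p'" "and_wire p = and_wire p' \<longleftrightarrow> p = p'"
  "basis_wire p q \<noteq> pivot_wire j r" "pivot_wire j r \<noteq> basis_wire p q" "basis_wire p q \<noteq> insert_wire j r" "insert_wire j r \<noteq> basis_wire p q" "basis_wire p q \<noteq> and_wire r" "and_wire r \<noteq> basis_wire p q"
  "pivot_wire j p \<noteq> insert_wire j' r" "insert_wire j' r \<noteq> pivot_wire j p" "pivot_wire j p \<noteq> and_wire r" "and_wire r \<noteq> pivot_wire j p" "insert_wire j p \<noteq> and_wire r" "and_wire r \<noteq> insert_wire j p"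
  "basis_wire p q \<noteq> Arg i s" "Arg i s \<noteq> basis_wire p q" "pivot_wire j p \<noteq> Arg i s" "Arg i s \<noteq> pivot_wire j p"
  "insert_wire j p \<noteq> Arg i s" "Arg i s \<noteq> insert_wire j p" "and_wire p \<noteq> Arg i s" "Arg i s \<noteq> and_wire p"
  "basis_wire p q \<noteq> Flag" "Flag \<noteq> basis_wire p q" "pivot_wire j p \<noteq> Flag" "Flag \<noteq> pivot_wire j p"
  "insert_wire j p \<noteq> Flag" "Flag \<noteq> insert_wire j p" "and_wire p \<noteq> Flag" "Flag \<noteq> and_wire p"
  by (auto simp: basis_wire_def pivot_wire_def insert_wire_def and_wire_def prod_encode_eq)

text \<open>In characteristic two \<open>w (1 - B)\<close> is \<open>w + w B\<close>, hence one CNOT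
  and one Toffoli gate for \<open>d\<close>. Row \<open>p\<close> receives \<open>d x\<close> before
  it is added to \<open>x\<close>, so a newly inserted string cancels itself.\<close>

definition elim_step :: "nat \<Rightarrow> nat \<Rightarrow> nat \<Rightarrow> gate list" where
  "elim_step n j p =
     [CNOT (Arg j p) (pivot_wire j p), CNOT (pivot_wire j p) (insert_wire j p), Toffoli (pivot_wire j p) (basis_wire p p) (insert_wire j p)]
     @ map (\<lambda>q. Toffoli (insert_wire j p) (Arg j q) (basis_wire p q)) [0..<n]
     @ map (\<lambda>q. Toffoli (pivot_wire j p) (basis_wire p q) (Arg j q)) [0..<n]"

definition eliminate :: "nat \<Rightarrow> nat \<Rightarrow> gate list" where
  "eliminate n N = concat (map (\<lambda>j. concat (map (elim_step n j) [0..<n])) [0..<N])"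

definition and_chain :: "nat \<Rightarrow> gate list" where
  "and_chain n = PauliX (and_wire 0) # map (\<lambda>p. Toffoli (and_wire p) (basis_wire p p) (and_wire (Suc p))) [0..<n]"

definition rank_gates :: "nat \<Rightarrow> nat \<Rightarrow> gate list" where
  "rank_gates n N = (let gs = eliminate n N @ and_chain n in
     gs @ [CNOT (and_wire n) Flag, PauliX Flag] @ rev gs)"

text \<open>The targets are distinct and differ from the control and all sources. Hence no gate
  reads a wire written by another, and all act on the original values at once.\<close>

lemma fold_toffoli:
  assumes "inj_on Y {..<k}" "c \<notin> Y ` {..<k}" "X ` {..<k} \<inter> Y ` {..<k} = {}"
  shows "fold perm (map (\<lambda>q. Toffoli c (X q) (Y q)) [0..<k]) v w =
    (if w \<in> Y ` {..<k} then v w + v c * v (X (inv_into {..<k} Y w)) else v w)"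
proof -
  let ?v = "\<lambda>k. fold perm (map (\<lambda>q. Toffoli c (X q) (Y q)) [0..<k]) v"
  have *: "(\<forall>q<m. ?v m (Y q) = v (Y q) + v c * v (X q)) \<and> (\<forall>w. w \<notin> Y ` {..<m} \<longrightarrow> ?v m w = v w)"
    if "m \<le> k" for m
    using that
  proof (induction m)
    case (Suc m)
    have Y: "Y q \<noteq> Y m" if "q < m" for q
      using inj_onD[OF assms(1), of q m] that Suc.prems by auto
    have "?v m c = v c" "?v m (X m) = v (X m)" "?v m (Y m) = v (Y m)"
    proof -
      have "c \<notin> Y ` {..<m}" "X m \<notin> Y ` {..<m}" "Y m \<notin> Y ` {..<m}"
      proof -
        have "Y ` {..<m} \<subseteq> Y ` {..<k}" "X m \<in> X ` {..<k}"
          using Suc.prems by auto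
        then show "c \<notin> Y ` {..<m}" "X m \<notin> Y ` {..<m}"
          using assms(2,3) by blast+
        show "Y m \<notin> Y ` {..<m}"
          using Y by (metis imageE lessThan_iff)
      qed
      then show "?v m c = v c" "?v m (X m) = v (X m)" "?v m (Y m) = v (Y m)"
        using Suc by auto
    qed
    then show ?case
      using Suc Y by (auto simp: less_Suc_eq lessThan_Suc)
  qed simp
  show ?thesis
  proof (cases "w \<in> Y ` {..<k}")
    case True
    then obtain q where "q < k" "w = Y q" by auto
    then show ?thesis using *[of k] assms(1) by simp
  qed (use *[of k] in simp)
qed

text \<open>Row \<open>p\<close> occurs in its new state in the second equation because
  \<open>x\<close> is reduced by the row already updated.\<close>

lemma elim_step_effect:
  fixes v :: label
  assumes p: "p < n" and pivot_wire: "v (pivot_wire j p) = 0" and insert_wire: "v (insert_wire j p) = 0"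
  defines "v' \<equiv> fold perm (elim_step n j p) v"
  shows "q < n \<Longrightarrow> v' (basis_wire p q) =
      v (basis_wire p q) + (v (Arg j p) + v (Arg j p) * v (basis_wire p p)) * v (Arg j q)"
    and "q < n \<Longrightarrow> v' (Arg j q) = v (Arg j q) + v (Arg j p) * v' (basis_wire p q)"
    and "i \<noteq> p \<Longrightarrow> v' (basis_wire i q) = v (basis_wire i q)"
    and "i \<noteq> j \<Longrightarrow> v' (Arg i q) = v (Arg i q)"
    and "i \<noteq> j \<or> q \<noteq> p \<Longrightarrow> v' (pivot_wire i q) = v (pivot_wire i q)"
    and "i \<noteq> j \<or> q \<noteq> p \<Longrightarrow> v' (insert_wire i q) = v (insert_wire i q)"
    and "v' (and_wire i) = v (and_wire i)"
proof -
  define v1 where "v1 = v(pivot_wire j p := v (Arg j p), insert_wire j p := v (Arg j p) + v (Arg j p) * v (basis_wire p p))"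
  define v2 where "v2 = fold perm (map (\<lambda>q. Toffoli (insert_wire j p) (Arg j q) (basis_wire p q)) [0..<n]) v1"
  have "v' = fold perm (map (\<lambda>q. Toffoli (pivot_wire j p) (basis_wire p q) (Arg j q)) [0..<n]) v2"
    using pivot_wire insert_wire by (simp add: v'_def v2_def v1_def elim_step_def)
  then have v': "v' w = (if w \<in> Arg j ` {..<n}
      then v2 w + v2 (pivot_wire j p) * v2 (basis_wire p (inv_into {..<n} (Arg j) w)) else v2 w)" for w
    unfolding \<open>v' = _\<close> by (subst fold_toffoli) (auto simp: inj_on_def)
  have v2: "v2 w = (if w \<in> basis_wire p ` {..<n}
      then v1 w + v1 (insert_wire j p) * v1 (Arg j (inv_into {..<n} (basis_wire p) w)) else v1 w)" for w
    unfolding v2_def by (subst fold_toffoli) (auto simp: inj_on_def)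
  have inv1: "inv_into {..<n} (Arg j) (Arg j q) = q" if "q < n" for q
    using that by (intro inv_into_f_f) (auto simp: inj_on_def)
  have inv2: "inv_into {..<n} (basis_wire p) (basis_wire p q) = q" if "q < n" for q
    using that by (intro inv_into_f_f) (auto simp: inj_on_def)
  show "q < n \<Longrightarrow> v' (basis_wire p q) =
      v (basis_wire p q) + (v (Arg j p) + v (Arg j p) * v (basis_wire p p)) * v (Arg j q)"
    by (auto simp: v' v2 inv2) (simp_all add: v1_def)
  show "q < n \<Longrightarrow> v' (Arg j q) = v (Arg j q) + v (Arg j p) * v' (basis_wire p q)"
    by (auto simp: v' v2 inv1 inv2) (simp_all add: v1_def)
  show "i \<noteq> p \<Longrightarrow> v' (basis_wire i q) = v (basis_wire i q)" "i \<noteq> j \<Longrightarrow> v' (Arg i q) = v (Arg i q)"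
    "i \<noteq> j \<or> q \<noteq> p \<Longrightarrow> v' (pivot_wire i q) = v (pivot_wire i q)"
    "i \<noteq> j \<or> q \<noteq> p \<Longrightarrow> v' (insert_wire i q) = v (insert_wire i q)" "v' (and_wire i) = v (and_wire i)"
    by (auto simp: v' v2 v1_def)
qed

section \<open>Invariants of the elimination\<close>

definition echelon :: "nat \<Rightarrow> label \<Rightarrow> bool" where
  "echelon n v \<longleftrightarrow> (\<forall>i<n. \<forall>q<i. v (basis_wire i q) = 0) \<and>
     (\<forall>i<n. v (basis_wire i i) = 0 \<longrightarrow> (\<forall>q<n. v (basis_wire i q) = 0))"

definition dot :: "nat \<Rightarrow> (nat \<Rightarrow> bit) \<Rightarrow> (nat \<Rightarrow> bit) \<Rightarrow> bit" where
  "dot n x t = (\<Sum>q<n. x q * t q)"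

text \<open>The row space is tracked only through its orthogonal complement: row operations act on
  dot products by simple algebra, and \<open>span_dim_eq_iff\<close> recovers the rank condition
  from it.\<close>

definition annihilates :: "nat \<Rightarrow> label \<Rightarrow> (nat \<Rightarrow> bit) \<Rightarrow> bool" where
  "annihilates n v t \<longleftrightarrow> (\<forall>i<n. dot n (\<lambda>q. v (basis_wire i q)) t = 0)"

lemma dot_add_scaled:
  assumes "\<And>q. q < n \<Longrightarrow> z q = x q + a * y q"
  shows "dot n z t = dot n x t + a * dot n y t"
proof -
  have "dot n z t = (\<Sum>q<n. x q * t q + a * (y q * t q))"
    unfolding dot_def using assms by (intro sum.cong) (simp_all add: distrib_right mult.assoc)
  then show ?thesis
    by (simp add: dot_def sum.distrib sum_distrib_left)
qed

definition fresh :: "label \<Rightarrow> nat \<Rightarrow> nat \<Rightarrow> bool" where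
  "fresh v j p \<longleftrightarrow> (\<forall>j' p'. j < j' \<or> j' = j \<and> p \<le> p' \<longrightarrow> v (pivot_wire j' p') = 0 \<and> v (insert_wire j' p') = 0)
     \<and> (\<forall>i. v (and_wire i) = 0)"

text \<open>The step consists of two elementary row operations on row \<open>p\<close> and
  \<open>x\<close>, which do not change the common solutions of the linear equations that the rows
  define.\<close>

lemma elim_step_invariant:
  fixes v :: label
  assumes p: "p < n" and fr: "fresh v j p" and ech: "echelon n v"
    and x0: "\<forall>q<p. v (Arg j q) = 0"
  defines "v' \<equiv> fold perm (elim_step n j p) v"
  shows "fresh v' j (Suc p)" "echelon n v'" "\<forall>q<Suc p. v' (Arg j q) = 0"
    "annihilates n v' t \<and> dot n (\<lambda>q. v' (Arg j q)) t = 0 \<longleftrightarrow>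
       annihilates n v t \<and> dot n (\<lambda>q. v (Arg j q)) t = 0"
    "\<forall>i. i \<noteq> j \<longrightarrow> (\<forall>q. v' (Arg i q) = v (Arg i q))"
proof -
  have WD: "v (pivot_wire j p) = 0" "v (insert_wire j p) = 0"
    using fr by (simp_all add: fresh_def)
  note eff = elim_step_effect[OF p, of v j, OF WD, folded v'_def]
  define w where "w = v (Arg j p)"
  define d where "d = w + w * v (basis_wire p p)"
  have Bp: "v' (basis_wire p q) = v (basis_wire p q) + d * v (Arg j q)" if "q < n" for q
    using eff(1)[OF that] by (simp add: d_def w_def)
  have Aj: "v' (Arg j q) = v (Arg j q) + w * v' (basis_wire p q)" if "q < n" for q
    using eff(2)[OF that] by (simp add: w_def)
  \<comment> \<open>Either \<open>x\<close> has a zero in column \<open>p\<close>, or the existing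
    row \<open>p\<close> clears it, or row \<open>p\<close> is zero and becomes \<open>x\<close>,
    which then cancels itself.\<close>
  have d_cases: "w = 0 \<and> d = 0 \<or> w = 1 \<and> d = 0 \<and> v (basis_wire p p) = 1 \<or> w = 1 \<and> d = 1 \<and> v (basis_wire p p) = 0"
    by (cases w; cases "v (basis_wire p p)") (simp_all add: d_def)
  show "fresh v' j (Suc p)"
    using fr eff(5,6,7) by (auto simp: fresh_def)
  have Bpp: "\<forall>q<n. v (basis_wire p q) = 0" if "v (basis_wire p p) = 0"
    using ech p that by (simp add: echelon_def)
  show "echelon n v'"
    unfolding echelon_def
  proof (intro conjI allI impI)
    fix i q assume "i < n" "q < i"
    then show "v' (basis_wire i q) = 0"
      using Bp[of q] eff(3)[of i q] ech x0 p by (cases "i = p") (auto simp: echelon_def)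
  next
    fix i q assume i: "i < n" and z: "v' (basis_wire i i) = 0" and q: "q < n"
    show "v' (basis_wire i q) = 0"
    proof (cases "i = p")
      case True
      then show ?thesis
        using z q d_cases Bp[OF p] Bp[OF q] Bpp by (auto simp: w_def)
    next
      case False
      then show ?thesis using z q i eff(3)[of i] ech by (auto simp: echelon_def)
    qed
  qed
  show "\<forall>q<Suc p. v' (Arg j q) = 0"
  proof (intro allI impI)
    fix q assume q: "q < Suc p"
    then have "q < n" using p by simp
    show "v' (Arg j q) = 0"
    proof (cases "q = p")
      case True
      then show ?thesis using Aj[OF p] Bp[OF p] d_cases by (auto simp: w_def)
    next
      case False
      then have "q < p" using q by simp
      moreover from this have "v (basis_wire p q) = 0" using ech p by (simp add: echelon_def)
      ultimately show ?thesis using Aj[OF \<open>q < n\<close>] Bp[OF \<open>q < n\<close>] x0 by simp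
    qed
  qed
  have dB: "dot n (\<lambda>q. v' (basis_wire p q)) t = dot n (\<lambda>q. v (basis_wire p q)) t + d * dot n (\<lambda>q. v (Arg j q)) t"
    using Bp by (rule dot_add_scaled)
  have dA: "dot n (\<lambda>q. v' (Arg j q)) t =
      dot n (\<lambda>q. v (Arg j q)) t + w * dot n (\<lambda>q. v' (basis_wire p q)) t"
    using Aj by (rule dot_add_scaled)
  have dB': "dot n (\<lambda>q. v' (basis_wire i q)) t = dot n (\<lambda>q. v (basis_wire i q)) t" if "i \<noteq> p" for i
    using eff(3)[OF that] by simp
  have split: "annihilates n u t \<longleftrightarrow> dot n (\<lambda>q. u (basis_wire p q)) t = 0 \<and>
      (\<forall>i<n. i \<noteq> p \<longrightarrow> dot n (\<lambda>q. u (basis_wire i q)) t = 0)" for u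
    using p by (auto simp: annihilates_def)
  show "annihilates n v' t \<and> dot n (\<lambda>q. v' (Arg j q)) t = 0 \<longleftrightarrow>
       annihilates n v t \<and> dot n (\<lambda>q. v (Arg j q)) t = 0"
    unfolding split using dB dA dB' by auto
  show "\<forall>i. i \<noteq> j \<longrightarrow> (\<forall>q. v' (Arg i q) = v (Arg i q))"
    using eff(4) by blast
qed

lemma eliminate_row:
  fixes v :: label
  assumes fr: "fresh v j 0" and ech: "echelon n v"
  defines "v' \<equiv> fold perm (concat (map (elim_step n j) [0..<n])) v"
  shows "fresh v' (Suc j) 0" "echelon n v'"
    "annihilates n v' t \<longleftrightarrow> annihilates n v t \<and> dot n (\<lambda>q. v (Arg j q)) t = 0"
    "\<forall>i. i \<noteq> j \<longrightarrow> (\<forall>q. v' (Arg i q) = v (Arg i q))"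
proof -
  let ?v = "\<lambda>p. fold perm (concat (map (elim_step n j) [0..<p])) v"
  have *: "fresh (?v p) j p \<and> echelon n (?v p) \<and> (\<forall>q<p. ?v p (Arg j q) = 0) \<and>
      (\<forall>t. annihilates n (?v p) t \<and> dot n (\<lambda>q. ?v p (Arg j q)) t = 0 \<longleftrightarrow>
       annihilates n v t \<and> dot n (\<lambda>q. v (Arg j q)) t = 0) \<and>
      (\<forall>i. i \<noteq> j \<longrightarrow> (\<forall>q. ?v p (Arg i q) = v (Arg i q)))" if "p \<le> n" for p
    using that
  proof (induction p)
    case 0
    then show ?case using fr ech by simp
  next
    case (Suc p)
    then have p: "p < n" and IH: "fresh (?v p) j p" "echelon n (?v p)" "\<forall>q<p. ?v p (Arg j q) = 0"
      by auto
    have "?v (Suc p) = fold perm (elim_step n j p) (?v p)" by simp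
    with elim_step_invariant[OF p IH] Suc show ?case by auto
  qed
  \<comment> \<open>After all \<open>n\<close> columns \<open>x\<close> is zero and its equation is
    trivial, so the rows alone carry the old equations and that of the original
    \<open>x\<close>.\<close>
  from *[of n] have "dot n (\<lambda>q. v' (Arg j q)) t = 0" for t
    by (simp add: v'_def dot_def)
  with *[of n] show "fresh v' (Suc j) 0" "echelon n v'"
    "annihilates n v' t \<longleftrightarrow> annihilates n v t \<and> dot n (\<lambda>q. v (Arg j q)) t = 0"
    "\<forall>i. i \<noteq> j \<longrightarrow> (\<forall>q. v' (Arg i q) = v (Arg i q))"
    by (auto simp: v'_def fresh_def)
qed

lemma eliminate_correct:
  fixes v :: label and n N :: nat
  assumes "clean v"
  defines "v' \<equiv> fold perm (eliminate n N) v"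
  shows "echelon n v'" "annihilates n v' t \<longleftrightarrow> (\<forall>j<N. dot n (\<lambda>q. v (Arg j q)) t = 0)"
    "\<And>i. v' (and_wire i) = 0"
proof -
  let ?v = "\<lambda>j. fold perm (eliminate n j) v"
  \<comment> \<open>The last clause records that strings not yet processed still hold their input
    values.\<close>
  have *: "fresh (?v j) j 0 \<and> echelon n (?v j) \<and>
      (\<forall>t. annihilates n (?v j) t \<longleftrightarrow> (\<forall>i<j. dot n (\<lambda>q. v (Arg i q)) t = 0)) \<and>
      (\<forall>i\<ge>j. \<forall>q. ?v j (Arg i q) = v (Arg i q))" for j
  proof (induction j)
    case 0
    then show ?case using assms(1)
      by (auto simp: eliminate_def clean_def fresh_def echelon_def annihilates_def dot_def
          and_wire_def basis_wire_def pivot_wire_def insert_wire_def)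
  next
    case (Suc j)
    then have IH: "fresh (?v j) j 0" "echelon n (?v j)" by auto
    have "?v (Suc j) = fold perm (concat (map (elim_step n j) [0..<n])) (?v j)"
      by (simp add: eliminate_def)
    with eliminate_row[OF IH] Suc show ?case by (auto simp: less_Suc_eq)
  qed
  from *[of N] show "echelon n v'" "annihilates n v' t \<longleftrightarrow> (\<forall>j<N. dot n (\<lambda>q. v (Arg j q)) t = 0)"
    "\<And>i. v' (and_wire i) = 0"
    by (auto simp: v'_def fresh_def)
qed

lemma and_chain_correct:
  assumes "\<And>i. v (and_wire i) = 0"
  shows "fold perm (and_chain n) v (and_wire n) = (if \<forall>p<n. v (basis_wire p p) = 1 then 1 else 0)"
proof -
  have "fold perm (and_chain n) v (and_wire n) = (if \<forall>p<n. v (basis_wire p p) = 1 then 1 else 0) \<and>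
    (\<forall>p q. fold perm (and_chain n) v (basis_wire p q) = v (basis_wire p q)) \<and>
    (\<forall>i>n. fold perm (and_chain n) v (and_wire i) = 0)"
  proof (induction n)
    case 0
    then show ?case using assms by (simp add: and_chain_def)
  next
    case (Suc n)
    have "fold perm (and_chain (Suc n)) v =
        perm (Toffoli (and_wire n) (basis_wire n n) (and_wire (Suc n))) (fold perm (and_chain n) v)"
      by (simp add: and_chain_def)
    with Suc show ?case
      by (cases "v (basis_wire n n)") (auto simp: less_Suc_eq)
  qed
  then show ?thesis by blast
qed

text \<open>The rows form an upper triangular matrix. Its determinant is the product of the diagonal
  bits, and it is nonzero exactly when the kernel is trivial.\<close>

lemma echelon_full_iff:
  assumes "echelon n v"
  shows "(\<forall>p<n. v (basis_wire p p) = 1) \<longleftrightarrow>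
    (\<forall>t \<in> carrier_vec n. annihilates n v (vec_index t) \<longrightarrow> t = 0\<^sub>v n)"
proof -
  define M where "M = mat n n (\<lambda>(i, q). v (basis_wire i q))"
  have M: "M \<in> carrier_mat n n" by (simp add: M_def)
  have "upper_triangular M"
    using assms by (auto simp: M_def echelon_def)
  then have "det M = prod_list (diag_mat M)"
    using det_upper_triangular M by blast
  also have "\<dots> = (\<Prod>p<n. v (basis_wire p p))"
    unfolding prod_list_diag_prod using M by (simp add: M_def atLeast0LessThan)
  finally have "det M \<noteq> 0 \<longleftrightarrow> (\<forall>p<n. v (basis_wire p p) = 1)"
    by (auto simp: bit_not_zero_iff)
  moreover have "M *\<^sub>v t = 0\<^sub>v n \<longleftrightarrow> annihilates n v (vec_index t)" if "t \<in> carrier_vec n" for t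
    using that by (auto simp: M_def vec_eq_iff annihilates_def dot_def scalar_prod_def
        atLeast0LessThan)
  ultimately show ?thesis
    using det_0_iff_vec_prod_zero_field[OF M] by blast
qed

lemma read_arg_reg: "read (arg_reg n j) v = vec n (\<lambda>q. v (Arg j q))"
  unfolding read_def arg_reg_def by (auto simp: vec_eq_iff index_vec_of_list)

lemma length_elim_step [simp]: "length (elim_step n j p) = 2 * n + 3"
  by (simp add: elim_step_def)

lemma length_rank_gates: "length (rank_gates n N) = 2 * (N * (n * (2 * n + 3)) + n + 1) + 2"
  by (simp add: rank_gates_def eliminate_def and_chain_def length_concat comp_def sum_list_triv
      algebra_simps)

lemma rank_circuit_rank_gates: "rank_circuit n N (rank_gates n N)"
proof -
  define gs where "gs = eliminate n N @ and_chain n"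
  have gs: "rank_gates n N = gs @ [CNOT (and_wire n) Flag, PauliX Flag] @ rev gs"
    by (simp add: rank_gates_def gs_def)
  have rev: "reversible gs"
    by (simp add: gs_def eliminate_def and_chain_def elim_step_def)
  have out: "fold gate_sem (rank_gates n N) (ket v) =
      ket (v(Flag := v Flag +
        (if span_dim n ((\<lambda>j. read (arg_reg n j) v) ` {..<N}) = n then 0 else 1)))"
    if v: "clean v" for v
  proof -
    note el = eliminate_correct[OF v, of n N]
    have dot: "dot n (\<lambda>q. v (Arg j q)) (vec_index t) = read (arg_reg n j) v \<bullet> t"
      if "t \<in> carrier_vec n" for t j
      using that by (simp add: dot_def read_arg_reg scalar_prod_def atLeast0LessThan)
    have "(\<forall>p<n. fold perm (eliminate n N) v (basis_wire p p) = 1) \<longleftrightarrow>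
        span_dim n ((\<lambda>j. read (arg_reg n j) v) ` {..<N}) = n"
      unfolding echelon_full_iff[OF el(1)] el(2)
      by (subst span_dim_eq_iff) (auto simp: dot read_arg_reg)
    then have "fold perm gs v (and_wire n) =
        (if span_dim n ((\<lambda>j. read (arg_reg n j) v) ` {..<N}) = n then 1 else 0)"
      using and_chain_correct[of "fold perm (eliminate n N) v" n] el(3) by (simp add: gs_def)
    then show ?thesis
      unfolding gs using compute_Flag_uncompute[OF rev, of "and_wire n" v] by (simp add: add.assoc)
  qed
  have "list_all wf_gate (rank_gates n N)"
    using rev unfolding gs by (auto simp: reversible_def list_all_iff)
  with out show ?thesis by (simp add: rank_circuit_def)
qed

section \<open>The reflection circuit\<close>

text \<open>Over the two-element field the disjunction of \<open>x\<close> and \<open>y\<close> is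
  \<open>x + y + x y\<close>, with one gate for each term.\<close>

definition or_chain :: "nat \<Rightarrow> gate list" where
  "or_chain m = concat (map (\<lambda>k. [CNOT (Anc k) (Anc (Suc k)), CNOT (Idx k) (Anc (Suc k)),
     Toffoli (Anc k) (Idx k) (Anc (Suc k))]) [0..<m])"

text \<open>Four \<open>T\<close> gates give \<open>Z\<close>.\<close>

definition reflection_gates :: "nat \<Rightarrow> gate list" where
  "reflection_gates m = or_chain m @ replicate 4 (PhaseT (Anc m)) @ rev (or_chain m)"

lemma length_reflection_gates: "length (reflection_gates m) = 6 * m + 4"
  by (simp add: reflection_gates_def or_chain_def length_concat comp_def sum_list_triv)

lemma or_chain_correct:
  assumes "clean v"
  shows "fold perm (or_chain m) v (Anc m) = (if \<forall>k<m. v (Idx k) = 0 then 0 else 1)"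
proof -
  have "fold perm (or_chain m) v (Anc m) = (if \<forall>k<m. v (Idx k) = 0 then 0 else 1) \<and>
    (\<forall>k. fold perm (or_chain m) v (Idx k) = v (Idx k)) \<and>
    (\<forall>i>m. fold perm (or_chain m) v (Anc i) = 0)"
  proof (induction m)
    case 0
    then show ?case using assms by (simp add: or_chain_def clean_def)
  next
    case (Suc m)
    have "fold perm (or_chain (Suc m)) v =
        fold perm [CNOT (Anc m) (Anc (Suc m)), CNOT (Idx m) (Anc (Suc m)),
          Toffoli (Anc m) (Idx m) (Anc (Suc m))] (fold perm (or_chain m) v)"
      by (simp add: or_chain_def)
    with Suc show ?case
      by (cases "v (Idx m)") (auto simp: less_Suc_eq)
  qed
  then show ?thesis by blast
qed

lemma gate_sem_scale: "gate_sem G (\<lambda>v. c * \<psi> v) = (\<lambda>v. c * gate_sem G \<psi> v)"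
  by (cases G) (auto simp: fun_eq_iff field_simps)

lemma fold_gate_sem_scale:
  "fold gate_sem gs (\<lambda>v. c * \<psi> v) = (\<lambda>v. c * fold gate_sem gs \<psi> v)"
  by (induction gs arbitrary: \<psi>) (simp_all add: gate_sem_scale)

lemma T4: "fold gate_sem (replicate 4 (PhaseT w)) (ket v) =
    (\<lambda>v'. (if v w = 0 then 1 else -1) * ket v v')"
proof -
  have "cis (pi / 4) * (cis (pi / 4) * (cis (pi / 4) * cis (pi / 4))) = -1"
  proof -
    have i: "cis (pi / 4) * cis (pi / 4) = \<i>" by (simp add: cis_mult)
    have "cis (pi / 4) * (cis (pi / 4) * (cis (pi / 4) * cis (pi / 4))) =
        (cis (pi / 4) * cis (pi / 4)) * (cis (pi / 4) * cis (pi / 4))"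
      by (simp only: mult.assoc)
    then show ?thesis unfolding i by simp
  qed
  then show ?thesis
    by (auto simp: numeral_eq_Suc ket_def fun_eq_iff)
qed

text \<open>The phase gates see the disjunction of the index bits, so a nonzero index gets the sign
  -1. On a basis state this is a scalar and survives the uncomputation.\<close>

lemma reflection_circuit_reflection_gates: "reflection_circuit m (reflection_gates m)"
proof -
  have rev: "reversible (or_chain m)"
    by (simp add: or_chain_def)
  have "fold gate_sem (reflection_gates m) (ket v) =
      (\<lambda>v'. (if read (idx_reg m) v = 0\<^sub>v m then 1 else -1) * ket v v')" if v: "clean v" for v
  proof -
    have "read (idx_reg m) v = 0\<^sub>v m \<longleftrightarrow> (\<forall>k<m. v (Idx k) = 0)"
      unfolding read_def idx_reg_def by (auto simp: vec_eq_iff index_vec_of_list)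
    then show ?thesis
      unfolding reflection_gates_def fold_append comp_def fold_gate_sem_ket[OF rev] T4
        or_chain_correct[OF v] fold_gate_sem_scale
      using rev by (cases "\<forall>k<m. v (Idx k) = 0") (auto simp: fold_gate_sem_ket uncompute)
  qed
  moreover have "list_all wf_gate (reflection_gates m)"
    using rev unfolding reflection_gates_def by (auto simp: reversible_def list_all_iff)
  ultimately show ?thesis by (simp add: reflection_circuit_def)
qed

section \<open>Registers and layers of Hadamard gates\<close>

lemma read_carrier [simp]: "read ws v \<in> carrier_vec (length ws)"
  unfolding read_def by (rule carrier_vecI) (simp del: vec_of_list_map)

lemma dim_read [simp]: "dim_vec (read ws v) = length ws"
  using read_carrier by (rule carrier_vecD)

lemma read_index [simp]: "k < length ws \<Longrightarrow> read ws v $ k = v (ws ! k)"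
  unfolding read_def by (simp add: vec_of_list_index del: vec_of_list_map)

lemma read_Cons: "read (w # ws) v = vCons (v w) (read ws v)"
  by (simp add: read_def del: vec_of_list_map)

lemma read_cong: "(\<And>w. w \<in> set ws \<Longrightarrow> v w = v' w) \<Longrightarrow> read ws v = read ws v'"
  unfolding read_def by (metis map_cong)

lemma read_upd_other [simp]: "w \<notin> set ws \<Longrightarrow> read ws (v(w := b)) = read ws v"
  by (rule read_cong) auto

lemma read_eq_iff: "read ws v = read ws v' \<longleftrightarrow> (\<forall>w \<in> set ws. v w = v' w)"
  by (induction ws) (auto simp: read_Cons read_def)

lemma xor_into_Cons: "xor_into (w # ws) (vCons b z) v = xor_into ws z (v(w := v w + b))"
  by (simp add: xor_into_def)

lemma xor_into_other: "w \<notin> set ws \<Longrightarrow> xor_into ws z v w = v w"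
proof (induction ws arbitrary: v z)
  case (Cons w' ws)
  then show ?case
    by (cases z) (auto simp: xor_into_Cons, simp add: xor_into_def)
qed (simp add: xor_into_def)

lemma read_xor_into_other: "set ws \<inter> set ys = {} \<Longrightarrow> read ws (xor_into ys z v) = read ws v"
  by (rule read_cong) (rule xor_into_other, blast)

lemma read_xor_into:
  assumes "distinct ws" "z \<in> carrier_vec (length ws)"
  shows "read ws (xor_into ws z v) = read ws v + z"
  using assms
proof (induction ws arbitrary: v z)
  case Nil
  then show ?case by (auto simp: xor_into_def vec_eq_iff read_def)
next
  case (Cons w ws)
  then obtain b z' where z: "z = vCons b z'" "z' \<in> carrier_vec (length ws)"
    by (cases z) auto
  have "read (w # ws) (xor_into (w # ws) z v) = vCons (v w + b) (read ws v + z')"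
    using Cons z by (simp add: read_Cons xor_into_Cons xor_into_other)
  also have "\<dots> = read (w # ws) v + z"
    using z by (auto simp: read_Cons vec_eq_iff vec_index_vCons)
  finally show ?case .
qed

lemma label_eqI:
  assumes "read ws v = read ws v'" "\<And>w. w \<notin> set ws \<Longrightarrow> v w = v' w"
  shows "v = v'"
  using assms unfolding read_eq_iff by (intro ext) blast

lemma add_self_bit_vec: "z \<in> carrier_vec k \<Longrightarrow> x \<in> carrier_vec k \<Longrightarrow> x + z + z = (x :: bit vec)"
  by (auto simp: vec_eq_iff add.assoc)

lemma xor_into_twice:
  assumes "distinct ws" "z \<in> carrier_vec (length ws)"
  shows "xor_into ws z (xor_into ws z v) = v"
  using assms by (intro label_eqI[of ws])
    (simp_all add: read_xor_into xor_into_other add_self_bit_vec[where k = "length ws"])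

text \<open>The nontrivial additive character of the two-element field.\<close>

definition chi :: "bit \<Rightarrow> real" where
  "chi b = (if b = 0 then 1 else -1)"

lemma chi_simps [simp]: "chi 0 = 1" "chi 1 = -1" "chi b * chi b = 1" "(chi b)\<^sup>2 = 1" "\<bar>chi b\<bar> = 1"
  by (auto simp: chi_def)

lemma chi_add: "chi (a + b) = chi a * chi b"
  by (cases a; cases b) (simp_all add: chi_def)

text \<open>Writing \<open>y\<close> is expressed as an XOR with \<open>read ws v + y\<close>, so
  that the facts about \<open>xor_into\<close> carry over.\<close>

definition overwrite :: "wire list \<Rightarrow> bit vec \<Rightarrow> label \<Rightarrow> label" where
  "overwrite ws y v = xor_into ws (read ws v + y) v"

lemma overwrite_Cons:
  assumes "w \<notin> set ws" "y \<in> carrier_vec (length ws)"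
  shows "overwrite (w # ws) (vCons b y) v = overwrite ws y (v(w := b))"
proof -
  have "read (w # ws) v + vCons b y = vCons (v w + b) (read ws v + y)"
    using assms by (auto simp: read_Cons vec_eq_iff vec_index_vCons)
  moreover have "read ws (v(w := b)) = read ws v"
    using assms by (intro read_cong) auto
  ultimately show ?thesis
    by (simp add: overwrite_def xor_into_Cons)
qed

lemma read_overwrite:
  "distinct ws \<Longrightarrow> y \<in> carrier_vec (length ws) \<Longrightarrow> read ws (overwrite ws y v) = y"
  unfolding overwrite_def
  by (subst read_xor_into) (auto simp: vec_eq_iff)

lemma overwrite_other: "w \<notin> set ws \<Longrightarrow> overwrite ws y v w = v w"
  by (simp add: overwrite_def xor_into_other)

lemma read_overwrite_other: "set ws \<inter> set ys = {} \<Longrightarrow> read ws (overwrite ys y v) = read ws v"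
  by (simp add: overwrite_def read_xor_into_other)

lemma finite_carrier_vec [simp]: "finite (carrier_vec n :: bit vec set)"
  by (rule finite_carrier_vec_bit)

lemma carrier_vec_Suc_bit:
  "(carrier_vec (Suc n) :: bit vec set) = vCons 0 ` carrier_vec n \<union> vCons 1 ` carrier_vec n"
proof -
  have "x \<in> vCons 0 ` carrier_vec n \<union> vCons 1 ` carrier_vec n"
    if "x \<in> carrier_vec (Suc n)" for x :: "bit vec"
    using that
  proof (cases x)
    case (vCons b y)
    then show ?thesis using that by (cases b) auto
  qed auto
  then show ?thesis by auto
qed

lemma sum_carrier_vec_Suc:
  "(\<Sum>y \<in> carrier_vec (Suc n). f y) =
    (\<Sum>y \<in> carrier_vec n. f (vCons 0 y)) + (\<Sum>y \<in> carrier_vec n. f (vCons 1 (y :: bit vec)))"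
  unfolding carrier_vec_Suc_bit
  by (subst sum.union_disjoint) (auto simp: sum.reindex inj_on_def)

lemma card_carrier_vec_bit: "card (carrier_vec n :: bit vec set) = 2 ^ n"
proof -
  have "(\<Sum>y :: bit vec \<in> carrier_vec n. 1 :: nat) = 2 ^ n"
  proof (induction n)
    case 0
    have "(carrier_vec 0 :: bit vec set) = {0\<^sub>v 0}" by (auto simp: vec_eq_iff)
    then show ?case by simp
  next
    case (Suc n)
    then show ?case using sum_carrier_vec_Suc[of "\<lambda>_. 1 :: nat" n] by simp
  qed
  then show ?thesis by simp
qed

text \<open>Induction on the wires: the two values of the first bit of \<open>y\<close> correspond
  to the two terms of the Hadamard gate on the first wire.\<close>

lemma hadamards_sem:
  fixes \<psi> :: state
  assumes "distinct ws"
  shows "fold (op_sem F) (hadamards ws) \<psi> v = (1 / sqrt 2) ^ length ws *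
    (\<Sum>y \<in> carrier_vec (length ws). chi (read ws v \<bullet> y) * \<psi> (overwrite ws y v))"
  using assms
proof (induction ws arbitrary: \<psi>)
  case Nil
  have "(carrier_vec 0 :: bit vec set) = {0\<^sub>v 0}" by (auto simp: vec_eq_iff)
  then show ?case
    by (simp add: hadamards_def overwrite_def xor_into_def scalar_prod_def)
next
  case (Cons w ws)
  let ?c = "complex_of_real ((1 / sqrt 2) ^ length ws)"
  have over: "overwrite ws y v w = v w" for y
    using Cons.prems by (simp add: overwrite_other)
  have upd: "(overwrite ws y v)(w := b) = overwrite (w # ws) (vCons b y) v"
    if "y \<in> carrier_vec (length ws)" for y b
  proof -
    have "overwrite ws y (v(w := b)) = (overwrite ws y v)(w := b)"
    proof (rule label_eqI[of ws])
      show "read ws (overwrite ws y (v(w := b))) = read ws ((overwrite ws y v)(w := b))"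
        using Cons.prems that by (simp add: read_overwrite)
    qed (auto simp: overwrite_other)
    then show ?thesis using Cons.prems that by (simp add: overwrite_Cons)
  qed
  have "fold (op_sem F) (hadamards (w # ws)) \<psi> v =
      ?c * (\<Sum>y \<in> carrier_vec (length ws). chi (read ws v \<bullet> y) *
        gate_sem (Hadamard w) \<psi> (overwrite ws y v))"
    using Cons by (simp add: hadamards_def del: gate_sem.simps)
  also have "\<dots> = ?c * (\<Sum>y \<in> carrier_vec (length ws). chi (read ws v \<bullet> y) *
        ((\<psi> (overwrite (w # ws) (vCons 0 y) v) +
          chi (v w) * \<psi> (overwrite (w # ws) (vCons 1 y) v)) / sqrt 2))"
    by (intro arg_cong2[of _ _ _ _ "(*)"] sum.cong) (auto simp: over upd chi_def)
  also have "\<dots> = ?c * (1 / sqrt 2) * (\<Sum>y \<in> carrier_vec (length ws).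
        chi (read (w # ws) v \<bullet> vCons 0 y) * \<psi> (overwrite (w # ws) (vCons 0 y) v) +
        chi (read (w # ws) v \<bullet> vCons 1 y) * \<psi> (overwrite (w # ws) (vCons 1 y) v))"
    unfolding mult.assoc
    by (simp add: read_Cons chi_add sum_distrib_left sum_divide_distrib algebra_simps add_divide_distrib)
  finally show ?case
    by (simp add: sum_carrier_vec_Suc sum.distrib)
qed

section \<open>Product states\<close>

lemma UNIV_bit: "(UNIV :: bit set) = {0, 1}"
proof -
  have "b \<in> {0, 1}" for b :: bit by (cases b) auto
  then show ?thesis by blast
qed

lemma finite_UNIV_bit [simp]: "finite (UNIV :: bit set)"
  by (simp add: UNIV_bit)

lemma fold_map_Gate: "fold (op_sem F) (map Gate gs) = fold gate_sem gs"
  by (induction gs) (simp_all add: comp_def)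

lemma distinct_regs [simp]:
  "distinct (idx_reg m)" "distinct (arg_reg n j)" "distinct (val_reg l j)"
  by (auto simp: idx_reg_def arg_reg_def val_reg_def distinct_map inj_on_def)

lemma length_regs [simp]:
  "length (idx_reg m) = m" "length (arg_reg n j) = n" "length (val_reg l j) = l"
  by (auto simp: idx_reg_def arg_reg_def val_reg_def)

lemma set_regs:
  "set (idx_reg m) = Idx ` {..<m}" "set (arg_reg n j) = Arg j ` {..<n}"
  "set (val_reg l j) = Val j ` {..<l}"
  by (auto simp: idx_reg_def arg_reg_def val_reg_def)

lemma read_regs_carrier [simp]:
  "read (idx_reg m) v \<in> carrier_vec m" "read (arg_reg n j) v \<in> carrier_vec n"
  "read (val_reg l j) v \<in> carrier_vec l"
  using read_carrier[of "idx_reg m" v] read_carrier[of "arg_reg n j" v]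
    read_carrier[of "val_reg l j" v] by simp_all

lemma regs_disjoint [simp]:
  "set (idx_reg m) \<inter> set (arg_reg n j) = {}" "set (idx_reg m) \<inter> set (val_reg l j) = {}"
  "set (arg_reg n i) \<inter> set (idx_reg m) = {}" "set (arg_reg n i) \<inter> set (val_reg l j) = {}"
  "set (val_reg l i) \<inter> set (idx_reg m) = {}" "set (val_reg l i) \<inter> set (arg_reg n j) = {}"
  "i \<noteq> j \<Longrightarrow> set (arg_reg n i) \<inter> set (arg_reg n j) = {}"
  "i \<noteq> j \<Longrightarrow> set (val_reg l i) \<inter> set (val_reg l j) = {}"
  "Flag \<notin> set (idx_reg m)" "Flag \<notin> set (arg_reg n j)" "Flag \<notin> set (val_reg l j)"
  by (auto simp: set_regs)

locale registers =
  fixes m n l N :: nat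
begin

definition wires_used :: "wire set" where
  "wires_used = insert Flag (set (idx_reg m) \<union>
     (\<Union>j<N. set (arg_reg n j)) \<union> (\<Union>j<N. set (val_reg l j)))"

text \<open>This set supports every state between subroutine calls. It is finite, which turns norms
  into finite sums, and its labels have zero ancillas, as the subroutines require.\<close>

definition labels :: "label set" where
  "labels = {v. \<forall>w. w \<notin> wires_used \<longrightarrow> v w = 0}"

abbreviation "idx \<equiv> read (idx_reg m)"
abbreviation "arg j \<equiv> read (arg_reg n j)"
abbreviation "val j \<equiv> read (val_reg l j)"

lemma finite_labels [simp]: "finite labels"
proof -
  have "finite wires_used" by (simp add: wires_used_def)
  then have "finite {v. \<forall>w. (w \<in> wires_used \<longrightarrow> v w \<in> (UNIV :: bit set)) \<and> (w \<notin> wires_used \<longrightarrow> v w = 0)}"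
    by (rule finite_set_of_finite_funs) simp
  then show ?thesis by (simp add: labels_def)
qed

lemma labels_clean: "v \<in> labels \<Longrightarrow> clean v"
  by (auto simp: labels_def clean_def wires_used_def set_regs)

lemma zero_in_labels [simp]: "(\<lambda>_. 0) \<in> labels"
  by (simp add: labels_def)

lemma upd_labels: "w \<in> wires_used \<Longrightarrow> v(w := b) \<in> labels \<longleftrightarrow> v \<in> labels"
  by (auto simp: labels_def)

lemma xor_into_labels:
  "set ws \<subseteq> wires_used \<Longrightarrow> xor_into ws z v \<in> labels \<longleftrightarrow> v \<in> labels"
  unfolding labels_def by (auto simp: xor_into_other subset_iff) (metis xor_into_other)+

lemma overwrite_labels:
  "set ws \<subseteq> wires_used \<Longrightarrow> overwrite ws z v \<in> labels \<longleftrightarrow> v \<in> labels"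
  by (simp add: overwrite_def xor_into_labels)

lemma regs_used [simp]:
  "Flag \<in> wires_used" "set (idx_reg m) \<subseteq> wires_used"
  "j < N \<Longrightarrow> set (arg_reg n j) \<subseteq> wires_used" "j < N \<Longrightarrow> set (val_reg l j) \<subseteq> wires_used"
  by (auto simp: wires_used_def)

text \<open>The pairs are collected in an extensional function, so that a sum over their contents
  ranges over a \<open>PiE\<close> set and can be exchanged with a product.\<close>

definition coords :: "label \<Rightarrow> bit vec \<times> bit \<times> (nat \<Rightarrow> bit vec \<times> bit vec)" where
  "coords v = (idx v, v Flag, \<lambda>j \<in> {..<N}. (arg j v, val j v))"

lemma bij_betw_coords:
  "bij_betw coords labels
     (carrier_vec m \<times> UNIV \<times> ({..<N} \<rightarrow>\<^sub>E carrier_vec n \<times> carrier_vec l))"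
proof (intro bij_betw_imageI inj_onI)
  fix v v' assume v: "v \<in> labels" "v' \<in> labels" and eq: "coords v = coords v'"
  have "arg j v = arg j v' \<and> val j v = val j v'" if "j < N" for j
    using arg_cong[OF eq, of "\<lambda>(_, _, p). p j"] that by (simp add: coords_def)
  with eq have "\<forall>w \<in> wires_used. v w = v' w"
    unfolding wires_used_def by (auto simp: coords_def read_eq_iff)
  with v show "v = v'"
    unfolding labels_def by (intro ext) (metis (mono_tags, lifting) mem_Collect_eq)
next
  show "coords ` labels = carrier_vec m \<times> UNIV \<times> ({..<N} \<rightarrow>\<^sub>E carrier_vec n \<times> carrier_vec l)"
  proof (intro equalityI subsetI)
    fix y :: "bit vec \<times> bit \<times> (nat \<Rightarrow> bit vec \<times> bit vec)"
    assume "y \<in> carrier_vec m \<times> UNIV \<times> ({..<N} \<rightarrow>\<^sub>E carrier_vec n \<times> carrier_vec l)"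
    then obtain i b p where y: "y = (i, b, p)" and i: "i \<in> carrier_vec m"
      and p: "p \<in> {..<N} \<rightarrow>\<^sub>E carrier_vec n \<times> carrier_vec l"
      by auto
    define v :: label where "v = (\<lambda>w. case w of
        Idx k \<Rightarrow> if k < m then i $ k else 0
      | Arg j k \<Rightarrow> if j < N \<and> k < n then fst (p j) $ k else 0
      | Val j k \<Rightarrow> if j < N \<and> k < l then snd (p j) $ k else 0
      | Flag \<Rightarrow> b
      | Anc k \<Rightarrow> 0)"
    have "v \<in> labels"
      by (auto simp: labels_def wires_used_def v_def set_regs split: wire.splits)
    moreover have "idx v = i"
      using i by (auto simp: vec_eq_iff idx_reg_def v_def)
    moreover have "(arg j v, val j v) = p j" if "j < N" for j
    proof -
      have "p j \<in> carrier_vec n \<times> carrier_vec l" using p that by auto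
      then show ?thesis
        using that by (auto simp: vec_eq_iff arg_reg_def val_reg_def v_def prod_eq_iff)
    qed
    then have "(\<lambda>j \<in> {..<N}. (arg j v, val j v)) = p"
      using p by (auto simp: fun_eq_iff PiE_iff extensional_def)
    ultimately have "coords v = y" by (simp add: coords_def y v_def)
    with \<open>v \<in> labels\<close> show "y \<in> coords ` labels" by blast
  qed (auto simp: coords_def split: if_splits)
qed

text \<open>Once the index is fixed the pairs are independent, so the sum over their joint contents
  is the product of the sums for the single pairs.\<close>

lemma sum_labels:
  fixes a :: "bit vec \<Rightarrow> real"
  shows "(\<Sum>v \<in> labels. a (idx v) * c (v Flag) * (\<Prod>j<N. q j (idx v) (arg j v) (val j v))) =
    (\<Sum>i \<in> carrier_vec m. a i * (\<Sum>b \<in> UNIV. c b) *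
       (\<Prod>j<N. \<Sum>x \<in> carrier_vec n. \<Sum>z \<in> carrier_vec l. q j i x z))"
proof -
  let ?P = "{..<N} \<rightarrow>\<^sub>E (carrier_vec n \<times> carrier_vec l :: (bit vec \<times> bit vec) set)"
  let ?t = "\<lambda>(i, b, p). a i * c b * (\<Prod>j<N. q j i (fst (p j)) (snd (p j)))"
  have "(\<Sum>v \<in> labels. a (idx v) * c (v Flag) * (\<Prod>j<N. q j (idx v) (arg j v) (val j v))) =
      (\<Sum>v \<in> labels. ?t (coords v))"
    by (simp add: coords_def)
  also have "\<dots> = (\<Sum>y \<in> carrier_vec m \<times> UNIV \<times> ?P. ?t y)"
    by (rule sum.reindex_bij_betw[OF bij_betw_coords])
  also have "\<dots> = (\<Sum>i \<in> carrier_vec m. \<Sum>b \<in> UNIV. \<Sum>p \<in> ?P.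
      a i * c b * (\<Prod>j<N. q j i (fst (p j)) (snd (p j))))"
    by (simp add: sum.cartesian_product finite_PiE)
  also have "\<dots> = (\<Sum>i \<in> carrier_vec m. \<Sum>b \<in> UNIV. a i * c b *
      (\<Prod>j<N. \<Sum>y \<in> carrier_vec n \<times> carrier_vec l. q j i (fst y) (snd y)))"
    by (simp add: prod_sum_PiE sum_distrib_left)
  also have "\<dots> = (\<Sum>i \<in> carrier_vec m. a i * (\<Sum>b \<in> UNIV. c b) *
       (\<Prod>j<N. \<Sum>x \<in> carrier_vec n. \<Sum>z \<in> carrier_vec l. q j i x z))"
    by (simp add: sum.cartesian_product case_prod_unfold sum_distrib_left sum_distrib_right)
  finally show ?thesis .
qed

end

context registers begin

text \<open>
  The amplitudes of all states in play are real: \<open>\<alpha>\<close> belongs to the index register, \<open>\<gamma>\<close> to the flag, and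
  \<open>\<beta> j i x z\<close> to the \<open>j\<close>-th pair when the index register contains \<open>i\<close>.
\<close>

definition prod_state :: "(bit vec \<Rightarrow> real) \<Rightarrow> (nat \<Rightarrow> bit vec \<Rightarrow> bit vec \<Rightarrow> bit vec \<Rightarrow> real) \<Rightarrow>
    (bit \<Rightarrow> real) \<Rightarrow> state" where
  "prod_state \<alpha> \<beta> \<gamma> v = complex_of_real (if v \<in> labels
     then \<alpha> (idx v) * \<gamma> (v Flag) * (\<Prod>j<N. \<beta> j (idx v) (arg j v) (val j v)) else 0)"

lemma prod_state_cong:
  assumes "\<And>i. i \<in> carrier_vec m \<Longrightarrow> \<alpha> i = \<alpha>' i"
    and "\<And>j i x z. j < N \<Longrightarrow> i \<in> carrier_vec m \<Longrightarrow> x \<in> carrier_vec n \<Longrightarrow> z \<in> carrier_vec l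
      \<Longrightarrow> \<beta> j i x z = \<beta>' j i x z"
    and "\<And>b. \<gamma> b = \<gamma>' b"
  shows "prod_state \<alpha> \<beta> \<gamma> = prod_state \<alpha>' \<beta>' \<gamma>'"
  using assms by (intro ext) (auto simp: prod_state_def)

lemma ket_zero_prod_state:
  "ket (\<lambda>_. 0) = prod_state (\<lambda>i. of_bool (i = 0\<^sub>v m))
     (\<lambda>_ _ x z. of_bool (x = 0\<^sub>v n) * of_bool (z = 0\<^sub>v l)) (\<lambda>b. of_bool (b = 0))"
proof
  fix v
  have zero: "read ws v = 0\<^sub>v k \<longleftrightarrow> (\<forall>w \<in> set ws. v w = 0)" if "length ws = k" for ws k
    using that by (auto simp: vec_eq_iff all_set_conv_all_nth)
  have eq: "v = (\<lambda>_. 0) \<longleftrightarrow> v \<in> labels \<and> (\<forall>w \<in> wires_used. v w = 0)"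
    by (auto simp: labels_def)
  have "v = (\<lambda>_. 0) \<longleftrightarrow> v \<in> labels \<and> idx v = 0\<^sub>v m \<and> v Flag = 0 \<and>
      (\<forall>j<N. arg j v = 0\<^sub>v n \<and> val j v = 0\<^sub>v l)"
    unfolding eq by (auto simp: zero wires_used_def)
  then show "ket (\<lambda>_. 0) v = prod_state (\<lambda>i. of_bool (i = 0\<^sub>v m))
     (\<lambda>_ _ x z. of_bool (x = 0\<^sub>v n) * of_bool (z = 0\<^sub>v l)) (\<lambda>b. of_bool (b = 0)) v"
    by (auto simp: ket_def prod_state_def prod_zero_iff)
qed

section \<open>Elementary operations on product states\<close>

lemma prod_update:
  fixes q q' :: "nat \<Rightarrow> real"
  assumes "j < N" "\<And>i. i < N \<Longrightarrow> i \<noteq> j \<Longrightarrow> q' i = q i"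
  shows "(\<Prod>i<N. q' i) = q' j * (\<Prod>i \<in> {..<N} - {j}. q i)"
  using assms by (subst prod.remove[of _ j]) auto

lemma prod_state_query:
  assumes j: "j < N" and F: "\<And>i x. i \<in> carrier_vec m \<Longrightarrow> x \<in> carrier_vec n \<Longrightarrow> F i x \<in> carrier_vec l"
  shows "op_sem F (Query (idx_reg m) (arg_reg n j) (val_reg l j)) (prod_state \<alpha> \<beta> \<gamma>) =
    prod_state \<alpha> (\<beta>(j := \<lambda>i x z. \<beta> j i x (z + F i x))) \<gamma>"
proof
  fix v
  let ?v = "xor_into (val_reg l j) (F (idx v) (arg j v)) v"
  let ?\<beta> = "\<beta>(j := \<lambda>i x z. \<beta> j i x (z + F i x))"
  have "val j ?v = val j v + F (idx v) (arg j v)"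
    using F by (simp add: read_xor_into)
  moreover have "val i ?v = val i v" if "i \<noteq> j" for i
    using that by (simp add: read_xor_into_other)
  ultimately have "(\<Prod>i<N. \<beta> i (idx ?v) (arg i ?v) (val i ?v)) =
      (\<Prod>i<N. ?\<beta> i (idx v) (arg i v) (val i v))"
    by (intro prod.cong) (auto simp: read_xor_into_other)
  then show "op_sem F (Query (idx_reg m) (arg_reg n j) (val_reg l j)) (prod_state \<alpha> \<beta> \<gamma>) v = prod_state \<alpha> ?\<beta> \<gamma> v"
    using j by (simp add: prod_state_def xor_into_labels read_xor_into_other xor_into_other)
qed

lemma prod_state_cond_xor:
  assumes j: "j < N" and z0: "z0 \<in> carrier_vec l"
  shows "(\<lambda>v. prod_state \<alpha> \<beta> \<gamma> (if arg j v = y then xor_into (val_reg l j) z0 v else v)) =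
    prod_state \<alpha> (\<beta>(j := \<lambda>i x z. \<beta> j i x (if x = y then z + z0 else z))) \<gamma>"
proof
  fix v
  let ?v = "if arg j v = y then xor_into (val_reg l j) z0 v else v"
  let ?\<beta> = "\<beta>(j := \<lambda>i x z. \<beta> j i x (if x = y then z + z0 else z))"
  have "val j ?v = (if arg j v = y then val j v + z0 else val j v)"
    using z0 by (simp add: read_xor_into)
  moreover have "val i ?v = val i v" if "i \<noteq> j" for i
    using that by (simp add: read_xor_into_other)
  ultimately have "(\<Prod>i<N. \<beta> i (idx ?v) (arg i ?v) (val i ?v)) =
      (\<Prod>i<N. ?\<beta> i (idx v) (arg i v) (val i v))"
    by (intro prod.cong) (auto simp: read_xor_into_other)
  then show "prod_state \<alpha> \<beta> \<gamma> ?v = prod_state \<alpha> ?\<beta> \<gamma> v"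
    using j by (simp add: prod_state_def xor_into_labels read_xor_into_other xor_into_other)
qed

lemma prod_state_hadamards_arg:
  assumes j: "j < N"
  shows "fold (op_sem F) (hadamards (arg_reg n j)) (prod_state \<alpha> \<beta> \<gamma>) =
    prod_state \<alpha> (\<beta>(j := \<lambda>i x z. (1 / sqrt 2) ^ n * (\<Sum>y \<in> carrier_vec n. chi (x \<bullet> y) * \<beta> j i y z))) \<gamma>"
proof
  fix v
  let ?\<beta> = "\<beta>(j := \<lambda>i x z. (1 / sqrt 2) ^ n * (\<Sum>y \<in> carrier_vec n. chi (x \<bullet> y) * \<beta> j i y z))"
  let ?w = "\<lambda>y. overwrite (arg_reg n j) y v"
  let ?R = "\<Prod>i \<in> {..<N} - {j}. \<beta> i (idx v) (arg i v) (val i v)"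
  have "(\<Prod>i<N. \<beta> i (idx (?w y)) (arg i (?w y)) (val i (?w y))) =
      \<beta> j (idx v) y (val j v) * ?R" if "y \<in> carrier_vec n" for y
    using that by (subst prod_update[OF j]) (auto simp: read_overwrite_other read_overwrite)
  then have w: "prod_state \<alpha> \<beta> \<gamma> (?w y) = complex_of_real (if v \<in> labels
      then \<alpha> (idx v) * \<gamma> (v Flag) * (\<beta> j (idx v) y (val j v) * ?R) else 0)"
    if "y \<in> carrier_vec n" for y
    using that j by (simp add: prod_state_def overwrite_labels read_overwrite_other overwrite_other)
  have "(\<Prod>i<N. ?\<beta> i (idx v) (arg i v) (val i v)) = (1 / sqrt 2) ^ n *
      (\<Sum>y \<in> carrier_vec n. chi (arg j v \<bullet> y) * \<beta> j (idx v) y (val j v)) * ?R"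
    by (subst prod_update[OF j, of _ "\<lambda>i. \<beta> i (idx v) (arg i v) (val i v)"]) simp_all
  note prod = this
  have "fold (op_sem F) (hadamards (arg_reg n j)) (prod_state \<alpha> \<beta> \<gamma>) v =
      complex_of_real ((1 / sqrt 2) ^ n * (\<Sum>y \<in> carrier_vec n. chi (arg j v \<bullet> y) *
        (if v \<in> labels then \<alpha> (idx v) * \<gamma> (v Flag) * (\<beta> j (idx v) y (val j v) * ?R) else 0)))"
    by (simp add: hadamards_sem w)
  also have "\<dots> = prod_state \<alpha> ?\<beta> \<gamma> v"
    unfolding prod_state_def prod
    by (cases "v \<in> labels") (simp_all only: if_True if_False sum_distrib_left sum_distrib_right mult_ac mult_zero_right mult_zero_left sum.neutral_const of_real_0)
  finally show "fold (op_sem F) (hadamards (arg_reg n j)) (prod_state \<alpha> \<beta> \<gamma>) v = prod_state \<alpha> ?\<beta> \<gamma> v" .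
qed

text \<open>The pair amplitudes are the same for all indices here; otherwise mixing the indices
  would destroy the product form. This is why a test ends by undoing steps (1) and (2).\<close>

lemma prod_state_hadamards_idx:
  shows "fold (op_sem F) (hadamards (idx_reg m)) (prod_state \<alpha> (\<lambda>j _. \<beta> j) \<gamma>) =
    prod_state (\<lambda>i. (1 / sqrt 2) ^ m * (\<Sum>y \<in> carrier_vec m. chi (i \<bullet> y) * \<alpha> y)) (\<lambda>j _. \<beta> j) \<gamma>"
proof
  fix v
  let ?w = "\<lambda>y. overwrite (idx_reg m) y v"
  let ?R = "\<Prod>j<N. \<beta> j (arg j v) (val j v)"
  have w: "prod_state \<alpha> (\<lambda>j _. \<beta> j) \<gamma> (?w y) = complex_of_real (if v \<in> labels
      then \<alpha> y * \<gamma> (v Flag) * ?R else 0)" if "y \<in> carrier_vec m" for y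
    using that by (simp add: prod_state_def overwrite_labels read_overwrite_other read_overwrite overwrite_other)
  have "fold (op_sem F) (hadamards (idx_reg m)) (prod_state \<alpha> (\<lambda>j _. \<beta> j) \<gamma>) v =
      complex_of_real ((1 / sqrt 2) ^ m * (\<Sum>y \<in> carrier_vec m. chi (idx v \<bullet> y) *
        (if v \<in> labels then \<alpha> y * \<gamma> (v Flag) * ?R else 0)))"
    by (simp add: hadamards_sem w)
  also have "\<dots> = prod_state (\<lambda>i. (1 / sqrt 2) ^ m * (\<Sum>y \<in> carrier_vec m. chi (i \<bullet> y) * \<alpha> y))
      (\<lambda>j _. \<beta> j) \<gamma> v"
    unfolding prod_state_def
    by (cases "v \<in> labels") (simp_all only: if_True if_False sum_distrib_left sum_distrib_right mult_ac mult_zero_right mult_zero_left sum.neutral_const of_real_0)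
  finally show "fold (op_sem F) (hadamards (idx_reg m)) (prod_state \<alpha> (\<lambda>j _. \<beta> j) \<gamma>) v =
    prod_state (\<lambda>i. (1 / sqrt 2) ^ m * (\<Sum>y \<in> carrier_vec m. chi (i \<bullet> y) * \<alpha> y)) (\<lambda>j _. \<beta> j) \<gamma> v" .
qed

lemma read_upd_Flag [simp]:
  "idx (v(Flag := b)) = idx v" "arg j (v(Flag := b)) = arg j v" "val j (v(Flag := b)) = val j v"
  by simp_all

lemma prod_state_flag_gates:
  "op_sem F (Gate (PauliX Flag)) (prod_state \<alpha> \<beta> \<gamma>) = prod_state \<alpha> \<beta> (\<lambda>b. \<gamma> (b + 1))"
  "op_sem F (Gate (Hadamard Flag)) (prod_state \<alpha> \<beta> \<gamma>) = prod_state \<alpha> \<beta> (\<lambda>b. (\<gamma> 0 + chi b * \<gamma> 1) / sqrt 2)"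
  by (auto simp: fun_eq_iff prod_state_def upd_labels chi_def algebra_simps simp flip: of_real_mult of_real_divide of_real_add of_real_diff)

end

section \<open>Isometries on finitely supported states\<close>

lemma gate_sem_sum:
  assumes "finite C"
  shows "gate_sem G (\<lambda>v'. \<Sum>v \<in> C. a v * \<phi> v v') = (\<lambda>v'. \<Sum>v \<in> C. a v * gate_sem G (\<phi> v) v')"
proof (cases G)
  case (Hadamard w)
  then show ?thesis
    by (simp add: fun_eq_iff sum_divide_distrib sum_distrib_left distrib_left add_divide_distrib
        sum.distrib mult.left_commute)
next
  case (PhaseT w)
  then show ?thesis
    by (simp add: fun_eq_iff sum_distrib_left mult.left_commute)
qed auto

lemma fold_gate_sem_sum:
  assumes "finite C"
  shows "fold gate_sem gs (\<lambda>v'. \<Sum>v \<in> C. a v * \<phi> v v') =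
    (\<lambda>v'. \<Sum>v \<in> C. a v * fold gate_sem gs (\<phi> v) v')"
  using assms by (induction gs arbitrary: \<phi>) (simp_all add: gate_sem_sum)

lemma fold_involutions:
  assumes "\<And>u \<psi>. u \<in> set us \<Longrightarrow> op_sem F u (op_sem F u \<psi>) = \<psi>"
  shows "fold (op_sem F) (rev us) (fold (op_sem F) us \<psi>) = \<psi>"
  using assms by (induction us arbitrary: \<psi>) simp_all

lemma op_sem_Gate: "op_sem F (Gate G) = gate_sem G"
  by (rule ext) simp

lemma hadamard_hadamard: "gate_sem (Hadamard w) (gate_sem (Hadamard w) \<psi>) = \<psi>"
proof
  fix v :: label
  have "complex_of_real (sqrt 2) * complex_of_real (sqrt 2) = 2"
    by (simp flip: of_real_mult)
  moreover have e: "v w = b \<Longrightarrow> \<psi> (v(w := b)) = \<psi> v" for b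
    by (simp add: fun_upd_idem)
  ultimately show "gate_sem (Hadamard w) (gate_sem (Hadamard w) \<psi>) v = \<psi> v"
    by (cases "v w") (auto simp: field_simps e)
qed

lemma query_query:
  assumes "\<And>i x. i \<in> carrier_vec m \<Longrightarrow> x \<in> carrier_vec n \<Longrightarrow> F i x \<in> carrier_vec l"
  shows "op_sem F (Query (idx_reg m) (arg_reg n j) (val_reg l j))
    (op_sem F (Query (idx_reg m) (arg_reg n j) (val_reg l j)) \<psi>) = \<psi>"
  using assms by (simp add: fun_eq_iff read_xor_into_other xor_into_twice)

context registers begin

definition supported :: "state \<Rightarrow> bool" where
  "supported \<psi> \<longleftrightarrow> (\<forall>v. v \<notin> labels \<longrightarrow> \<psi> v = 0)"

definition state_dist :: "state \<Rightarrow> state \<Rightarrow> real" where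
  "state_dist \<psi> \<phi> = L2_set (\<lambda>v. cmod (\<psi> v - \<phi> v)) labels"

text \<open>Distances between supported states are all that the propagation of errors uses. Norms
  are covered as distances from the zero state.\<close>

definition isometric :: "(state \<Rightarrow> state) \<Rightarrow> bool" where
  "isometric U \<longleftrightarrow> (\<forall>\<psi> \<phi>. supported \<psi> \<longrightarrow> supported \<phi> \<longrightarrow>
     supported (U \<psi>) \<and> state_dist (U \<psi>) (U \<phi>) = state_dist \<psi> \<phi>)"

lemma supported_prod_state [simp]: "supported (prod_state \<alpha> \<beta> \<gamma>)"
  by (simp add: supported_def prod_state_def)

lemma supported_zero [simp]: "supported (\<lambda>_. 0)"
  by (simp add: supported_def)

lemma state_dist_triangle: "state_dist \<psi> \<omega> \<le> state_dist \<psi> \<phi> + state_dist \<phi> \<omega>"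
proof -
  have "state_dist \<psi> \<omega> \<le> L2_set (\<lambda>v. cmod (\<psi> v - \<phi> v) + cmod (\<phi> v - \<omega> v)) labels"
    unfolding state_dist_def
    by (intro L2_set_mono norm_diff_triangle_le[OF order_refl order_refl]) simp
  also have "\<dots> \<le> state_dist \<psi> \<phi> + state_dist \<phi> \<omega>"
    unfolding state_dist_def by (rule L2_set_triangle_ineq)
  finally show ?thesis .
qed

lemma isometricD:
  "isometric U \<Longrightarrow> supported \<psi> \<Longrightarrow> supported (U \<psi>)"
  "isometric U \<Longrightarrow> supported \<psi> \<Longrightarrow> supported \<phi> \<Longrightarrow> state_dist (U \<psi>) (U \<phi>) = state_dist \<psi> \<phi>"
  unfolding isometric_def by blast+

lemma isometric_fold: "(\<And>u. u \<in> set us \<Longrightarrow> isometric (f u)) \<Longrightarrow> isometric (fold f us)"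
proof (induction us)
  case (Cons u us)
  then have "isometric (f u)" "isometric (fold f us)" by auto
  then show ?case unfolding isometric_def by simp
qed (simp add: isometric_def)

lemma isometric_comp: "isometric U \<Longrightarrow> isometric V \<Longrightarrow> isometric (U \<circ> V)"
  by (simp add: isometric_def)

text \<open>The formula for \<open>U\<close> is asked for on supported states only, because the rank
  circuit is specified only for clean ancillas.\<close>

lemma isometric_permutation:
  assumes "\<And>\<psi>. supported \<psi> \<Longrightarrow> U \<psi> = (\<lambda>v. \<psi> (\<pi> v))"
    and "\<And>v. \<pi> (\<pi> v) = v" and "\<And>v. \<pi> v \<in> labels \<longleftrightarrow> v \<in> labels"
  shows "isometric U"
  unfolding isometric_def
proof (intro allI impI conjI)
  fix \<psi> \<phi> assume "supported \<psi>" "supported \<phi>"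
  then have U: "U \<psi> = (\<lambda>v. \<psi> (\<pi> v))" "U \<phi> = (\<lambda>v. \<phi> (\<pi> v))"
    using assms(1) by auto
  show "supported (U \<psi>)"
    using \<open>supported \<psi>\<close> assms(3) by (simp add: U supported_def)
  have "bij_betw \<pi> labels labels"
    by (rule bij_betwI[where g = \<pi>]) (use assms in auto)
  then have "(\<Sum>v \<in> labels. (cmod (\<psi> (\<pi> v) - \<phi> (\<pi> v)))\<^sup>2) = (\<Sum>v \<in> labels. (cmod (\<psi> v - \<phi> v))\<^sup>2)"
    by (rule sum.reindex_bij_betw)
  then show "state_dist (U \<psi>) (U \<phi>) = state_dist \<psi> \<phi>"
    by (simp add: U state_dist_def L2_set_def)
qed

lemma isometric_phase:
  assumes "\<And>\<psi>. supported \<psi> \<Longrightarrow> U \<psi> = (\<lambda>v. s v * \<psi> v)" and "\<And>v. cmod (s v) = 1"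
  shows "isometric U"
  unfolding isometric_def
proof (intro allI impI conjI)
  fix \<psi> \<phi> assume "supported \<psi>" "supported \<phi>"
  then have U: "U \<psi> = (\<lambda>v. s v * \<psi> v)" "U \<phi> = (\<lambda>v. s v * \<phi> v)"
    using assms(1) by auto
  show "supported (U \<psi>)"
    using \<open>supported \<psi>\<close> by (simp add: U supported_def)
  show "state_dist (U \<psi>) (U \<phi>) = state_dist \<psi> \<phi>"
    by (simp add: U state_dist_def assms(2) norm_mult flip: right_diff_distrib)
qed

text \<open>The parallelogram law, applied to the two labels that differ exactly at
  \<open>w\<close>.\<close>

lemma isometric_hadamard:
  assumes w: "w \<in> wires_used"
  shows "isometric (gate_sem (Hadamard w))"
  unfolding isometric_def
proof (intro allI impI conjI)
  fix \<psi> \<phi> assume sup: "supported \<psi>" "supported \<phi>"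
  show "supported (gate_sem (Hadamard w) \<psi>)"
    using sup w by (simp add: supported_def upd_labels)
  define \<delta> where "\<delta> v = \<psi> v - \<phi> v" for v
  let ?\<pi> = "\<lambda>v :: label. v(w := v w + 1)"
  let ?h = "\<lambda>v. (cmod (gate_sem (Hadamard w) \<delta> v))\<^sup>2"
  let ?d = "\<lambda>v. (cmod (\<delta> v))\<^sup>2"
  have "bij_betw ?\<pi> labels labels"
    by (rule bij_betwI[where g = ?\<pi>]) (use w in \<open>auto simp: upd_labels add.assoc\<close>)
  then have re: "(\<Sum>v \<in> labels. f (?\<pi> v)) = (\<Sum>v \<in> labels. f v)" for f :: "label \<Rightarrow> real"
    by (rule sum.reindex_bij_betw)
  have "?h v + ?h (?\<pi> v) = ?d v + ?d (?\<pi> v)" for v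
  proof -
    have par: "(cmod ((a + b) / sqrt 2))\<^sup>2 + (cmod ((a - b) / sqrt 2))\<^sup>2 = (cmod a)\<^sup>2 + (cmod b)\<^sup>2"
      for a b :: complex
    proof -
      have "(cmod (a + b))\<^sup>2 + (cmod (a - b))\<^sup>2 = 2 * ((cmod a)\<^sup>2 + (cmod b)\<^sup>2)"
        unfolding cmod_power2 by (simp add: power2_eq_square algebra_simps)
      then show ?thesis by (simp add: norm_divide power_divide field_simps)
    qed
    have "v(w := 0) = v \<and> ?\<pi> v = v(w := 1) \<and> v w = 0 \<or> v(w := 1) = v \<and> ?\<pi> v = v(w := 0) \<and> v w = 1"
      by (cases "v w") (auto simp: fun_upd_idem_iff)
    then show ?thesis
      using par[of "\<delta> (v(w := 0))" "\<delta> (v(w := 1))"] by (elim disjE) (simp_all add: add.commute)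
  qed
  \<comment> \<open>Summing over all labels counts each pair twice on both sides.\<close>
  then have "(\<Sum>v \<in> labels. ?h v + ?h (?\<pi> v)) = (\<Sum>v \<in> labels. ?d v + ?d (?\<pi> v))"
    by simp
  then have "(\<Sum>v \<in> labels. ?h v) = (\<Sum>v \<in> labels. ?d v)"
    unfolding sum.distrib re[of ?h] re[of ?d] by simp
  moreover have "gate_sem (Hadamard w) \<psi> v - gate_sem (Hadamard w) \<phi> v = gate_sem (Hadamard w) \<delta> v" for v
    by (simp add: \<delta>_def algebra_simps diff_divide_distrib add_divide_distrib)
  ultimately show "state_dist (gate_sem (Hadamard w) \<psi>) (gate_sem (Hadamard w) \<phi>) = state_dist \<psi> \<phi>"
    by (simp only: state_dist_def L2_set_def \<delta>_def)
qed

lemma isometric_hadamards: "set ws \<subseteq> wires_used \<Longrightarrow> isometric (fold (op_sem F) (hadamards ws))"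
  by (rule isometric_fold) (auto simp: hadamards_def op_sem_Gate isometric_hadamard subset_iff simp del: gate_sem.simps)

lemma isometric_query:
  assumes "j < N" "\<And>i x. i \<in> carrier_vec m \<Longrightarrow> x \<in> carrier_vec n \<Longrightarrow> F i x \<in> carrier_vec l"
  shows "isometric (op_sem F (Query (idx_reg m) (arg_reg n j) (val_reg l j)))"
  by (rule isometric_permutation[where \<pi> = "\<lambda>v. xor_into (val_reg l j) (F (idx v) (arg j v)) v"])
    (use assms in \<open>simp_all add: xor_into_labels read_xor_into_other xor_into_twice\<close>)

lemma supported_expand: "supported \<psi> \<Longrightarrow> \<psi> = (\<lambda>v'. \<Sum>v \<in> labels. \<psi> v * ket v v')"
proof
  fix v'
  assume \<psi>: "supported \<psi>"
  have "(\<Sum>v \<in> labels. \<psi> v * ket v v') = (\<Sum>v \<in> labels. if v' = v then \<psi> v else 0)"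
    by (intro sum.cong) (auto simp: ket_def)
  also have "\<dots> = \<psi> v'"
    using \<psi> by (auto simp: supported_def)
  finally show "\<psi> v' = (\<Sum>v \<in> labels. \<psi> v * ket v v')" ..
qed

section \<open>The subroutine circuits on superpositions\<close>

definition full :: "label \<Rightarrow> bool" where
  "full v \<longleftrightarrow> span_dim n ((\<lambda>j. arg j v) ` {..<N}) = n"

lemma full_upd_Flag [simp]: "full (v(Flag := b)) \<longleftrightarrow> full v"
  by (simp add: full_def)

text \<open>Linearity extends the specification from clean basis states. The label map is an
  involution, so the amplitude arriving at \<open>v'\<close> comes from the image of
  \<open>v'\<close>.\<close>

lemma rank_circuit_sem:
  assumes rk: "rank_circuit n N rk" and \<psi>: "supported \<psi>"
  shows "fold gate_sem rk \<psi> = (\<lambda>v. \<psi> (v(Flag := v Flag + (if full v then 0 else 1))))"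
proof
  fix v'
  let ?\<pi> = "\<lambda>v. v(Flag := v Flag + (if full v then 0 else 1))"
  have inv: "?\<pi> (?\<pi> v) = v" for v by (auto simp: full_upd_Flag add.assoc)
  have "fold gate_sem rk \<psi> v' = (\<Sum>v \<in> labels. \<psi> v * fold gate_sem rk (ket v) v')"
    using fold_gate_sem_sum[OF finite_labels, of rk \<psi> ket] supported_expand[OF \<psi>] by metis
  also have "\<dots> = (\<Sum>v \<in> labels. \<psi> v * ket (?\<pi> v) v')"
    using rk by (intro sum.cong refl) (auto simp: rank_circuit_def full_def labels_clean)
  also have "\<dots> = (\<Sum>v \<in> labels. if v = ?\<pi> v' then \<psi> (?\<pi> v') else 0)"
  proof (intro sum.cong refl)
    fix v
    have "v' = ?\<pi> v \<longleftrightarrow> v = ?\<pi> v'" using inv by metis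
    then show "\<psi> v * ket (?\<pi> v) v' = (if v = ?\<pi> v' then \<psi> (?\<pi> v') else 0)"
      by (simp add: ket_def)
  qed
  also have "\<dots> = \<psi> (?\<pi> v')"
    using \<psi> by (auto simp: supported_def)
  finally show "fold gate_sem rk \<psi> v' = \<psi> (?\<pi> v')" .
qed

lemma isometric_rank_circuit:
  assumes "rank_circuit n N rk"
  shows "isometric (fold gate_sem rk)"
  by (rule isometric_permutation[where \<pi> = "\<lambda>v. v(Flag := v Flag + (if full v then 0 else 1))"])
    (simp_all add: rank_circuit_sem[OF assms] add.assoc upd_labels)

lemma reflection_circuit_sem:
  assumes rf: "reflection_circuit m rf" and \<psi>: "supported \<psi>"
  shows "fold gate_sem rf \<psi> = (\<lambda>v. (if idx v = 0\<^sub>v m then 1 else -1) * \<psi> v)"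
proof
  fix v'
  have "fold gate_sem rf \<psi> v' = (\<Sum>v \<in> labels. \<psi> v * fold gate_sem rf (ket v) v')"
    using fold_gate_sem_sum[OF finite_labels, of rf \<psi> ket] supported_expand[OF \<psi>] by metis
  also have "\<dots> = (\<Sum>v \<in> labels. \<psi> v * ((if idx v = 0\<^sub>v m then 1 else -1) * ket v v'))"
    using rf by (intro sum.cong refl) (auto simp: reflection_circuit_def labels_clean)
  also have "\<dots> = (\<Sum>v \<in> labels. if v = v' then (if idx v' = 0\<^sub>v m then 1 else -1) * \<psi> v' else 0)"
    by (intro sum.cong) (auto simp: ket_def)
  also have "\<dots> = (if idx v' = 0\<^sub>v m then 1 else -1) * \<psi> v'"
    using \<psi> by (auto simp: supported_def)
  finally show "fold gate_sem rf \<psi> v' = (if idx v' = 0\<^sub>v m then 1 else -1) * \<psi> v'" .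
qed

lemma isometric_reflection_circuit:
  assumes "reflection_circuit m rf"
  shows "isometric (fold gate_sem rf)"
  by (rule isometric_phase[OF reflection_circuit_sem[OF assms]]) auto

lemma prod_state_reflection:
  assumes "reflection_circuit m rf"
  shows "fold gate_sem rf (prod_state \<alpha> \<beta> \<gamma>) = prod_state (\<lambda>i. (if i = 0\<^sub>v m then 1 else -1) * \<alpha> i) \<beta> \<gamma>"
  unfolding reflection_circuit_sem[OF assms supported_prod_state] by (auto simp: prod_state_def)

definition steps12 :: "op list" where
  "steps12 = map (\<lambda>j. Query (idx_reg m) (arg_reg n j) (val_reg l j)) [0..<N]
     @ hadamards (concat (map (arg_reg n) [0..<N]))"

lemma steps12_cases:
  assumes "u \<in> set steps12"
  obtains j where "j < N" "u = Query (idx_reg m) (arg_reg n j) (val_reg l j)"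
    | w where "w \<in> wires_used" "u = Gate (Hadamard w)"
  using assms unfolding steps12_def hadamards_def wires_used_def by auto blast

lemma steps12_undo:
  assumes "\<And>i x. i \<in> carrier_vec m \<Longrightarrow> x \<in> carrier_vec n \<Longrightarrow> F i x \<in> carrier_vec l"
  shows "fold (op_sem F) (rev steps12) (fold (op_sem F) steps12 \<psi>) = \<psi>"
proof (rule fold_involutions)
  fix u \<psi> assume "u \<in> set steps12"
  then show "op_sem F u (op_sem F u \<psi>) = \<psi>"
    by (cases rule: steps12_cases)
      (simp_all only: query_query[OF assms] op_sem.simps(1) hadamard_hadamard)
qed

lemma isometric_steps12:
  assumes "\<And>i x. i \<in> carrier_vec m \<Longrightarrow> x \<in> carrier_vec n \<Longrightarrow> F i x \<in> carrier_vec l"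
  shows "isometric (fold (op_sem F) steps12)" "isometric (fold (op_sem F) (rev steps12))"
proof -
  have "isometric (op_sem F u)" if "u \<in> set steps12" for u
    using that
  proof (cases rule: steps12_cases)
    case (1 j)
    then show ?thesis using isometric_query[of j F] assms by (simp del: op_sem.simps)
  next
    case (2 w)
    then have "op_sem F u = gate_sem (Hadamard w)" by (auto simp del: gate_sem.simps)
    then show ?thesis using 2 isometric_hadamard by metis
  qed
  then show "isometric (fold (op_sem F) steps12)" "isometric (fold (op_sem F) (rev steps12))"
    by (auto intro: isometric_fold)
qed

lemma prod_state_queries:
  assumes "k \<le> N" "\<And>i x. i \<in> carrier_vec m \<Longrightarrow> x \<in> carrier_vec n \<Longrightarrow> F i x \<in> carrier_vec l"
  shows "fold (op_sem F) (map (\<lambda>j. Query (idx_reg m) (arg_reg n j) (val_reg l j)) [0..<k]) (prod_state \<alpha> \<beta> \<gamma>)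
    = prod_state \<alpha> (\<lambda>j i x z. if j < k then \<beta> j i x (z + F i x) else \<beta> j i x z) \<gamma>"
  using assms(1)
proof (induction k)
  case (Suc k)
  then show ?case
    by (simp add: prod_state_query[OF _ assms(2)] del: op_sem.simps)
      (intro prod_state_cong; auto simp: less_Suc_eq)
qed simp

lemma prod_state_hadamards_args:
  assumes "k \<le> N"
  shows "fold (op_sem F) (hadamards (concat (map (arg_reg n) [0..<k]))) (prod_state \<alpha> \<beta> \<gamma>) =
    prod_state \<alpha> (\<lambda>j i x z. if j < k
      then (1 / sqrt 2) ^ n * (\<Sum>y \<in> carrier_vec n. chi (x \<bullet> y) * \<beta> j i y z) else \<beta> j i x z) \<gamma>"
  using assms
proof (induction k)
  case (Suc k)
  have "hadamards (concat (map (arg_reg n) [0..<Suc k])) =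
      hadamards (concat (map (arg_reg n) [0..<k])) @ hadamards (arg_reg n k)"
    by (simp add: hadamards_def)
  with Suc show ?case
    by (simp add: prod_state_hadamards_arg) (intro prod_state_cong; auto simp: less_Suc_eq)
qed (simp add: hadamards_def)

lemma prod_state_steps12:
  assumes "\<And>i x. i \<in> carrier_vec m \<Longrightarrow> x \<in> carrier_vec n \<Longrightarrow> F i x \<in> carrier_vec l"
  shows "fold (op_sem F) steps12 (prod_state \<alpha> \<beta> \<gamma>) =
    prod_state \<alpha> (\<lambda>j i u z. (1 / sqrt 2) ^ n * (\<Sum>y \<in> carrier_vec n. chi (u \<bullet> y) * \<beta> j i y (z + F i y))) \<gamma>"
proof -
  note queries = prod_state_queries[where k = N and F = F, OF order_refl]
  show ?thesis
    unfolding steps12_def using assms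
    by (simp add: queries prod_state_hadamards_args cong: prod_state_cong)
qed

end

section \<open>Fourier amplitudes of functions on bit strings\<close>

lemma sum_shift:
  fixes f :: "bit vec \<Rightarrow> real"
  assumes "s \<in> carrier_vec n"
  shows "(\<Sum>y \<in> carrier_vec n. f (y + s)) = (\<Sum>y \<in> carrier_vec n. f y)"
proof -
  have "bij_betw (\<lambda>y. y + s) (carrier_vec n) (carrier_vec n)"
    by (rule bij_betwI[where g = "\<lambda>y. y + s"]) (use assms in \<open>auto simp: add_self_bit_vec[where k = n]\<close>)
  then show ?thesis by (rule sum.reindex_bij_betw)
qed

lemma chi_scalar_add:
  assumes "u \<in> carrier_vec n" "y \<in> carrier_vec n" "t \<in> carrier_vec n"
  shows "chi (u \<bullet> (y + t)) = chi (u \<bullet> y) * chi (u \<bullet> t)"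
  by (simp add: scalar_prod_add_distrib[OF assms] chi_add)

text \<open>Orthogonality of characters: if \<open>t\<close> has a one in position \<open>k\<close>,
  adding the \<open>k\<close>-th unit vector to \<open>u\<close> flips every sign, so the sum equals
  its negative.\<close>

lemma chi_sum:
  assumes t: "t \<in> carrier_vec n"
  shows "(\<Sum>u \<in> carrier_vec n. chi (u \<bullet> t)) = (if t = 0\<^sub>v n then 2 ^ n else 0)"
proof (cases "t = 0\<^sub>v n")
  case True
  then show ?thesis by (simp add: card_carrier_vec_bit)
next
  case False
  then obtain k where k: "k < n" "t $ k = 1"
    using t by (auto simp: vec_eq_iff)
  let ?e = "unit_vec n k :: bit vec"
  have "(\<Sum>u \<in> carrier_vec n. chi (u \<bullet> t)) = (\<Sum>u \<in> carrier_vec n. chi ((u + ?e) \<bullet> t))"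
    by (rule sum_shift[symmetric]) simp
  also have "\<dots> = (\<Sum>u \<in> carrier_vec n. - chi (u \<bullet> t))"
    using t k by (intro sum.cong refl) (simp add: add_scalar_prod_distrib[of _ n] chi_add)
  finally show ?thesis using False by (simp add: sum_negf)
qed

text \<open>Amplitude of \<open>u\<close> and \<open>z\<close> after Hadamard gates on the first
  register of a uniform superposition of all \<open>y\<close> paired with \<open>h y\<close>.
  Preparation and gates each contribute \<open>(1 / sqrt 2) ^ n\<close>.\<close>

definition amp :: "nat \<Rightarrow> (bit vec \<Rightarrow> bit vec) \<Rightarrow> bit vec \<Rightarrow> bit vec \<Rightarrow> real" where
  "amp n h u z = (1 / 2) ^ n * (\<Sum>y \<in> carrier_vec n. chi (u \<bullet> y) * of_bool (h y = z))"

text \<open>Translation by \<open>s\<close> permutes the terms and, as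
  \<open>u \<bullet> s = 1\<close>, reverses their signs.\<close>

lemma amp_period:
  assumes s: "s \<in> carrier_vec n" and h: "\<And>x. x \<in> carrier_vec n \<Longrightarrow> h x = h (x + s)"
    and u: "u \<in> carrier_vec n" "u \<bullet> s = 1"
  shows "amp n h u z = 0"
proof -
  have "(\<Sum>y \<in> carrier_vec n. chi (u \<bullet> y) * of_bool (h y = z)) =
      (\<Sum>y \<in> carrier_vec n. chi (u \<bullet> (y + s)) * of_bool (h (y + s) = z))"
    by (rule sum_shift[OF s, symmetric])
  also have "\<dots> = (\<Sum>y \<in> carrier_vec n. - (chi (u \<bullet> y) * of_bool (h y = z)))"
    using u s by (intro sum.cong refl) (simp add: chi_scalar_add[where n = n] flip: h)
  finally show ?thesis by (simp add: amp_def sum_negf)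
qed

text \<open>The autocorrelation of \<open>h\<close> at \<open>t\<close> as a Fourier sum. Expanding
  the square gives terms for pairs \<open>y\<close>, \<open>y'\<close>; the sum over
  \<open>u\<close> forces \<open>y' = y + t\<close>, the sum over \<open>z\<close> forces
  \<open>h y' = h y\<close>.\<close>

lemma amp_correlation:
  assumes h: "h \<in> carrier_vec n \<rightarrow> carrier_vec l" and t: "t \<in> carrier_vec n"
  shows "(\<Sum>u \<in> carrier_vec n. \<Sum>z \<in> carrier_vec l. chi (u \<bullet> t) * (amp n h u z)\<^sup>2) =
    (1 / 2) ^ n * card {y \<in> carrier_vec n. h (y + t) = h y}"
proof -
  let ?C = "carrier_vec n :: bit vec set" and ?L = "carrier_vec l :: bit vec set"
  have sq: "chi (u \<bullet> t) * (amp n h u z)\<^sup>2 = (1 / 4) ^ n * (\<Sum>y \<in> ?C. \<Sum>y' \<in> ?C.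
      chi (u \<bullet> (y' + (y + t))) * (of_bool (h y = z) * of_bool (h y' = z)))" if u: "u \<in> ?C" for u z
  proof -
    have "(amp n h u z)\<^sup>2 = ((1 / 2) ^ n * (1 / 2) ^ n) * ((\<Sum>y \<in> ?C. chi (u \<bullet> y) * of_bool (h y = z)) *
        (\<Sum>y' \<in> ?C. chi (u \<bullet> y') * of_bool (h y' = z)))"
      unfolding amp_def power2_eq_square by (simp only: mult_ac)
    also have "(1 / 2) ^ n * (1 / 2) ^ n = (1 / 4 :: real) ^ n"
      by (simp flip: power_mult_distrib)
    finally have "chi (u \<bullet> t) * (amp n h u z)\<^sup>2 = (1 / 4) ^ n * (chi (u \<bullet> t) *
        (\<Sum>y \<in> ?C. \<Sum>y' \<in> ?C. (chi (u \<bullet> y) * of_bool (h y = z)) * (chi (u \<bullet> y') * of_bool (h y' = z))))"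
      unfolding sum_product by (simp only: mult.left_commute)
    also have "\<dots> = (1 / 4) ^ n * (\<Sum>y \<in> ?C. \<Sum>y' \<in> ?C.
        chi (u \<bullet> t) * ((chi (u \<bullet> y) * of_bool (h y = z)) * (chi (u \<bullet> y') * of_bool (h y' = z))))"
      by (simp only: sum_distrib_left)
    also have "\<dots> = (1 / 4) ^ n * (\<Sum>y \<in> ?C. \<Sum>y' \<in> ?C.
        chi (u \<bullet> (y' + (y + t))) * (of_bool (h y = z) * of_bool (h y' = z)))"
    proof -
      have "chi (u \<bullet> (y' + (y + t))) = chi (u \<bullet> y') * (chi (u \<bullet> y) * chi (u \<bullet> t))"
        if "y \<in> ?C" "y' \<in> ?C" for y y'
        using that u t by (simp add: chi_scalar_add[where n = n])
      then show ?thesis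
        by (rule_tac arg_cong2[of _ _ _ _ "(*)"], simp, intro sum.cong refl) (simp only: mult_ac)
    qed
    finally show ?thesis .
  qed
  have "(\<Sum>u \<in> ?C. \<Sum>z \<in> ?L. chi (u \<bullet> t) * (amp n h u z)\<^sup>2) =
      (1 / 4) ^ n * (\<Sum>u \<in> ?C. \<Sum>z \<in> ?L. \<Sum>y \<in> ?C. \<Sum>y' \<in> ?C.
        chi (u \<bullet> (y' + (y + t))) * (of_bool (h y = z) * of_bool (h y' = z)))"
    by (simp add: sq sum_distrib_left)
  also have "(\<Sum>u \<in> ?C. \<Sum>z \<in> ?L. \<Sum>y \<in> ?C. \<Sum>y' \<in> ?C.
        chi (u \<bullet> (y' + (y + t))) * (of_bool (h y = z) * of_bool (h y' = z))) =
      (\<Sum>y \<in> ?C. \<Sum>y' \<in> ?C. \<Sum>u \<in> ?C. \<Sum>z \<in> ?L.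
        chi (u \<bullet> (y' + (y + t))) * (of_bool (h y = z) * of_bool (h y' = z)))"
  proof -
    have swap: "(\<Sum>z \<in> Z. \<Sum>y \<in> ?C. \<Sum>y' \<in> ?C. f z y y') = (\<Sum>y \<in> ?C. \<Sum>y' \<in> ?C. \<Sum>z \<in> Z. f z y y')"
      for f :: "bit vec \<Rightarrow> bit vec \<Rightarrow> bit vec \<Rightarrow> real" and Z
    proof -
      have "(\<Sum>z \<in> Z. \<Sum>y \<in> ?C. \<Sum>y' \<in> ?C. f z y y') = (\<Sum>y \<in> ?C. \<Sum>z \<in> Z. \<Sum>y' \<in> ?C. f z y y')"
        by (rule sum.swap)
      also have "\<dots> = (\<Sum>y \<in> ?C. \<Sum>y' \<in> ?C. \<Sum>z \<in> Z. f z y y')"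
        by (rule sum.cong, rule refl, rule sum.swap)
      finally show ?thesis .
    qed
    show ?thesis
      unfolding swap[of _ ?L] by (rule swap)
  qed
  also have "\<dots> = (\<Sum>y \<in> ?C. \<Sum>y' \<in> ?C. (if y' = y + t then 2 ^ n * of_bool (h (y + t) = h y) else 0))"
  proof (intro sum.cong refl)
    fix y y' assume y: "y \<in> ?C" "y' \<in> ?C"
    have "(\<Sum>z \<in> ?L. of_bool (h y = z) * of_bool (h y' = z)) =
        (\<Sum>z \<in> ?L. if h y = z then of_bool (h y' = h y) else 0 :: real)"
      by (intro sum.cong) auto
    also have "\<dots> = of_bool (h y' = h y)"
      using h y by auto
    finally have "(\<Sum>z \<in> ?L. chi (u \<bullet> (y' + (y + t))) * (of_bool (h y = z) * of_bool (h y' = z))) =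
        chi (u \<bullet> (y' + (y + t))) * of_bool (h y' = h y)" for u
      by (simp flip: sum_distrib_left)
    then have "(\<Sum>u \<in> ?C. \<Sum>z \<in> ?L. chi (u \<bullet> (y' + (y + t))) * (of_bool (h y = z) * of_bool (h y' = z))) =
        (\<Sum>u \<in> ?C. chi (u \<bullet> (y' + (y + t)))) * of_bool (h y' = h y)"
      by (simp add: sum_distrib_right)
    moreover have "y' + (y + t) = 0\<^sub>v n \<longleftrightarrow> y' = y + t"
    proof
      assume "y' + (y + t) = 0\<^sub>v n"
      then show "y' = y + t"
        using add_self_bit_vec[of "y + t" n y'] y t by (metis add_carrier_vec left_zero_vec)
    next
      assume "y' = y + t"
      then show "y' + (y + t) = 0\<^sub>v n" using y t by (auto simp: vec_eq_iff)
    qed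
    ultimately show "(\<Sum>u \<in> ?C. \<Sum>z \<in> ?L. chi (u \<bullet> (y' + (y + t))) * (of_bool (h y = z) * of_bool (h y' = z))) =
        (if y' = y + t then 2 ^ n * of_bool (h (y + t) = h y) else 0)"
      using y t by (simp add: chi_sum)
  qed
  also have "\<dots> = (\<Sum>y \<in> ?C. 2 ^ n * of_bool (h (y + t) = h y))"
    using t by (intro sum.cong refl) simp
  also have "\<dots> = 2 ^ n * card {y \<in> ?C. h (y + t) = h y}"
    by (simp add: sum_distrib_left[symmetric] sum_of_bool_eq Int_def)
  finally have "(\<Sum>u \<in> ?C. \<Sum>z \<in> ?L. chi (u \<bullet> t) * (amp n h u z)\<^sup>2) =
      ((1 / 4) ^ n * 2 ^ n) * card {y \<in> ?C. h (y + t) = h y}"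
    by simp
  also have "(1 / 4) ^ n * 2 ^ n = (1 / 2 :: real) ^ n"
    by (simp flip: power_mult_distrib)
  finally show ?thesis .
qed

text \<open>Parseval's identity, obtained as the autocorrelation at zero.\<close>

lemma amp_total:
  assumes h: "h \<in> carrier_vec n \<rightarrow> carrier_vec l"
  shows "(\<Sum>u \<in> carrier_vec n. \<Sum>z \<in> carrier_vec l. (amp n h u z)\<^sup>2) = 1"
proof -
  have "{y \<in> carrier_vec n. h (y + 0\<^sub>v n) = h y} = carrier_vec n" by auto
  then show ?thesis
    using amp_correlation[OF h, of "0\<^sub>v n"] by (simp add: card_carrier_vec_bit flip: power_mult_distrib)
qed

lemma amp_orthogonal_weight:
  assumes h: "h \<in> carrier_vec n \<rightarrow> carrier_vec l" and t: "t \<in> carrier_vec n"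
    and pr: "measure_pmf.prob (pmf_of_set (carrier_vec n)) {x. h (x + t) = h x} \<le> 1 / 2"
  shows "(\<Sum>u \<in> carrier_vec n. \<Sum>z \<in> carrier_vec l. of_bool (u \<bullet> t = 0) * (amp n h u z)\<^sup>2) \<le> 3 / 4"
proof -
  have ne: "carrier_vec n \<noteq> ({} :: bit vec set)" by (metis empty_iff zero_carrier_vec)
  have "carrier_vec n \<inter> {x. h (x + t) = h x} = {y \<in> carrier_vec n. h (y + t) = h y}" by blast
  then have "measure_pmf.prob (pmf_of_set (carrier_vec n)) {x. h (x + t) = h x} =
      card {y \<in> carrier_vec n. h (y + t) = h y} / 2 ^ n"
    by (simp add: measure_pmf_of_set ne card_carrier_vec_bit)
  with pr have le: "(1 / 2) ^ n * card {y \<in> carrier_vec n. h (y + t) = h y} \<le> 1 / 2"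
    by (simp add: power_one_over field_simps)
  \<comment> \<open>The indicator of orthogonality is the average of the trivial character and
    \<open>chi\<close>; this turns the bound 1/2 into (1 + 1/2) / 2.\<close>
  have "of_bool (b = 0) = (1 + chi b) / 2" for b
    by (simp add: chi_def)
  then have "(\<Sum>u \<in> carrier_vec n. \<Sum>z \<in> carrier_vec l. of_bool (u \<bullet> t = 0) * (amp n h u z)\<^sup>2) =
      (\<Sum>u \<in> carrier_vec n. \<Sum>z \<in> carrier_vec l. ((amp n h u z)\<^sup>2 + chi (u \<bullet> t) * (amp n h u z)\<^sup>2) / 2)"
    by (intro sum.cong refl) (simp add: algebra_simps)
  also have "\<dots> = (1 + (1 / 2) ^ n * card {y \<in> carrier_vec n. h (y + t) = h y}) / 2"
    unfolding sum_divide_distrib[symmetric] sum.distrib amp_total[OF h] amp_correlation[OF h t] ..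
  finally show ?thesis using le by simp
qed

section \<open>Grover iterations with the approximate test\<close>

lemma bit_add_eq_0_iff: "(a :: bit) + b = 0 \<longleftrightarrow> b = a"
  by (cases a; cases b) simp_all

text \<open>Applied with \<open>d = 2 ^ m\<close> and \<open>q = sqrt (2 ^ m - 1)\<close>. Then
  \<open>2 * q / d\<close> and \<open>(d - 2) / d\<close> are the sine and cosine of twice the
  Grover angle, and the right-hand sides are addition formulas.\<close>

lemma grover_rotation:
  fixes q s c d :: real
  assumes "d \<noteq> 0" "q\<^sup>2 = d - 1"
  shows "2 / d * (- s + q * c) + s = s * ((d - 2) / d) + c * (2 * q / d)"
    and "q \<noteq> 0 \<Longrightarrow> 2 / d * (- s + q * c) - c / q = (c * ((d - 2) / d) - s * (2 * q / d)) / q"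
proof -
  show "2 / d * (- s + q * c) + s = s * ((d - 2) / d) + c * (2 * q / d)"
    using assms(1) by (simp add: field_simps)
  assume "q \<noteq> 0"
  have "q * (q * c) = d * c - c"
    using assms(2) by (metis left_diff_distrib mult.assoc mult_1 power2_eq_square)
  then have num: "2 * q * (- s + q * c) - c * d = c * (d - 2) - 2 * q * s"
    by (simp add: algebra_simps)
  have "2 / d * (- s + q * c) - c / q = (2 * q * (- s + q * c) - c * d) / (d * q)"
    using \<open>q \<noteq> 0\<close> assms(1) by (simp add: field_simps)
  also have "\<dots> = (c * ((d - 2) / d) - s * (2 * q / d)) / q"
    unfolding num using \<open>q \<noteq> 0\<close> assms(1) by (simp add: field_simps)
  finally show "2 / d * (- s + q * c) - c / q = (c * ((d - 2) / d) - s * (2 * q / d)) / q" .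
qed

section \<open>The rotation angle\<close>

definition grover_angle :: "nat \<Rightarrow> real" where
  "grover_angle m = arcsin (2 powr (- (real m / 2)))"

lemma sin_angle: "sin (grover_angle m) = 1 / sqrt (2 ^ m)"
proof -
  have "2 powr (- (real m / 2)) = 1 / sqrt (2 ^ m)"
    by (simp add: powr_minus_divide powr_half_sqrt_powr powr_realpow)
  moreover have "1 / sqrt (2 ^ m) \<le> 1"
    by simp
  ultimately show ?thesis
    unfolding grover_angle_def by (simp add: sin_arcsin order_trans[OF _ zero_le_divide_1_iff[THEN iffD2]])
qed

lemma angle_bounds: "0 < grover_angle m" "grover_angle m \<le> pi / 2"
proof -
  have "2 powr (- (real m / 2)) \<le> 2 powr 0"
    by (intro powr_mono) auto
  then have le: "2 powr (- (real m / 2)) \<le> 1" by simp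
  then have "arcsin 0 < arcsin (2 powr (- (real m / 2)))"
    by (intro arcsin_less_mono[THEN iffD2]) auto
  then show "0 < grover_angle m" by (simp add: grover_angle_def)
  show "grover_angle m \<le> pi / 2"
    unfolding grover_angle_def using le by (intro arcsin_ubound) (auto intro: order_trans[OF _ powr_ge_zero])
qed

lemma cos_angle: "cos (grover_angle m) = sqrt (2 ^ m - 1) / sqrt (2 ^ m)"
proof -
  have "cos (grover_angle m) \<ge> 0"
    using angle_bounds[of m] by (intro cos_ge_zero) auto
  then have "cos (grover_angle m) = sqrt (1 - (sin (grover_angle m))\<^sup>2)"
    by (simp flip: cos_squared_eq)
  also have "1 - (sin (grover_angle m))\<^sup>2 = (2 ^ m - 1) / 2 ^ m"
    by (simp add: sin_angle power_divide field_simps)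
  finally show ?thesis by (simp add: real_sqrt_divide)
qed

locale search = registers +
  fixes F :: f_oracle and g :: g_oracle and i0 :: "bit vec" and rk rf :: "gate list"
  assumes rk: "rank_circuit n N rk" and rf: "reflection_circuit m rf"
    and F: "\<And>i x. i \<in> carrier_vec m \<Longrightarrow> x \<in> carrier_vec n \<Longrightarrow> F i x \<in> carrier_vec l"
    and g: "\<And>x. x \<in> carrier_vec n \<Longrightarrow> g x \<in> carrier_vec l"
    and i0: "i0 \<in> carrier_vec m"
    and period: "has_period n (\<lambda>x. F i0 x + g x)"
    and no_period: "\<And>i t. i \<in> carrier_vec m \<Longrightarrow> i \<noteq> i0 \<Longrightarrow> t \<in> carrier_vec n \<Longrightarrow> t \<noteq> 0\<^sub>v n \<Longrightarrow>
      measure_pmf.prob (pmf_of_set (carrier_vec n))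
        {x. F i (x + t) + g (x + t) = F i x + g x} \<le> 1 / 2"
begin

abbreviation "h i x \<equiv> F i x + g x"

text \<open>The ignored arguments give the shape expected by \<open>prod_state\<close>: all pairs
  are alike and independent of the index.\<close>

definition prep :: "nat \<Rightarrow> bit vec \<Rightarrow> bit vec \<Rightarrow> bit vec \<Rightarrow> real" where
  "prep _ _ x z = (1 / sqrt 2) ^ n * of_bool (z = g x)"

definition minus_amp :: "bit \<Rightarrow> real" where
  "minus_amp b = chi b / sqrt 2"

definition mark :: "(bit vec \<Rightarrow> real) \<Rightarrow> bit vec \<Rightarrow> real" where
  "mark \<alpha> i = (if i = i0 then - \<alpha> i else \<alpha> i)"

lemma h_carrier: "i \<in> carrier_vec m \<Longrightarrow> h i \<in> carrier_vec n \<rightarrow> carrier_vec l"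
  using F g by auto

lemma half_power: "(1 / sqrt 2) ^ k * ((1 / sqrt 2) ^ k * x) = (1 / 2) ^ k * (x :: real)"
  by (simp flip: mult.assoc power_mult_distrib)

lemma steps12_prep:
  "fold (op_sem F) steps12 (prod_state \<alpha> prep \<gamma>) = prod_state \<alpha> (\<lambda>_ i. amp n (h i)) \<gamma>"
proof -
  have eq: "z + F i y = g y \<longleftrightarrow> h i y = z"
    if "i \<in> carrier_vec m" "y \<in> carrier_vec n" "z \<in> carrier_vec l" for i y z
  proof -
    note c = F[OF that(1,2)] g[OF that(2)] that(3)
    show ?thesis
      using c add_self_bit_vec[of "F i y" l z] add_self_bit_vec[of "F i y" l "g y"]
      by (metis comm_add_vec)
  qed
  have "fold (op_sem F) steps12 (prod_state \<alpha> prep \<gamma>) = prod_state \<alpha> (\<lambda>j i u z. (1 / sqrt 2) ^ n *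
      (\<Sum>y \<in> carrier_vec n. chi (u \<bullet> y) * prep j i y (z + F i y))) \<gamma>"
    by (rule prod_state_steps12) (rule F)
  also have "\<dots> = prod_state \<alpha> (\<lambda>_ i. amp n (h i)) \<gamma>"
  proof (rule prod_state_cong)
    fix j and i u z :: "bit vec"
    assume i: "i \<in> carrier_vec m" and z: "z \<in> carrier_vec l"
    let ?c = "(1 / sqrt 2) ^ n :: real"
    have "?c * (\<Sum>y \<in> carrier_vec n. chi (u \<bullet> y) * prep j i y (z + F i y)) =
        ?c * (\<Sum>y \<in> carrier_vec n. ?c * (chi (u \<bullet> y) * of_bool (h i y = z)))"
    proof (rule arg_cong[of _ _ "(*) ?c"], rule sum.cong[OF refl])
      fix y :: "bit vec" assume "y \<in> carrier_vec n"
      then show "chi (u \<bullet> y) * prep j i y (z + F i y) = ?c * (chi (u \<bullet> y) * of_bool (h i y = z))"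
        using eq[OF i _ z] by (simp only: prep_def mult.left_commute)
    qed
    also have "\<dots> = amp n (h i) u z"
      unfolding amp_def sum_distrib_left[symmetric] by (rule half_power)
    finally show "?c * (\<Sum>y \<in> carrier_vec n. chi (u \<bullet> y) * prep j i y (z + F i y)) = amp n (h i) u z" .
  qed simp_all
  finally show ?thesis .
qed

section \<open>The error of one test\<close>

lemma full_iff: "full v \<longleftrightarrow> (\<forall>t \<in> carrier_vec n. (\<forall>j<N. arg j v \<bullet> t = 0) \<longrightarrow> t = 0\<^sub>v n)"
  unfolding full_def by (subst span_dim_eq_iff) auto

text \<open>The actual and the ideal sign differ in two cases. For \<open>i0\<close> and full rank
  some string is not orthogonal to the period, and \<open>amp_period\<close> makes the amplitude
  zero. For another index and deficient rank, a common annihilator \<open>t\<close> gives a summand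
  that alone equals the left side; the signs differ by 2, whence the factor 4.\<close>

lemma test_error_pointwise:
  fixes v :: label and \<alpha> :: "bit vec \<Rightarrow> real"
  defines "P \<equiv> \<alpha> (idx v) * minus_amp (v Flag) * (\<Prod>j<N. amp n (h (idx v)) (arg j v) (val j v))"
  shows "(((if full v then 1 else -1) - (if idx v = i0 then -1 else 1)) * P)\<^sup>2 \<le>
    (\<Sum>t \<in> carrier_vec n - {0\<^sub>v n}. 4 * (of_bool (idx v \<noteq> i0) * (\<alpha> (idx v))\<^sup>2 * (minus_amp (v Flag))\<^sup>2 *
      (\<Prod>j<N. of_bool (arg j v \<bullet> t = 0) * (amp n (h (idx v)) (arg j v) (val j v))\<^sup>2)))"
    (is "?L \<le> (\<Sum>t \<in> ?T. ?R t)")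
proof -
  have nonneg: "0 \<le> ?R t" for t
    by (intro mult_nonneg_nonneg prod_nonneg) auto
  consider (zero) "?L = 0" | (bad) "idx v \<noteq> i0" "\<not> full v"
  proof (cases "idx v = i0")
    case True
    show ?thesis
    proof (cases "full v")
      case fv: True
      obtain s where s: "s \<in> carrier_vec n" "s \<noteq> 0\<^sub>v n"
        and per: "\<And>x. x \<in> carrier_vec n \<Longrightarrow> h i0 x = h i0 (x + s)"
        using period unfolding has_period_def by blast
      obtain j where j: "j < N" "arg j v \<bullet> s \<noteq> 0"
        using fv s unfolding full_iff by blast
      then have "amp n (h i0) (arg j v) (val j v) = 0"
        by (intro amp_period[OF s(1), where h = "h i0", OF per]) (auto simp: bit_not_zero_iff)
      then have "P = 0"
        using j True by (auto simp: P_def)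
      then show ?thesis using zero by simp
    qed (use True zero in simp)
  next
    case False
    then show ?thesis using zero bad by (cases "full v") auto
  qed
  then show ?thesis
  proof cases
    case zero
    then show ?thesis using nonneg by (simp only: sum_nonneg)
  next
    case bad
    then obtain t where t: "t \<in> ?T" "\<forall>j<N. arg j v \<bullet> t = 0"
      unfolding full_iff by blast
    then have "?R t = 4 * P\<^sup>2"
      using bad by (simp add: P_def power_mult_distrib prod_power_distrib)
    also have "\<dots> = ?L"
      using bad by (simp add: power_mult_distrib)
    finally have "?L = ?R t" ..
    also have "\<dots> \<le> (\<Sum>t \<in> ?T. ?R t)"
      using t nonneg by (intro member_le_sum) auto
    finally show ?thesis .
  qed
qed

lemma sum_minus_amp: "(\<Sum>b \<in> UNIV. (minus_amp b)\<^sup>2) = 1"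
  by (simp add: UNIV_bit minus_amp_def power_divide)

text \<open>Phase kickback: flipping the flag negates \<open>minus_amp\<close>.\<close>

lemma rank_circuit_prod_state:
  "fold gate_sem rk (prod_state \<alpha> \<beta> minus_amp) v = (if full v then 1 else -1) * prod_state \<alpha> \<beta> minus_amp v"
proof -
  have "minus_amp (b + 1) = - minus_amp b" for b
    by (simp add: minus_amp_def chi_add)
  then show ?thesis
    unfolding rank_circuit_sem[OF rk supported_prod_state] by (simp add: prod_state_def upd_labels)
qed

definition err :: real where
  "err = 2 * sqrt (2 ^ n * (3 / 4) ^ N)"

lemma test_error:
  assumes \<alpha>: "(\<Sum>i \<in> carrier_vec m. (\<alpha> i)\<^sup>2) \<le> 1"
  shows "state_dist (fold gate_sem rk (prod_state \<alpha> (\<lambda>_ i. amp n (h i)) minus_amp))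
    (prod_state (mark \<alpha>) (\<lambda>_ i. amp n (h i)) minus_amp) \<le> err"
proof -
  let ?T = "carrier_vec n - {0\<^sub>v n} :: bit vec set"
  let ?P = "\<lambda>v. \<alpha> (idx v) * minus_amp (v Flag) * (\<Prod>j<N. amp n (h (idx v)) (arg j v) (val j v))"
  let ?R = "\<lambda>t v. of_bool (idx v \<noteq> i0) * (\<alpha> (idx v))\<^sup>2 * (minus_amp (v Flag))\<^sup>2 *
      (\<Prod>j<N. of_bool (arg j v \<bullet> t = 0) * (amp n (h (idx v)) (arg j v) (val j v))\<^sup>2)"
  have diff: "(cmod (fold gate_sem rk (prod_state \<alpha> (\<lambda>_ i. amp n (h i)) minus_amp) v -
      prod_state (mark \<alpha>) (\<lambda>_ i. amp n (h i)) minus_amp v))\<^sup>2 =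
      (((if full v then 1 else -1) - (if idx v = i0 then -1 else 1)) * ?P v)\<^sup>2" if "v \<in> labels" for v
  proof -
    have "fold gate_sem rk (prod_state \<alpha> (\<lambda>_ i. amp n (h i)) minus_amp) v -
      prod_state (mark \<alpha>) (\<lambda>_ i. amp n (h i)) minus_amp v =
      complex_of_real (((if full v then 1 else -1) - (if idx v = i0 then -1 else 1)) * ?P v)"
      using that by (simp add: rank_circuit_prod_state prod_state_def mark_def)
    then show ?thesis by (simp only: norm_of_real power2_abs)
  qed
  \<comment> \<open>For a fixed \<open>t\<close> the weight factors over the pairs, and for an index
    other than \<open>i0\<close> each factor is at most 3/4.\<close>
  have weight: "(\<Sum>v \<in> labels. ?R t v) \<le> (3 / 4) ^ N" if t: "t \<in> ?T" for t
  proof -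
    let ?q = "\<lambda>i. \<Sum>x \<in> carrier_vec n. \<Sum>z \<in> carrier_vec l. of_bool (x \<bullet> t = 0) * (amp n (h i) x z)\<^sup>2"
    have "(\<Sum>v \<in> labels. ?R t v) =
        (\<Sum>i \<in> carrier_vec m. of_bool (i \<noteq> i0) * (\<alpha> i)\<^sup>2 * (\<Sum>b \<in> UNIV. (minus_amp b)\<^sup>2) * (\<Prod>j<N. ?q i))"
      by (rule sum_labels[where a = "\<lambda>i. of_bool (i \<noteq> i0) * (\<alpha> i)\<^sup>2"])
    also have "\<dots> \<le> (\<Sum>i \<in> carrier_vec m. (\<alpha> i)\<^sup>2 * (3 / 4) ^ N)"
    proof (intro sum_mono)
      fix i assume i: "i \<in> (carrier_vec m :: bit vec set)"
      show "of_bool (i \<noteq> i0) * (\<alpha> i)\<^sup>2 * (\<Sum>b \<in> UNIV. (minus_amp b)\<^sup>2) * (\<Prod>j<N. ?q i) \<le> (\<alpha> i)\<^sup>2 * (3 / 4) ^ N"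
      proof (cases "i = i0")
        case False
        have "?q i \<le> 3 / 4"
          using t i False by (intro amp_orthogonal_weight[OF h_carrier[OF i]] no_period) auto
        then have "(?q i) ^ N \<le> (3 / 4) ^ N"
          by (intro power_mono sum_nonneg) auto
        then show ?thesis
          using False by (simp add: sum_minus_amp mult_left_mono)
      qed simp
    qed
    also have "\<dots> = (\<Sum>i \<in> carrier_vec m. (\<alpha> i)\<^sup>2) * (3 / 4) ^ N"
      by (simp add: sum_distrib_right)
    also have "\<dots> \<le> 1 * (3 / 4) ^ N"
      using \<alpha> by (intro mult_right_mono) auto
    finally show ?thesis by simp
  qed
  have "(state_dist (fold gate_sem rk (prod_state \<alpha> (\<lambda>_ i. amp n (h i)) minus_amp))
      (prod_state (mark \<alpha>) (\<lambda>_ i. amp n (h i)) minus_amp))\<^sup>2 \<le> (\<Sum>v \<in> labels. \<Sum>t \<in> ?T. 4 * ?R t v)"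
    unfolding state_dist_def L2_set_def
    by (simp only: real_sqrt_pow2 sum_nonneg zero_le_power2)
      (intro sum_mono, simp only: diff, rule test_error_pointwise)
  also have "\<dots> = 4 * (\<Sum>t \<in> ?T. \<Sum>v \<in> labels. ?R t v)"
    by (subst sum.swap) (simp only: sum_distrib_left)
  also have "\<dots> \<le> 4 * (\<Sum>t \<in> ?T. (3 / 4) ^ N)"
    using weight by (intro mult_left_mono sum_mono) auto
  also have "\<dots> = 4 * (real (card ?T) * (3 / 4) ^ N)"
    by simp
  also have "\<dots> \<le> 4 * (2 ^ n * (3 / 4) ^ N)"
  proof -
    have "card ?T \<le> card (carrier_vec n :: bit vec set)"
      by (intro card_mono) auto
    then have "real (card ?T) \<le> 2 ^ n"
      by (simp add: card_carrier_vec_bit)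
    then show ?thesis by simp
  qed
  also have "\<dots> = err\<^sup>2"
    by (simp add: err_def power_mult_distrib)
  finally show ?thesis
    by (rule power2_le_imp_le) (simp add: err_def)
qed

text \<open>Inversion about the mean.\<close>

definition diffuse :: "(bit vec \<Rightarrow> real) \<Rightarrow> bit vec \<Rightarrow> real" where
  "diffuse \<alpha> i = 2 / 2 ^ m * (\<Sum>x \<in> carrier_vec m. \<alpha> x) - \<alpha> i"

definition diffusion :: "op list" where
  "diffusion = hadamards (idx_reg m) @ map Gate rf @ hadamards (idx_reg m)"

lemma isometric_diffusion: "isometric (fold (op_sem F) diffusion)"
proof -
  have "isometric (fold (op_sem F) (hadamards (idx_reg m)))"
    by (rule isometric_hadamards) simp
  then show ?thesis
    unfolding diffusion_def fold_append fold_map_Gate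
    by (intro isometric_comp isometric_reflection_circuit[OF rf])
qed

lemma diffusion_prod_state: "fold (op_sem F) diffusion (prod_state \<alpha> prep \<gamma>) = prod_state (diffuse \<alpha>) prep \<gamma>"
proof -
  let ?c = "(1 / sqrt 2 :: real) ^ m"
  let ?s = "\<lambda>y :: bit vec. if y = 0\<^sub>v m then 1 else -1 :: real"
  have prep: "prep = (\<lambda>j _. prep j undefined)"
    by (simp add: prep_def fun_eq_iff)
  have had: "fold (op_sem F) (hadamards (idx_reg m)) (prod_state \<alpha> prep \<gamma>) =
      prod_state (\<lambda>i. ?c * (\<Sum>y \<in> carrier_vec m. chi (i \<bullet> y) * \<alpha> y)) prep \<gamma>" for \<alpha>
    using prod_state_hadamards_idx[of F \<alpha> "\<lambda>j. prep j undefined" \<gamma>] by (simp flip: prep)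
  have "?c * (\<Sum>y \<in> carrier_vec m. chi (i \<bullet> y) *
      (?s y * (?c * (\<Sum>x \<in> carrier_vec m. chi (y \<bullet> x) * \<alpha> x)))) = diffuse \<alpha> i"
    if i: "i \<in> carrier_vec m" for i
  proof -
    have "?c * (\<Sum>y \<in> carrier_vec m. chi (i \<bullet> y) * (?s y * (?c * (\<Sum>x \<in> carrier_vec m. chi (y \<bullet> x) * \<alpha> x)))) =
        ?c * (?c * (\<Sum>y \<in> carrier_vec m. \<Sum>x \<in> carrier_vec m. ?s y * (chi (i \<bullet> y) * chi (y \<bullet> x)) * \<alpha> x))"
      by (simp only: sum_distrib_left mult_ac)
    also have "\<dots> = (1 / 2) ^ m * (\<Sum>y \<in> carrier_vec m. \<Sum>x \<in> carrier_vec m.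
        ?s y * (chi (i \<bullet> y) * chi (y \<bullet> x)) * \<alpha> x)"
      by (rule half_power)
    also have "(\<Sum>y \<in> carrier_vec m. \<Sum>x \<in> carrier_vec m. ?s y * (chi (i \<bullet> y) * chi (y \<bullet> x)) * \<alpha> x) =
        (\<Sum>x \<in> carrier_vec m. \<Sum>y \<in> carrier_vec m. ?s y * chi (y \<bullet> (i + x)) * \<alpha> x)"
    proof (subst sum.swap, intro sum.cong refl)
      fix x y :: "bit vec" assume "x \<in> carrier_vec m" "y \<in> carrier_vec m"
      then show "?s y * (chi (i \<bullet> y) * chi (y \<bullet> x)) * \<alpha> x = ?s y * chi (y \<bullet> (i + x)) * \<alpha> x"
        using i by (simp add: chi_scalar_add[where n = m] comm_scalar_prod[of i m y])
    qed
    also have "\<dots> = (\<Sum>x \<in> carrier_vec m. (2 - (if x = i then 2 ^ m else 0)) * \<alpha> x)"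
    proof (intro sum.cong refl)
      fix x :: "bit vec" assume x: "x \<in> carrier_vec m"
      have z: "i + x = 0\<^sub>v m \<longleftrightarrow> x = i"
        using x i by (auto simp: vec_eq_iff bit_add_eq_0_iff)
      \<comment> \<open>The sign is twice the indicator of zero minus 1. The indicator produces the
        mean, the constant an orthogonality sum.\<close>
      have "(\<Sum>y \<in> carrier_vec m. ?s y * chi (y \<bullet> (i + x))) =
          (\<Sum>y \<in> carrier_vec m. (if y = 0\<^sub>v m then 2 else 0) - chi (y \<bullet> (i + x)))"
        using i x by (intro sum.cong refl) auto
      also have "\<dots> = 2 - (if x = i then 2 ^ m else 0)"
        using i x by (simp add: sum_subtractf chi_sum z)
      finally show "(\<Sum>y \<in> carrier_vec m. ?s y * chi (y \<bullet> (i + x)) * \<alpha> x) =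
          (2 - (if x = i then 2 ^ m else 0)) * \<alpha> x"
        by (simp flip: sum_distrib_right)
    qed
    also have "\<dots> = 2 * (\<Sum>x \<in> carrier_vec m. \<alpha> x) - 2 ^ m * \<alpha> i"
      using i by (simp add: left_diff_distrib sum_subtractf sum_distrib_left if_distrib[of "\<lambda>a. a * _"] cong: if_cong)
    finally show ?thesis
      by (simp add: diffuse_def field_simps power_one_over)
  qed
  then show ?thesis
    unfolding diffusion_def fold_append fold_map_Gate comp_def had prod_state_reflection[OF rf]
    by (intro prod_state_cong) auto
qed

definition grover :: "state \<Rightarrow> state" where
  "grover = fold (op_sem F) (grover_iteration m n l N rk rf)"

lemma grover_eq: "grover = fold (op_sem F) diffusion \<circ>
    (fold (op_sem F) (rev steps12) \<circ> (fold gate_sem rk \<circ> fold (op_sem F) steps12))"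
  unfolding grover_def grover_iteration_def test_def Let_def steps12_def[symmetric]
    diffusion_def[symmetric] fold_append fold_map_Gate comp_assoc ..

lemma isometric_grover: "isometric grover"
  unfolding grover_eq
  by (intro isometric_comp isometric_diffusion isometric_steps12 isometric_rank_circuit[OF rk] F)

lemma grover_error:
  assumes "(\<Sum>i \<in> carrier_vec m. (\<alpha> i)\<^sup>2) \<le> 1"
  shows "state_dist (grover (prod_state \<alpha> prep minus_amp)) (prod_state (diffuse (mark \<alpha>)) prep minus_amp) \<le> err"
proof -
  let ?V = "fold (op_sem F) diffusion \<circ> fold (op_sem F) (rev steps12)"
  let ?X = "fold gate_sem rk (prod_state \<alpha> (\<lambda>_ i. amp n (h i)) minus_amp)"
  let ?Y = "prod_state (mark \<alpha>) (\<lambda>_ i. amp n (h i)) minus_amp"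
  have "isometric ?V"
    by (intro isometric_comp isometric_diffusion isometric_steps12 F)
  moreover have "supported ?X"
    by (rule isometricD(1)[OF isometric_rank_circuit[OF rk]]) simp
  ultimately have "state_dist (?V ?X) (?V ?Y) = state_dist ?X ?Y"
    by (rule isometricD(2)) simp
  moreover have "?V ?X = grover (prod_state \<alpha> prep minus_amp)"
    by (simp add: grover_eq steps12_prep)
  \<comment> \<open>The exactly flipped state is the image of a product state under steps (1) and
    (2), so step (4) restores that product state without error.\<close>
  moreover have "?V ?Y = prod_state (diffuse (mark \<alpha>)) prep minus_amp"
    using steps12_undo[of F "prod_state (mark \<alpha>) prep minus_amp", OF F]
    by (simp add: steps12_prep diffusion_prod_state)
  ultimately show ?thesis
    using test_error[OF assms] by simp
qed

section \<open>The ideal Grover search\<close>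

abbreviation "angle \<equiv> grover_angle m"

text \<open>For \<open>m = 0\<close> the second branch divides by zero, but then \<open>i0\<close> is the only index.\<close>

definition amplitude :: "nat \<Rightarrow> bit vec \<Rightarrow> real" where
  "amplitude k i = (if i = i0 then sin (real (2 * k + 1) * angle)
     else cos (real (2 * k + 1) * angle) / sqrt (2 ^ m - 1))"

lemma sum_other:
  "(\<Sum>i \<in> carrier_vec m. if i = i0 then a else b) = a + (2 ^ m - 1) * (b :: real)"
proof -
  have "real (card (carrier_vec m - {i0})) = 2 ^ m - 1"
    using i0 by (simp add: card_Diff_singleton card_carrier_vec_bit of_nat_diff)
  moreover have "(\<Sum>i \<in> carrier_vec m - {i0}. if i = i0 then a else b) = (\<Sum>i \<in> carrier_vec m - {i0}. b)"
    by (intro sum.cong) auto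
  ultimately show ?thesis
    using i0 by (simp add: sum.remove[of _ i0])
qed

lemma sum_amplitude_sq: "(\<Sum>i \<in> carrier_vec m. (amplitude k i)\<^sup>2) \<le> 1"
proof -
  let ?s = "sin (real (2 * k + 1) * angle)" and ?c = "cos (real (2 * k + 1) * angle)"
  have "(\<Sum>i \<in> carrier_vec m. (amplitude k i)\<^sup>2) =
      (\<Sum>i \<in> carrier_vec m. if i = i0 then ?s\<^sup>2 else (?c / sqrt (2 ^ m - 1))\<^sup>2)"
    by (intro sum.cong) (auto simp: amplitude_def)
  also have "\<dots> = ?s\<^sup>2 + (2 ^ m - 1) * (?c / sqrt (2 ^ m - 1))\<^sup>2"
    by (rule sum_other)
  also have "\<dots> \<le> ?s\<^sup>2 + ?c\<^sup>2"
  \<comment> \<open>For \<open>m = 0\<close> the factor \<open>2 ^ m - 1\<close> makes the second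
    summand zero, whatever the quotient is.\<close>
  proof (cases "2 ^ m = (1 :: real)")
    case False
    then have "(2 ^ m - 1) * (?c / sqrt (2 ^ m - 1))\<^sup>2 = ?c\<^sup>2"
      by (simp add: power_divide)
    then show ?thesis by (simp only: order_refl)
  qed (simp only: diff_self mult_zero_left add_left_mono zero_le_power2)
  also have "\<dots> = 1" by simp
  finally show ?thesis .
qed

lemma amplitude_0: "i \<in> carrier_vec m \<Longrightarrow> amplitude 0 i = (1 / sqrt 2) ^ m"
proof -
  assume i: "i \<in> carrier_vec m"
  have p: "(1 / sqrt 2) ^ m = 1 / sqrt (2 ^ m)"
    by (simp add: power_one_over real_sqrt_power)
  show ?thesis
  proof (cases "i = i0")
    case False
    have "m \<noteq> 0"
    proof
      assume "m = 0"
      with i i0 have "i = i0" by (auto simp: vec_eq_iff)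
      with False show False ..
    qed
    then have "(1 :: real) < 2 ^ m" by simp
    then show ?thesis using False by (simp add: amplitude_def cos_angle p)
  qed (simp add: amplitude_def sin_angle p)
qed

text \<open>In the plane spanned by \<open>i0\<close> and the uniform superposition of the other
  indices, a flip followed by the inversion about the mean rotates by twice the angle.\<close>

lemma diffuse_mark_amplitude:
  assumes i: "i \<in> carrier_vec m"
  shows "diffuse (mark (amplitude k)) i = amplitude (Suc k) i"
proof -
  let ?s = "sin (real (2 * k + 1) * angle)" and ?c = "cos (real (2 * k + 1) * angle)"
  define q where "q = sqrt (2 ^ m - 1 :: real)"
  define d :: real where "d = 2 ^ m"
  have d: "d \<noteq> 0" "q\<^sup>2 = d - 1" and d_pos: "d > 0"
    by (simp_all add: d_def q_def)
  have s2: "sin (2 * angle) = 2 * q / d"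
    unfolding sin_double sin_angle cos_angle q_def[symmetric] by (simp add: d_def)
  have c2: "cos (2 * angle) = (d - 2) / d"
    unfolding cos_double sin_angle cos_angle q_def[symmetric]
    using d d_pos by (simp add: power_divide diff_divide_distrib flip: d_def)
  have step: "real (2 * Suc k + 1) * angle = real (2 * k + 1) * angle + 2 * angle"
    by (simp add: algebra_simps)
  have "(\<Sum>x \<in> carrier_vec m. mark (amplitude k) x) =
      (\<Sum>x \<in> carrier_vec m. if x = i0 then - ?s else ?c / q)"
    by (intro sum.cong) (auto simp: mark_def amplitude_def q_def)
  also have "\<dots> = - ?s + (2 ^ m - 1) * (?c / q)"
    by (rule sum_other)
  \<comment> \<open>Cancelling \<open>q\<close> is also correct for \<open>q = 0\<close>, where both
    products vanish.\<close>
  also have "\<dots> = - ?s + q * ?c"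
  proof -
    have "2 ^ m - 1 = q * q"
      using d(2) by (simp add: d_def power2_eq_square)
    then show ?thesis by (cases "q = 0") simp_all
  qed
  finally have sum: "(\<Sum>x \<in> carrier_vec m. mark (amplitude k) x) = - ?s + q * ?c" .
  show ?thesis
  proof (cases "i = i0")
    case True
    have "diffuse (mark (amplitude k)) i = 2 / d * (- ?s + q * ?c) + ?s"
      unfolding diffuse_def sum using True by (simp add: d_def mark_def amplitude_def)
    also have "\<dots> = ?s * ((d - 2) / d) + ?c * (2 * q / d)"
      by (rule grover_rotation(1)[OF d])
    also have "\<dots> = amplitude (Suc k) i"
      unfolding amplitude_def step sin_add s2 c2 using True by simp
    finally show ?thesis .
  next
    case False
    have "m \<noteq> 0"
    proof
      assume "m = 0"
      with i i0 have "i = i0" by (auto simp: vec_eq_iff)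
      with False show False ..
    qed
    then have q: "q > 0" by (simp add: q_def)
    have "diffuse (mark (amplitude k)) i = 2 / d * (- ?s + q * ?c) - ?c / q"
      unfolding diffuse_def sum using False by (simp add: d_def mark_def amplitude_def q_def)
    also have "\<dots> = (?c * ((d - 2) / d) - ?s * (2 * q / d)) / q"
      using q by (intro grover_rotation(2)[OF d]) simp
    also have "\<dots> = amplitude (Suc k) i"
      unfolding amplitude_def step cos_add s2 c2 using False by (simp add: q_def)
    finally show ?thesis .
  qed
qed

text \<open>The ideal iterates remain product states, to which \<open>grover_error\<close> applies,
  while the isometry of the actual iteration carries the earlier error along unchanged.\<close>

lemma grover_iterates:
  "supported ((grover ^^ k) (prod_state (amplitude 0) prep minus_amp)) \<and>
   state_dist ((grover ^^ k) (prod_state (amplitude 0) prep minus_amp)) (prod_state (amplitude k) prep minus_amp) \<le> real k * err"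
proof (induction k)
  case 0
  show ?case by (simp add: state_dist_def L2_set_def)
next
  case (Suc k)
  let ?\<Psi> = "(grover ^^ k) (prod_state (amplitude 0) prep minus_amp)"
  have eq: "prod_state (diffuse (mark (amplitude k))) prep minus_amp = prod_state (amplitude (Suc k)) prep minus_amp"
    by (intro prod_state_cong diffuse_mark_amplitude refl)
  have e: "state_dist (grover (prod_state (amplitude k) prep minus_amp)) (prod_state (amplitude (Suc k)) prep minus_amp) \<le> err"
    using grover_error[OF sum_amplitude_sq[of k]] by (simp only: eq)
  have sup: "supported ?\<Psi>" and IH: "state_dist ?\<Psi> (prod_state (amplitude k) prep minus_amp) \<le> real k * err"
    using Suc by auto
  have "state_dist (grover ?\<Psi>) (prod_state (amplitude (Suc k)) prep minus_amp) \<le>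
      state_dist (grover ?\<Psi>) (grover (prod_state (amplitude k) prep minus_amp)) +
      state_dist (grover (prod_state (amplitude k) prep minus_amp)) (prod_state (amplitude (Suc k)) prep minus_amp)"
    by (rule state_dist_triangle)
  also have "\<dots> \<le> real k * err + err"
    using IH e isometricD(2)[OF isometric_grover sup supported_prod_state] by (simp only: add_mono)
  also have "\<dots> = real (Suc k) * err"
    by (simp add: distrib_right)
  finally show ?case
    using isometricD(1)[OF isometric_grover sup] by (simp only: funpow.simps comp_apply simp_thms)
qed

end

section \<open>The run of the algorithm\<close>

lemma run_foldr_Do: "run F g (foldr Do us P) \<psi> = run F g P (fold (op_sem F) us \<psi>)"
  by (induction us arbitrary: \<psi>) simp_all

lemma distinct_all_strings: "distinct (all_strings n)"
  by (rule card_distinct, simp only: set_all_strings card_carrier_vec_bit) (simp add: all_strings_def)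

lemma iterations_eq: "iterations m = nat \<lfloor>pi / (4 * grover_angle m)\<rfloor>"
  by (simp add: iterations_def grover_angle_def)

lemma iterations_bounds:
  "real (iterations m) \<le> pi / (4 * grover_angle m)" "pi / (4 * grover_angle m) < real (iterations m) + 1"
proof -
  have "pi / (4 * grover_angle m) \<ge> 0"
    using angle_bounds[of m] by simp
  then have "real (iterations m) = \<lfloor>pi / (4 * grover_angle m)\<rfloor>"
    by (simp add: iterations_eq)
  then show "real (iterations m) \<le> pi / (4 * grover_angle m)" "pi / (4 * grover_angle m) < real (iterations m) + 1"
    by linarith+
qed

text \<open>The floor in the number of iterations puts the final angle within
  \<open>grover_angle m\<close> of \<open>pi / 2\<close>. For \<open>m \<ge> 1\<close> this
  deviation is at most \<open>pi / 4\<close>; for \<open>m = 0\<close> there is no iteration and the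
  angle is \<open>pi / 2\<close> itself.\<close>

lemma final_angle: "\<bar>sin (real (2 * iterations m + 1) * grover_angle m)\<bar> \<ge> 1 / sqrt 2"
proof (cases "m = 0")
  case True
  then have "2 powr (- (real m / 2)) = 1" by simp
  then have a: "grover_angle m = pi / 2" unfolding grover_angle_def by simp
  have "iterations m = 0" unfolding iterations_eq a by simp
  then show ?thesis by (simp only: a) (simp add: field_simps)
next
  case False
  define x where "x = real (2 * iterations m + 1) * grover_angle m"
  have "real (iterations m) * (4 * grover_angle m) \<le> pi" "pi < (real (iterations m) + 1) * (4 * grover_angle m)"
    using iterations_bounds[of m] angle_bounds[of m] by (simp_all add: pos_le_divide_eq pos_divide_less_eq)
  then have bounds: "pi / 2 - grover_angle m \<le> x" "x \<le> pi / 2 + grover_angle m"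
    by (simp_all add: x_def algebra_simps)
  have "sin (grover_angle m) \<le> sin (pi / 4)"
  proof -
    have "(2 :: real) ^ 1 \<le> 2 ^ m" using False by (intro power_increasing) auto
    then have "sqrt 2 \<le> sqrt (2 ^ m)" by simp
    then have "1 / sqrt (2 ^ m) \<le> 1 / sqrt 2" by (intro divide_left_mono) auto
    also have "\<dots> = sin (pi / 4)" by (simp add: sin_45 field_simps)
    finally show ?thesis by (simp add: sin_angle)
  qed
  then have "grover_angle m \<le> pi / 4"
    using angle_bounds[of m] by (subst (asm) sin_mono_le_eq) auto
  then have "\<bar>x - pi / 2\<bar> \<le> pi / 4"
    using bounds unfolding abs_le_iff by linarith
  then have "cos (pi / 4) \<le> cos \<bar>x - pi / 2\<bar>"
    by (intro cos_monotone_0_pi_le) auto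
  also have "cos \<bar>x - pi / 2\<bar> = sin x"
    unfolding cos_abs_real by (simp add: cos_diff)
  finally have "sqrt 2 / 2 \<le> \<bar>sin x\<bar>" by (simp add: cos_45)
  moreover have "1 / sqrt 2 = sqrt 2 / (2 :: real)" by (simp add: field_simps)
  ultimately show ?thesis by (simp only: x_def)
qed

text \<open>Since \<open>sin x \<le> x\<close>, the angle is at least
  \<open>1 / sqrt (2 ^ m)\<close>.\<close>

lemma iterations_le: "real (iterations m) \<le> pi / 4 * sqrt (2 ^ m)"
proof -
  have "1 / sqrt (2 ^ m) \<le> grover_angle m"
    using sin_x_le_x[of "grover_angle m"] angle_bounds[of m] by (simp add: sin_angle)
  then have "1 / grover_angle m \<le> sqrt (2 ^ m)"
    using angle_bounds[of m] by (simp add: field_simps)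
  then have "pi / 4 * (1 / grover_angle m) \<le> pi / 4 * sqrt (2 ^ m)"
    by (intro mult_left_mono) auto
  then show ?thesis
    using iterations_bounds(1)[of m] by simp
qed

context search begin

text \<open>
  The pairs of registers when the answers for all strings in \<open>Y\<close> have been written, and that for \<open>y\<close>
  has been written into the first \<open>k\<close> pairs.
\<close>

definition written :: "nat \<Rightarrow> bit vec set \<Rightarrow> bit vec \<Rightarrow> nat \<Rightarrow> bit vec \<Rightarrow> bit vec \<Rightarrow> bit vec \<Rightarrow> real" where
  "written k Y y j _ x z = (1 / sqrt 2) ^ n *
     of_bool (z = (if x \<in> Y \<or> x = y \<and> j < k then g x else 0\<^sub>v l))"

lemma run_writes:
  assumes y: "y \<in> carrier_vec n" "y \<notin> Y"
  shows "run F g (foldr (\<lambda>j. CondXor (arg_reg n j) (val_reg l j) y (g y)) [0..<N] Q)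
      (prod_state \<alpha> (written 0 Y y) \<gamma>) = run F g Q (prod_state \<alpha> (written N Y y) \<gamma>)"
proof -
  have "run F g (foldr (\<lambda>j. CondXor (arg_reg n j) (val_reg l j) y (g y)) [k..<N] Q)
      (prod_state \<alpha> (written k Y y) \<gamma>) = run F g Q (prod_state \<alpha> (written N Y y) \<gamma>)" if "k \<le> N" for k
    using that
  \<comment> \<open>The writes run upwards from pair \<open>k\<close>, so the induction is on the
    number of remaining pairs.\<close>
  proof (induction "N - k" arbitrary: k)
    case 0
    then show ?case by simp
  next
    case (Suc d)
    then have k: "k < N" by simp
    have "prod_state \<alpha> ((written k Y y)(k := \<lambda>i x z. written k Y y k i x (if x = y then z + g y else z))) \<gamma> =
        prod_state \<alpha> (written (Suc k) Y y) \<gamma>"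
    proof (rule prod_state_cong)
      fix j and i x z :: "bit vec"
      assume z: "z \<in> carrier_vec l"
      have "z + g y = 0\<^sub>v l \<longleftrightarrow> z = g y"
        using z g[OF y(1)] by (auto simp: vec_eq_iff bit_add_eq_0_iff)
      then show "((written k Y y)(k := \<lambda>i x z. written k Y y k i x (if x = y then z + g y else z))) j i x z =
          written (Suc k) Y y j i x z"
        using y by (auto simp: written_def less_Suc_eq)
    qed simp_all
    moreover have "[k..<N] = k # [Suc k..<N]"
      using k by (rule upt_conv_Cons)
    ultimately show ?case
      using Suc(1)[of "Suc k"] Suc(2) k by (simp add: prod_state_cond_xor[OF k g[OF y(1)]])
  qed
  then show ?thesis by simp
qed

lemma run_asks:
  assumes "distinct ys" "set ys \<subseteq> carrier_vec n" "set ys \<inter> Y = {}"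
  shows "run F g (foldr (\<lambda>y Q. Ask y (\<lambda>z.
        foldr (\<lambda>j. CondXor (arg_reg n j) (val_reg l j) y z) [0..<N] Q)) ys Q)
      (prod_state \<alpha> (written 0 Y (0\<^sub>v n)) \<gamma>) = run F g Q (prod_state \<alpha> (written 0 (Y \<union> set ys) (0\<^sub>v n)) \<gamma>)"
  using assms
proof (induction ys arbitrary: Y)
  case (Cons y ys)
  have y: "y \<in> carrier_vec n" "y \<notin> Y"
    using Cons.prems by auto
  \<comment> \<open>With \<open>k = 0\<close> the string \<open>y\<close> is immaterial; with
    \<open>k = N\<close> it has reached every pair and counts as a member of
    \<open>Y\<close>.\<close>
  have "prod_state \<alpha> (written 0 Y (0\<^sub>v n)) \<gamma> = prod_state \<alpha> (written 0 Y y) \<gamma>"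
    by (rule prod_state_cong) (simp_all add: written_def)
  moreover have "prod_state \<alpha> (written N Y y) \<gamma> = prod_state \<alpha> (written 0 (insert y Y) (0\<^sub>v n)) \<gamma>"
    by (rule prod_state_cong) (simp_all add: written_def)
  moreover have "distinct ys" "set ys \<subseteq> carrier_vec n" "set ys \<inter> insert y Y = {}"
    using Cons.prems by auto
  ultimately show ?case
    using Cons.IH[of "insert y Y"] by (simp add: run_writes[OF y])
qed simp

lemma run_online:
  "run F g (online n l N Q) (ket (\<lambda>_. 0)) =
    run F g Q (prod_state (\<lambda>i. of_bool (i = 0\<^sub>v m)) prep (\<lambda>b. of_bool (b = 0)))"
proof -
  let ?\<alpha> = "\<lambda>i. of_bool (i = 0\<^sub>v m) :: real" and ?\<gamma> = "\<lambda>b :: bit. of_bool (b = 0) :: real"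
  have "fold (op_sem F) (hadamards (concat (map (arg_reg n) [0..<N]))) (ket (\<lambda>_. 0)) =
      prod_state ?\<alpha> (written 0 {} (0\<^sub>v n)) ?\<gamma>"
    unfolding ket_zero_prod_state prod_state_hadamards_args[OF order_refl]
  proof (rule prod_state_cong)
    fix j and i x z :: "bit vec"
    assume "j < N" "x \<in> carrier_vec n"
    show "(if j < N then (1 / sqrt 2) ^ n * (\<Sum>y \<in> carrier_vec n. chi (x \<bullet> y) *
          (of_bool (y = 0\<^sub>v n) * of_bool (z = 0\<^sub>v l))) else of_bool (x = 0\<^sub>v n) * of_bool (z = 0\<^sub>v l)) =
        written 0 {} (0\<^sub>v n) j i x z"
      using \<open>j < N\<close> \<open>x \<in> _\<close> by (simp add: written_def scalar_prod_right_zero[of x n])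
  qed simp_all
  moreover have "prod_state ?\<alpha> (written 0 (carrier_vec n) (0\<^sub>v n)) ?\<gamma> = prod_state ?\<alpha> prep ?\<gamma>"
    by (rule prod_state_cong) (simp_all add: written_def prep_def)
  ultimately show ?thesis
    using run_asks[of "all_strings n" "{}" Q ?\<alpha> ?\<gamma>]
    by (simp add: online_def run_foldr_Do distinct_all_strings set_all_strings)
qed

abbreviation "alg \<equiv> online n l N (foldr Do (offline m n l N rk rf) Stop)"

lemma run_alg:
  "run F g alg (ket (\<lambda>_. 0)) = (grover ^^ iterations m) (prod_state (amplitude 0) prep minus_amp)"
proof -
  have prep: "prep = (\<lambda>j _. prep j undefined)"
    by (simp add: prep_def fun_eq_iff)
  have "fold (op_sem F) (hadamards (idx_reg m)) (prod_state (\<lambda>i. of_bool (i = 0\<^sub>v m)) prep \<gamma>) =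
      prod_state (amplitude 0) prep \<gamma>" for \<gamma>
  proof -
    have "fold (op_sem F) (hadamards (idx_reg m)) (prod_state (\<lambda>i. of_bool (i = 0\<^sub>v m)) prep \<gamma>) =
        prod_state (\<lambda>i. (1 / sqrt 2) ^ m * (\<Sum>y \<in> carrier_vec m. chi (i \<bullet> y) * of_bool (y = 0\<^sub>v m))) prep \<gamma>"
      using prod_state_hadamards_idx[of F "\<lambda>i. of_bool (i = 0\<^sub>v m)" "\<lambda>j. prep j undefined" \<gamma>]
      by (simp flip: prep)
    also have "\<dots> = prod_state (amplitude 0) prep \<gamma>"
    proof (rule prod_state_cong)
      fix i :: "bit vec" assume i: "i \<in> carrier_vec m"
      show "(1 / sqrt 2) ^ m * (\<Sum>y \<in> carrier_vec m. chi (i \<bullet> y) * of_bool (y = 0\<^sub>v m)) =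
          amplitude 0 i"
        using i by (simp add: amplitude_0 scalar_prod_right_zero[of i m])
    qed simp_all
    finally show ?thesis .
  qed
  moreover have "op_sem F (Gate (Hadamard Flag)) (op_sem F (Gate (PauliX Flag))
      (prod_state \<alpha> prep (\<lambda>b. of_bool (b = 0)))) = prod_state \<alpha> prep minus_amp" for \<alpha>
    unfolding prod_state_flag_gates by (rule prod_state_cong) (simp_all add: minus_amp_def)
  moreover have "fold (op_sem F) (concat (replicate k (grover_iteration m n l N rk rf))) \<psi> =
      (grover ^^ k) \<psi>" for k \<psi>
    by (induction k arbitrary: \<psi>) (simp_all add: grover_def funpow_swap1)
  ultimately show ?thesis
    by (simp add: run_online run_foldr_Do offline_def del: op_sem.simps)
qed

section \<open>Measurement of the index register\<close>

lemma outcome_prob_eq: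
  "outcome_prob F g m alg i0 =
    (\<Sum>v \<in> {v \<in> labels. idx v = i0}. (cmod ((grover ^^ iterations m) (prod_state (amplitude 0) prep minus_amp) v))\<^sup>2)"
proof -
  let ?\<Psi> = "(grover ^^ iterations m) (prod_state (amplitude 0) prep minus_amp)"
  have sup: "supported ?\<Psi>"
    using grover_iterates by blast
  have "outcome_prob F g m alg i0 = (\<Sum>\<^sub>\<infinity>v \<in> {v \<in> labels. idx v = i0}. (cmod (?\<Psi> v))\<^sup>2)"
    unfolding outcome_prob_def run_alg
    by (rule infsum_cong_neutral) (use sup in \<open>auto simp: supported_def\<close>)
  then show ?thesis by simp
qed

text \<open>\<open>S = UNIV\<close> gives the squared norm, \<open>S = {i0}\<close> the success
  probability of the ideal search.\<close>

lemma weight_prod_state: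
  "(\<Sum>v \<in> {v \<in> labels. idx v \<in> S}. (cmod (prod_state \<alpha> prep minus_amp v))\<^sup>2) =
    (\<Sum>i \<in> carrier_vec m. of_bool (i \<in> S) * (\<alpha> i)\<^sup>2)"
proof -
  let ?a = "\<lambda>i. of_bool (i \<in> S) * (\<alpha> i)\<^sup>2"
  have half: "((1 / sqrt 2) ^ n)\<^sup>2 = (1 / 2 :: real) ^ n"
    using half_power[of n 1] by (simp add: power2_eq_square)
  have "(\<Sum>z \<in> carrier_vec l. (prep j i x z)\<^sup>2) = (1 / 2) ^ n" if "x \<in> carrier_vec n" for j i x
  proof -
    have "(\<Sum>z \<in> carrier_vec l. (prep j i x z)\<^sup>2) = (\<Sum>z \<in> carrier_vec l. if z = g x then (1 / 2) ^ n else 0)"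
      by (intro sum.cong) (auto simp: prep_def half simp del: power_one_over)
    also have "\<dots> = (1 / 2) ^ n" using g[OF that] by simp
    finally show ?thesis .
  qed
  then have one: "(\<Sum>x \<in> carrier_vec n. \<Sum>z \<in> carrier_vec l. (prep j i x z)\<^sup>2) = 1" for j i
    by (simp add: card_carrier_vec_bit flip: power_mult_distrib)
  have "(\<Sum>v \<in> {v \<in> labels. idx v \<in> S}. (cmod (prod_state \<alpha> prep minus_amp v))\<^sup>2) =
      (\<Sum>v \<in> labels. of_bool (idx v \<in> S) * (cmod (prod_state \<alpha> prep minus_amp v))\<^sup>2)"
    by (rule sum.mono_neutral_cong_left) auto
  also have "\<dots> = (\<Sum>v \<in> labels. ?a (idx v) * (minus_amp (v Flag))\<^sup>2 *
        (\<Prod>j<N. (prep j (idx v) (arg j v) (val j v))\<^sup>2))"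
    by (intro sum.cong refl) (simp only: prod_state_def if_True norm_of_real power2_abs power_mult_distrib
        prod_power_distrib mult.assoc)
  also have "\<dots> = (\<Sum>i \<in> carrier_vec m. ?a i * (\<Sum>b \<in> UNIV. (minus_amp b)\<^sup>2) *
       (\<Prod>j<N. \<Sum>x \<in> carrier_vec n. \<Sum>z \<in> carrier_vec l. (prep j i x z)\<^sup>2))"
    by (rule sum_labels[where a = ?a])
  finally show ?thesis by (simp only: one sum_minus_amp prod.neutral_const mult_1_right)
qed

lemma state_dist_initial: "state_dist (prod_state (amplitude 0) prep minus_amp) (\<lambda>_. 0) = 1"
proof -
  have "(\<Sum>i \<in> carrier_vec m. (amplitude 0 i)\<^sup>2) = (\<Sum>i :: bit vec \<in> carrier_vec m. (1 / 2) ^ m)"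
    using half_power[of m 1] by (intro sum.cong refl) (simp add: amplitude_0 power2_eq_square)
  also have "\<dots> = 1"
    by (simp add: card_carrier_vec_bit flip: power_mult_distrib)
  finally show ?thesis
    using weight_prod_state[where S = UNIV and \<alpha> = "amplitude 0"] by (simp add: state_dist_def L2_set_def)
qed

text \<open>The norm is the distance from the zero state, which every operation fixes; isometry
  therefore keeps it equal to 1.\<close>

lemma outcome_prob_le_1: "outcome_prob F g m alg i0 \<le> 1"
proof -
  let ?\<Psi> = "\<lambda>k. (grover ^^ k) (prod_state (amplitude 0) prep minus_amp)"
  have zero: "op_sem F u (\<lambda>_. 0) = (\<lambda>_. 0)" for u
  proof (cases u)
    case (Gate G)
    then show ?thesis by (cases G) auto
  qed auto
  have "fold (op_sem F) us (\<lambda>_. 0) = (\<lambda>_. 0)" for us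
    by (induction us) (simp_all add: zero)
  then have zero: "grover (\<lambda>_. 0) = (\<lambda>_. 0)"
    by (simp add: grover_def)
  have "supported (?\<Psi> k) \<and> state_dist (?\<Psi> k) (\<lambda>_. 0) = 1" for k
  proof (induction k)
    case (Suc k)
    then show ?case
      using isometricD[OF isometric_grover] zero supported_zero by (metis comp_apply funpow.simps(2))
  qed (simp add: state_dist_initial)
  then have "(\<Sum>v \<in> labels. (cmod (?\<Psi> (iterations m) v))\<^sup>2) = 1"
    by (simp add: state_dist_def L2_set_def)
  moreover have "outcome_prob F g m alg i0 \<le> (\<Sum>v \<in> labels. (cmod (?\<Psi> (iterations m) v))\<^sup>2)"
    unfolding outcome_prob_eq by (intro sum_mono2) auto
  ultimately show ?thesis by simp
qed

lemma outcome_ideal: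
  "L2_set (\<lambda>v. cmod (prod_state (amplitude k) prep minus_amp v)) {v \<in> labels. idx v = i0} =
    \<bar>sin (real (2 * k + 1) * angle)\<bar>"
proof -
  have "(\<Sum>i \<in> carrier_vec m. of_bool (i \<in> {i0}) * (amplitude k i)\<^sup>2) =
      (\<Sum>i \<in> carrier_vec m. if i = i0 then (sin (real (2 * k + 1) * angle))\<^sup>2 else 0)"
    by (intro sum.cong) (auto simp: amplitude_def)
  also have "\<dots> = (sin (real (2 * k + 1) * angle))\<^sup>2"
    by (simp only: sum_other mult_zero_right add_0_right)
  finally show ?thesis
    using weight_prod_state[where S = "{i0}" and \<alpha> = "amplitude k"]
    by (simp only: L2_set_def singleton_iff real_sqrt_abs)
qed

text \<open>Triangle inequality on the component with index \<open>i0\<close>: the ideal norm is at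
  least 1/2 and the deviation at most 1/4, which leaves norm 1/4 and probability 1/16.\<close>

lemma outcome_prob_ge:
  assumes small: "pi / 4 * sqrt (2 ^ m) * err \<le> 1 / 4"
  shows "1 / 16 \<le> outcome_prob F g m alg i0"
proof -
  let ?k = "iterations m" and ?S = "{v \<in> labels. idx v = i0}"
  let ?\<Psi> = "(grover ^^ ?k) (prod_state (amplitude 0) prep minus_amp)" and ?\<Phi> = "prod_state (amplitude ?k) prep minus_amp"
  have "L2_set (\<lambda>v. cmod (?\<Psi> v - ?\<Phi> v)) ?S \<le> state_dist ?\<Psi> ?\<Phi>"
    unfolding state_dist_def L2_set_def by (intro real_sqrt_le_mono sum_mono2) auto
  also have "\<dots> \<le> real ?k * err"
    using grover_iterates by blast
  also have "\<dots> \<le> pi / 4 * sqrt (2 ^ m) * err"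
    using iterations_le by (intro mult_right_mono) (auto simp: err_def)
  finally have err: "L2_set (\<lambda>v. cmod (?\<Psi> v - ?\<Phi> v)) ?S \<le> 1 / 4"
    using small by simp
  have "1 / 2 \<le> (1 / sqrt 2 :: real)"
    using real_sqrt_le_mono[of 2 4] by (simp add: field_simps)
  also have "\<dots> \<le> L2_set (\<lambda>v. cmod (?\<Phi> v)) ?S"
    unfolding outcome_ideal by (rule final_angle)
  also have "\<dots> \<le> L2_set (\<lambda>v. cmod (?\<Psi> v) + cmod (?\<Psi> v - ?\<Phi> v)) ?S"
    by (intro L2_set_mono) (auto intro: norm_triangle_sub simp: norm_minus_commute)
  also have "\<dots> \<le> L2_set (\<lambda>v. cmod (?\<Psi> v)) ?S + L2_set (\<lambda>v. cmod (?\<Psi> v - ?\<Phi> v)) ?S"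
    by (rule L2_set_triangle_ineq)
  finally have "1 / 4 \<le> L2_set (\<lambda>v. cmod (?\<Psi> v)) ?S"
    using err by simp
  then have "(1 / 4)\<^sup>2 \<le> (L2_set (\<lambda>v. cmod (?\<Psi> v)) ?S)\<^sup>2"
    by (intro power_mono) auto
  also have "\<dots> = outcome_prob F g m alg i0"
    by (simp add: outcome_prob_eq L2_set_def sum_nonneg)
  finally show ?thesis by (simp add: power2_eq_square)
qed

end

section \<open>Query and time bounds\<close>

lemma classical_queries_foldr:
  "classical_queries g (foldr Do us Q) = classical_queries g Q"
  "classical_queries g (foldr (\<lambda>j. CondXor (xs j) (ys j) y z) js Q) = classical_queries g Q"
  by (induction us, simp_all) (induction js, simp_all)

lemma classical_queries_online:
  "classical_queries g (online n l N (foldr Do us Stop)) = 2 ^ n"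
proof -
  have "classical_queries g (foldr (\<lambda>y Q. Ask y (\<lambda>z.
      foldr (\<lambda>j. CondXor (arg_reg n j) (val_reg l j) y z) [0..<N] Q)) ys Q) =
      length ys + classical_queries g Q" for ys Q
    by (induction ys) (simp_all add: classical_queries_foldr)
  then show ?thesis
    by (simp add: online_def classical_queries_foldr all_strings_def)
qed

lemma quantum_queries_foldr:
  "quantum_queries g (foldr Do us Q) = sum_list (map op_queries us) + quantum_queries g Q"
  "quantum_queries g (foldr (\<lambda>j. CondXor (xs j) (ys j) y z) js Q) = quantum_queries g Q"
  by (induction us, simp_all) (induction js, simp_all)

lemma op_queries_gates:
  "sum_list (map op_queries (hadamards ws)) = 0" "sum_list (map op_queries (map Gate gs)) = 0"
  by (simp_all add: hadamards_def comp_def)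

lemma quantum_queries_online:
  "quantum_queries g (online n l N (foldr Do us Stop)) = sum_list (map op_queries us)"
proof -
  have "quantum_queries g (foldr (\<lambda>y Q. Ask y (\<lambda>z.
      foldr (\<lambda>j. CondXor (arg_reg n j) (val_reg l j) y z) [0..<N] Q)) ys Q) =
      quantum_queries g Q" for ys Q
    by (induction ys) (simp_all add: quantum_queries_foldr)
  then show ?thesis
    by (simp add: online_def quantum_queries_foldr op_queries_gates)
qed

lemma sum_list_concat_replicate:
  "sum_list (map f (concat (replicate k xs))) = k * (sum_list (map f xs) :: nat)"
  by (induction k) simp_all

lemma op_queries_offline:
  "sum_list (map op_queries (offline m n l N rk rf)) = iterations m * (2 * N)"
  by (simp add: offline_def sum_list_concat_replicate grover_iteration_def test_def Let_def
      op_queries_gates comp_def sum_list_triv flip: rev_map)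

lemma op_time_gates:
  "sum_list (map (op_time T) (hadamards ws)) = length ws"
  "sum_list (map (op_time T) (map Gate gs)) = length gs"
  by (simp_all add: hadamards_def comp_def sum_list_triv)

lemma offline_time_eq:
  "offline_time T c m n l rk rf = 2 * m + 2 +
    iterations m * (2 * (c * n * T + c * n * n) + length rk + 2 * m + length rf)"
proof -
  have "length (concat (map (arg_reg n) [0..<N])) = N * n" for N
    by (simp add: length_concat comp_def sum_list_triv)
  then show ?thesis
    by (simp add: offline_time_def offline_def sum_list_concat_replicate grover_iteration_def test_def
        Let_def op_time_gates comp_def sum_list_triv flip: rev_map)
qed

lemma iterations_le_powr: "real (iterations m) \<le> 2 powr (real m / 2)"
proof -
  have "pi / 4 * sqrt (2 ^ m) \<le> 1 * sqrt (2 ^ m)"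
    using pi_less_4 by (intro mult_right_mono) auto
  also have "\<dots> = 2 powr (real m / 2)"
    by (simp add: powr_half_sqrt_powr powr_realpow)
  finally show ?thesis using iterations_le[of m] by linarith
qed

text \<open>The product under the root is at most the \<open>n\<close>-th power of a number not
  exceeding 1/64, hence at most 1/64 as \<open>n \<ge> 1\<close>. Its root is 1/8, and the remaining
  factor \<open>pi / 2\<close> is at most 2.\<close>

lemma total_error_small:
  fixes a :: real
  assumes c: "2 powr (a + 1) * (3 / 4) ^ c \<le> 1 / 64" and n: "n \<ge> 1" and m: "real m \<le> a * real n"
  shows "pi / 4 * sqrt (2 ^ m) * (2 * sqrt (2 ^ n * (3 / 4) ^ (c * n))) \<le> 1 / 4"
proof -
  have "(2 :: real) ^ m \<le> (2 powr a) ^ n"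
    using m by (simp add: powr_powr flip: powr_realpow)
  then have "2 ^ m * (2 ^ n * (3 / 4) ^ (c * n)) \<le> (2 powr a) ^ n * (2 ^ n * (3 / 4 :: real) ^ (c * n))"
    by (intro mult_right_mono) auto
  also have "\<dots> = (2 powr (a + 1) * (3 / 4) ^ c) ^ n"
    by (simp add: powr_add power_mult power_mult_distrib mult_ac)
  also have "\<dots> \<le> (1 / 64) ^ n"
    using c by (intro power_mono) auto
  also have "\<dots> \<le> (1 / 64) ^ 1"
    using n by (intro power_decreasing) auto
  finally have "sqrt (2 ^ m * (2 ^ n * (3 / 4) ^ (c * n))) \<le> sqrt ((1 / 8)\<^sup>2)"
    by (intro real_sqrt_le_mono) (simp add: power2_eq_square)
  then have "sqrt (2 ^ m) * sqrt (2 ^ n * (3 / 4) ^ (c * n)) \<le> 1 / 8"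
    by (simp only: real_sqrt_mult real_sqrt_abs)
  then have "pi / 2 * (sqrt (2 ^ m) * sqrt (2 ^ n * (3 / 4) ^ (c * n))) \<le> 2 * (1 / 8)"
    using pi_less_4 by (intro mult_mono) auto
  then show ?thesis by (simp add: mult_ac)
qed

text \<open>Lower powers of \<open>n\<close> are absorbed into \<open>n ^ 3\<close>. In each
  iteration the rank circuit yields \<open>10 c + 6\<close>, the Hadamard gates on the arguments
  \<open>2 c\<close>, and the \<open>8 m + 4\<close> gates of the diffusion \<open>8 a + 4\<close>.
  The operations outside the iterations add \<open>2 a + 2\<close>.\<close>

lemma offline_time_bound:
  fixes a :: real
  assumes n: "n \<ge> 1" and m: "real m \<le> a * real n"
    and rk: "length rk = 2 * (c * n * (n * (2 * n + 3)) + n + 1) + 2"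
    and rf: "length rf = 6 * m + 4"
  shows "real (offline_time T c m n l rk rf) \<le>
    (12 * real c + 14 + 10 * a) * ((real n ^ 3 + real n * real T) * 2 powr (real m / 2))"
proof -
  let ?n = "real n" and ?Z = "2 powr (real m / 2)"
  have n1: "1 \<le> ?n" and a: "0 \<le> a"
    using n m by (auto simp: zero_le_mult_iff dest: order_trans[of 0 "real m", rotated])
  have cube: "?n * ?n \<le> ?n ^ 3" "?n \<le> ?n ^ 3" "1 \<le> ?n ^ 3"
    using n1 power_increasing[of 2 3 ?n] power_increasing[of 1 3 ?n] one_le_power[of ?n 3]
    by (simp_all add: power2_eq_square)
  have m3: "real m \<le> a * ?n ^ 3"
    using m mult_left_mono[OF cube(2) a] by linarith
  have c2: "real c * (?n * ?n) \<le> real c * ?n ^ 3"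
    using cube(1) by (intro mult_left_mono) auto
  have rk3: "real (length rk) \<le> (10 * real c + 6) * ?n ^ 3"
  proof -
    have "real (length rk) = 4 * (real c * ?n ^ 3) + 6 * (real c * (?n * ?n)) + 2 * ?n + 4"
      by (simp add: rk power3_eq_cube algebra_simps)
    also have "\<dots> \<le> 10 * (real c * ?n ^ 3) + 6 * ?n ^ 3"
      using c2 cube by linarith
    finally show ?thesis by (simp only: distrib_right mult.assoc)
  qed
  have Z: "1 \<le> ?Z" by (simp add: ge_one_powr_ge_zero)
  let ?body = "2 * (real c * ?n * real T + real c * ?n * ?n) + real (length rk) + 2 * real m + real (length rf)"
  have body: "?body \<le> 2 * real c * (?n * real T) + (12 * real c + 10 + 8 * a) * ?n ^ 3"
    using rk3 m3 c2 cube by (simp add: rf algebra_simps)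
  have "real (offline_time T c m n l rk rf) = 2 * real m + 2 + real (iterations m) * ?body"
    by (simp add: offline_time_eq)
  also have "\<dots> \<le> (2 * a + 2) * ?n ^ 3 * ?Z + ?Z * ?body"
  proof (intro add_mono mult_right_mono iterations_le_powr)
    have "2 * real m + 2 \<le> (2 * a + 2) * ?n ^ 3"
      using m3 cube by (simp add: algebra_simps)
    also have "\<dots> \<le> (2 * a + 2) * ?n ^ 3 * ?Z"
      using mult_left_mono[OF Z, of "(2 * a + 2) * ?n ^ 3"] a by simp
    finally show "2 * real m + 2 \<le> (2 * a + 2) * ?n ^ 3 * ?Z" .
  qed simp
  also have "\<dots> \<le> (2 * a + 2) * ?n ^ 3 * ?Z + ?Z * (2 * real c * (?n * real T) + (12 * real c + 10 + 8 * a) * ?n ^ 3)"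
    using body by (intro add_left_mono mult_left_mono) auto
  also have "\<dots> = (2 * real c * (?n * real T) + (12 * real c + 12 + 10 * a) * ?n ^ 3) * ?Z"
    by (simp add: algebra_simps)
  also have "\<dots> \<le> ((12 * real c + 14 + 10 * a) * (?n * real T) + (12 * real c + 14 + 10 * a) * ?n ^ 3) * ?Z"
    using a by (intro mult_right_mono add_mono) auto
  finally show ?thesis by (simp add: algebra_simps)
qed

theorem proposition3:
  fixes a :: real
  shows "\<exists>c0 > 0. \<forall>c \<ge> c0. \<exists>p > 0. \<exists>K :: real. \<forall>n \<ge> 1. \<forall>m. real m \<le> a * real n \<longrightarrow>
    (\<exists>rk rf. rank_circuit n (c * n) rk \<and> reflection_circuit m rf \<and>
      (\<forall>l F g i0 T\<^sub>F.
         (\<forall>i \<in> carrier_vec m. F i \<in> carrier_vec n \<rightarrow> carrier_vec l) \<longrightarrow>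
         g \<in> carrier_vec n \<rightarrow> carrier_vec l \<longrightarrow>
         i0 \<in> carrier_vec m \<longrightarrow>
         (\<forall>i \<in> carrier_vec m. has_period n (\<lambda>x. F i x + g x) \<longleftrightarrow> i = i0) \<longrightarrow>
         (\<forall>i \<in> carrier_vec m - {i0}. \<forall>t \<in> carrier_vec n - {0\<^sub>v n}.
            measure_pmf.prob (pmf_of_set (carrier_vec n))
              {x. F i (x + t) + g (x + t) = F i x + g x} \<le> 1 / 2) \<longrightarrow>
         outcome_prob F g m (Alg_ExpQ1 c m n l rk rf) i0 \<in> {p..1} \<and>
         real (classical_queries g (Alg_ExpQ1 c m n l rk rf)) \<le> K * 2 ^ n \<and>
         real (quantum_queries g (Alg_ExpQ1 c m n l rk rf))
           \<le> K * (real n * 2 powr (real m / 2)) \<and>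
         real (offline_time T\<^sub>F c m n l rk rf)
           \<le> K * ((real n ^ 3 + real n * real T\<^sub>F) * 2 powr (real m / 2))))"
proof -
  \<comment> \<open>This is the hypothesis of \<open>total_error_small\<close> in strict form. The
    witness \<open>Suc k\<close> is used below because it must be positive.\<close>
  obtain k where k: "(3 / 4 :: real) ^ k < 1 / (64 * 2 powr (a + 1))"
    using real_arch_pow_inv[of "1 / (64 * 2 powr (a + 1))" "3 / 4"] by auto
  show ?thesis
  proof (rule exI[of _ "Suc k"], intro conjI allI impI)
    fix c assume c: "c \<ge> Suc k"
    have "(3 / 4 :: real) ^ c \<le> (3 / 4) ^ k"
      using c by (intro power_decreasing) auto
    also note k
    finally have "2 powr (a + 1) * (3 / 4) ^ c \<le> 2 powr (a + 1) * (1 / (64 * 2 powr (a + 1)))"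
      by (intro mult_left_mono) auto
    then have small: "2 powr (a + 1) * (3 / 4) ^ c \<le> 1 / 64"
      by simp
    \<comment> \<open>\<open>K\<close> is fixed before \<open>n\<close> and \<open>m\<close>. The
      absolute value keeps it positive also for negative \<open>a\<close>, for which no
      \<open>m\<close> qualifies.\<close>
    define K where "K = 12 * real c + 14 + 10 * \<bar>a\<bar>"
    show "\<exists>p > 0. \<exists>K :: real. \<forall>n \<ge> 1. \<forall>m. real m \<le> a * real n \<longrightarrow>
    (\<exists>rk rf. rank_circuit n (c * n) rk \<and> reflection_circuit m rf \<and>
      (\<forall>l F g i0 T\<^sub>F.
         (\<forall>i \<in> carrier_vec m. F i \<in> carrier_vec n \<rightarrow> carrier_vec l) \<longrightarrow>
         g \<in> carrier_vec n \<rightarrow> carrier_vec l \<longrightarrow>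
         i0 \<in> carrier_vec m \<longrightarrow>
         (\<forall>i \<in> carrier_vec m. has_period n (\<lambda>x. F i x + g x) \<longleftrightarrow> i = i0) \<longrightarrow>
         (\<forall>i \<in> carrier_vec m - {i0}. \<forall>t \<in> carrier_vec n - {0\<^sub>v n}.
            measure_pmf.prob (pmf_of_set (carrier_vec n))
              {x. F i (x + t) + g (x + t) = F i x + g x} \<le> 1 / 2) \<longrightarrow>
         outcome_prob F g m (Alg_ExpQ1 c m n l rk rf) i0 \<in> {p..1} \<and>
         real (classical_queries g (Alg_ExpQ1 c m n l rk rf)) \<le> K * 2 ^ n \<and>
         real (quantum_queries g (Alg_ExpQ1 c m n l rk rf))
           \<le> K * (real n * 2 powr (real m / 2)) \<and>
         real (offline_time T\<^sub>F c m n l rk rf)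
           \<le> K * ((real n ^ 3 + real n * real T\<^sub>F) * 2 powr (real m / 2))))"
    proof (rule exI[of _ "1 / 16"], intro conjI exI[of _ K] allI impI)
      fix n m assume n: "1 \<le> (n :: nat)" and m: "real m \<le> a * real n"
      \<comment> \<open>The circuits depend only on \<open>n\<close>, \<open>c\<close> and
        \<open>m\<close>, so one choice serves all oracles.\<close>
      let ?rk = "rank_gates n (c * n)" and ?rf = "reflection_gates m"
      have "0 \<le> a * real n" using m by linarith
      then have a: "\<bar>a\<bar> = a" using n by (simp add: zero_le_mult_iff)
      have time: "real (offline_time T c m n l ?rk ?rf)
          \<le> K * ((real n ^ 3 + real n * real T) * 2 powr (real m / 2))" for T l
        unfolding K_def a using n m length_rank_gates length_reflection_gates by (rule offline_time_bound)
      have classical: "real (classical_queries g (Alg_ExpQ1 c m n l ?rk ?rf)) \<le> K * 2 ^ n" for g l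
        unfolding Alg_ExpQ1_def classical_queries_online by (simp add: K_def)
      have quantum: "real (quantum_queries g (Alg_ExpQ1 c m n l ?rk ?rf))
           \<le> K * (real n * 2 powr (real m / 2))" for g l
      proof -
        have "real (quantum_queries g (Alg_ExpQ1 c m n l ?rk ?rf)) =
            2 * real c * (real n * real (iterations m))"
          by (simp add: Alg_ExpQ1_def quantum_queries_online op_queries_offline)
        also have "\<dots> \<le> K * (real n * 2 powr (real m / 2))"
          using iterations_le_powr by (intro mult_mono) (auto simp: K_def)
        finally show ?thesis .
      qed
      have outcome: "outcome_prob F g m (Alg_ExpQ1 c m n l ?rk ?rf) i0 \<in> {1 / 16..1}"
        if F: "\<forall>i \<in> carrier_vec m. F i \<in> carrier_vec n \<rightarrow> carrier_vec l"
          and g: "g \<in> carrier_vec n \<rightarrow> carrier_vec l" and i0: "i0 \<in> carrier_vec m"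
          and per: "\<forall>i \<in> carrier_vec m. has_period n (\<lambda>x. F i x + g x) \<longleftrightarrow> i = i0"
          and pr: "\<forall>i \<in> carrier_vec m - {i0}. \<forall>t \<in> carrier_vec n - {0\<^sub>v n}.
            measure_pmf.prob (pmf_of_set (carrier_vec n))
              {x. F i (x + t) + g (x + t) = F i x + g x} \<le> 1 / 2" for l F g i0
      proof -
        interpret search m n l "c * n" F g i0 ?rk ?rf
          by unfold_locales
            (use F g i0 per pr rank_circuit_rank_gates reflection_circuit_reflection_gates in auto)
        show ?thesis
          using outcome_prob_ge outcome_prob_le_1 total_error_small[OF small n m]
          by (simp add: Alg_ExpQ1_def err_def)
      qed
      show "\<exists>rk rf. rank_circuit n (c * n) rk \<and> reflection_circuit m rf \<and>
      (\<forall>l F g i0 T\<^sub>F.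
         (\<forall>i \<in> carrier_vec m. F i \<in> carrier_vec n \<rightarrow> carrier_vec l) \<longrightarrow>
         g \<in> carrier_vec n \<rightarrow> carrier_vec l \<longrightarrow>
         i0 \<in> carrier_vec m \<longrightarrow>
         (\<forall>i \<in> carrier_vec m. has_period n (\<lambda>x. F i x + g x) \<longleftrightarrow> i = i0) \<longrightarrow>
         (\<forall>i \<in> carrier_vec m - {i0}. \<forall>t \<in> carrier_vec n - {0\<^sub>v n}.
            measure_pmf.prob (pmf_of_set (carrier_vec n))
              {x. F i (x + t) + g (x + t) = F i x + g x} \<le> 1 / 2) \<longrightarrow>
         outcome_prob F g m (Alg_ExpQ1 c m n l rk rf) i0 \<in> {1 / 16..1} \<and>
         real (classical_queries g (Alg_ExpQ1 c m n l rk rf)) \<le> K * 2 ^ n \<and>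
         real (quantum_queries g (Alg_ExpQ1 c m n l rk rf))
           \<le> K * (real n * 2 powr (real m / 2)) \<and>
         real (offline_time T\<^sub>F c m n l rk rf)
           \<le> K * ((real n ^ 3 + real n * real T\<^sub>F) * 2 powr (real m / 2)))"
        by (rule exI[of _ ?rk], rule exI[of _ ?rf], intro conjI allI impI
            rank_circuit_rank_gates reflection_circuit_reflection_gates outcome classical quantum time)
    qed simp
  qed simp
qed

end
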